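(* Let $G$ be a finite group, let $k$ be a field of characteristic $0$ or of prime characteristic $p$ not dividing $|G|$, and let $M:\mathcal O(G)\to k\text{-Mod}$ be a covariant coefficient system. Let $X$ be a pointed $G$-space. Then (a) $\alpha_X=|\alpha_{\mathcal S(X)}|:\overline F^G(X,M)=|\overline F^G(\mathcal S(X),M)|\to|F^G(\mathcal S(X),M)|=F^G(X,M)$, and (b) $\alpha_X:\widehat{\mathbb F}^G(X,M)\to\mathbb F^G(X,M)$ are isomorphisms of topological groups.
   Context: Spaces. Topological groups are taken in the category of k-spaces ($X$ is a k-space if $W\subset X$ is closed whenever $f^{-1}(W)$ is closed for every continuous $f:Z\to X$, $Z$ compact Hausdorff; products are k-ified). Here $X$ need not be a k-space. An identification is a quotient map. Pointed $G$-spaces and pointed $G$-sets have a $G$-fixed base point $x_0$; $G_x$ is the isotropy group of $x$. Algebra. $\mathcal O(G)$ is the orbit category (objects $G/H$; morphisms $G$-functions); $M_*(\alpha)$ is the homomorphism induced by $\alpha$. For a pointed $G$-set $S$, $F(S,M)$ is the module of functions $u:S\to\bigcup_{H\subset G}M(G/H)$ with $u(x)\in M(G/G_x)$, $u(x_0)=0$ and $u(x)=0$ for all but finitely many $x$; $lx$ ($l\in M(G/G_x)$) is the function with value $l$ at $x$ and $0$ elsewhere ($lx_0=0$). For a pointed $G$-function $f:S\to T$, $f_*(lx)=M_*(\widehat f_x)(l)f(x)$, with $\widehat f_x:G/G_x\to G/G_{f(x)}$ the canonical projection. $G$ acts by $g\cdot(lx)=M_*(R_{g^{-1}})(l)(gx)$,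 where $R_{g^{-1}}:G/G_x\to G/G_{gx}$, $aG_x\mapsto ag^{-1}G_{gx}$. $\overline F^G(S,M)$ is the fixed submodule $F(S,M)^G$ with $\overline f^G_*$ the restriction of $f_*$, and $\iota_S:\overline F^G(S,M)\hookrightarrow F(S,M)$ is the inclusion. $\beta_S:F(S,M)\to F(S,M)^G$ is the surjection $\beta_S(lx)=\gamma^G_x(l)=\sum_{[g]\in G/G_x}M_*(R_{g^{-1}})(l)(gx)$. $F^G(S,M)$ is the same module $F(S,M)^G$, but with functoriality $f^G_*(\gamma^G_x(l))=\gamma^G_{f(x)}(M_*(\widehat f_x)(l))$. Put $\alpha_S=\beta_S\circ\iota_S:\overline F^G(S,M)\to F^G(S,M)$. All these are natural in $S$, so they apply degreewise to simplicial pointed $G$-sets, giving simplicial groups and homomorphisms. Topological groups. $\mathcal S(X)$ is the singular simplicial pointed $G$-set of $X$; $|\cdot|$ is geometric realization. Set $F(X,M)=|F(\mathcal S(X),M)|$, $\overline F^G(X,M)=|\overline F^G(\mathcal S(X),M)|$, $F^G(X,M)=|F^G(\mathcal S(X),M)|$. Let $X^\delta$ be the underlying $G$-set of $X$. $\mathbb F(X,M)$ is $F(X^\delta,M)$ with the identification topology given by the surjective homomorphism $\pi_X:|F(\mathcal S(X),M)|\to F(X^\delta,M)$, $\pi_X([l\sigma,t])=M_*(p_{\sigma,t})(l)\sigma(t)$, where $p_{\sigma,t}:G/G_\sigma\to G/G_{\sigma(t)}$ is the canonical projection. $\mathbb F^G(X,M)$ is $F^G(X^\delta,M)$ with the quotient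 topology induced by $\beta_X=\beta_{X^\delta}:\mathbb F(X,M)\to F^G(X^\delta,M)$. $\widehat{\mathbb F}^G(X,M)$ is $\overline F^G(X^\delta,M)$ with the identification topology given by the restriction $\widehat\pi^G_X:|\overline F^G(\mathcal S(X),M)|\to\overline F^G(X^\delta,M)$ of $\pi_X$. In (b), $\alpha_X=\alpha_{X^\delta}=\beta_{X^\delta}\circ\iota_{X^\delta}$. *)

theory Defs
  imports "HOL-Analysis.Abstract_Topological_Spaces" "HOL-Homology.Simplices" "HOL-Algebra.Group_Action" "HOL-Algebra.Left_Coset"
    "HOL-Algebra.Module" "HOL-Computational_Algebra.Primes"
begin

section \<open>Topological groups in the category of k-spaces\<close>

definition identification_topology :: "'a topology \<Rightarrow> ('a \<Rightarrow> 'b) \<Rightarrow> 'b topology" where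
  "identification_topology X q =
     topology (\<lambda>U. U \<subseteq> q ` topspace X \<and> openin X {x \<in> topspace X. q x \<in> U})"

lemma istopology_identification:
  "istopology (\<lambda>U. U \<subseteq> q ` topspace X \<and> openin X {x \<in> topspace X. q x \<in> U})"
proof -
  have 1: "{x \<in> topspace X. q x \<in> S \<inter> T} =
      {x \<in> topspace X. q x \<in> S} \<inter> {x \<in> topspace X. q x \<in> T}" for S T
    by auto
  have 2: "{x \<in> topspace X. q x \<in> \<Union>\<K>} = (\<Union>K\<in>\<K>. {x \<in> topspace X. q x \<in> K})" for \<K>
    by auto
  show ?thesis
    unfolding istopology_def 1 2 by blast
qed

lemma openin_identification_topology:
  "openin (identification_topology X q) U \<longleftrightarrow>
     U \<subseteq> q ` topspace X \<and> openin X {x \<in> topspace X. q x \<in> U}"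
  by (simp add: identification_topology_def istopology_identification)

lemma topspace_identification_topology:
  "topspace (identification_topology X q) = q ` topspace X"
proof -
  have "{x \<in> topspace X. q x \<in> q ` topspace X} = topspace X"
    by auto
  then have "openin (identification_topology X q) (q ` topspace X)"
    by (simp add: openin_identification_topology)
  then show ?thesis
    by (metis openin_identification_topology openin_subset openin_topspace subset_antisym)
qed

lemma quotient_map_identification_topology:
  "quotient_map X (identification_topology X q) q"
  by (simp add: quotient_map_def topspace_identification_topology openin_identification_topology)

text \<open>The library's \<^const>\<open>k_space\<close> tests closedness on compact subspaces; the notion needed here
  tests along continuous maps from compact Hausdorff spaces, which differs for spaces that are not
  Hausdorff. As one cannot quantify over types inside a definition, the type
  \<^typ>\<open>'z\<close> that carries the test spaces is a parameter: it plays the role of the universe of sets.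
  Instances of the form \<^typ>\<open>'z + (nat \<Rightarrow> real)\<close> with arbitrary \<^typ>\<open>'z\<close> range, up to bijection,
  over all universes that have room for the standard simplices.\<close>

definition kspace :: "'z itself \<Rightarrow> 'a topology \<Rightarrow> bool" where
  "kspace TYPE('z) X \<longleftrightarrow>
     (\<forall>W \<subseteq> topspace X.
        (\<forall>(Z :: 'z topology) f. compact_space Z \<and> Hausdorff_space Z \<and> continuous_map Z X f
            \<longrightarrow> closedin Z {z \<in> topspace Z. f z \<in> W})
        \<longrightarrow> closedin X W)"

definition kify :: "'z itself \<Rightarrow> 'a topology \<Rightarrow> 'a topology" where
  "kify TYPE('z) X =
     topology (\<lambda>U. U \<subseteq> topspace X \<and>
        (\<forall>(Z :: 'z topology) f. compact_space Z \<and> Hausdorff_space Z \<and> continuous_map Z X f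
            \<longrightarrow> openin Z {z \<in> topspace Z. f z \<in> U}))"

lemma istopology_kify:
  "istopology (\<lambda>U. U \<subseteq> topspace X \<and>
        (\<forall>(Z :: 'z topology) f. compact_space Z \<and> Hausdorff_space Z \<and> continuous_map Z X f
            \<longrightarrow> openin Z {z \<in> topspace Z. f z \<in> U}))"
proof -
  have 1: "{z \<in> topspace Z. f z \<in> S \<inter> T} =
      {z \<in> topspace Z. f z \<in> S} \<inter> {z \<in> topspace Z. f z \<in> T}"
    for S T and Z :: "'z topology" and f :: "'z \<Rightarrow> 'a"
    by auto
  have 2: "{z \<in> topspace Z. f z \<in> \<Union>\<K>} = (\<Union>K\<in>\<K>. {z \<in> topspace Z. f z \<in> K})"
    for \<K> and Z :: "'z topology" and f :: "'z \<Rightarrow> 'a"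
    by auto
  show ?thesis
    unfolding istopology_def 1 2 by blast
qed

lemma openin_kify:
  "openin (kify TYPE('z) X) U \<longleftrightarrow> U \<subseteq> topspace X \<and>
     (\<forall>(Z :: 'z topology) f. compact_space Z \<and> Hausdorff_space Z \<and> continuous_map Z X f
         \<longrightarrow> openin Z {z \<in> topspace Z. f z \<in> U})"
  by (simp only: kify_def topology_inverse'[OF istopology_kify])

definition k_topological_group ::
    "'z itself \<Rightarrow> ('a, 'b) monoid_scheme \<Rightarrow> 'a topology \<Rightarrow> bool" where
  "k_topological_group TYPE('z) A T \<longleftrightarrow>
     group A \<and> topspace T = carrier A \<and> kspace TYPE('z) T \<and>
     continuous_map (kify TYPE('z) (prod_topology T T)) T (\<lambda>(x, y). x \<otimes>\<^bsub>A\<^esub> y) \<and>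
     continuous_map T T (\<lambda>x. inv\<^bsub>A\<^esub> x)"

definition topological_group_iso ::
    "'z itself \<Rightarrow> ('a, 'c) monoid_scheme \<Rightarrow> 'a topology \<Rightarrow> ('b, 'd) monoid_scheme \<Rightarrow> 'b topology
      \<Rightarrow> ('a \<Rightarrow> 'b) \<Rightarrow> bool" where
  "topological_group_iso TYPE('z) A T B U f \<longleftrightarrow>
     k_topological_group TYPE('z) A T \<and> k_topological_group TYPE('z) B U \<and>
     f \<in> iso A B \<and> homeomorphic_map T U f"


section \<open>Coefficient systems\<close>

definition ring_char :: "('k, 'b) ring_scheme \<Rightarrow> nat" where
  "ring_char R =
     (if \<exists>n::nat. 0 < n \<and> [n] \<cdot>\<^bsub>R\<^esub> \<one>\<^bsub>R\<^esub> = \<zero>\<^bsub>R\<^esub>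
      then LEAST n::nat. 0 < n \<and> [n] \<cdot>\<^bsub>R\<^esub> \<one>\<^bsub>R\<^esub> = \<zero>\<^bsub>R\<^esub>
      else 0)"

definition linear_maps ::
    "('k, 'b) ring_scheme \<Rightarrow> ('k, 'v, 'c) module_scheme \<Rightarrow> ('k, 'w, 'd) module_scheme
      \<Rightarrow> ('v \<Rightarrow> 'w) set" where
  "linear_maps R V W =
     {f \<in> carrier V \<rightarrow> carrier W.
        (\<forall>x\<in>carrier V. \<forall>y\<in>carrier V. f (x \<oplus>\<^bsub>V\<^esub> y) = f x \<oplus>\<^bsub>W\<^esub> f y) \<and>
        (\<forall>r\<in>carrier R. \<forall>x\<in>carrier V. f (r \<odot>\<^bsub>V\<^esub> x) = r \<odot>\<^bsub>W\<^esub> f x)}"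

definition orbit_objects :: "('g, 'a) monoid_scheme \<Rightarrow> 'g set set set" where
  "orbit_objects G = {lcosets\<^bsub>G\<^esub> H |H. subgroup H G}"

definition orbit_morphisms ::
    "('g, 'a) monoid_scheme \<Rightarrow> 'g set set \<Rightarrow> 'g set set \<Rightarrow> ('g set \<Rightarrow> 'g set) set" where
  "orbit_morphisms G A B =
     {f \<in> A \<rightarrow>\<^sub>E B. \<forall>g\<in>carrier G. \<forall>C\<in>A. f (g <#\<^bsub>G\<^esub> C) = g <#\<^bsub>G\<^esub> f C}"

text \<open>\<open>obj M A\<close> is $M(A)$ and \<open>mor M A B f\<close> is $M_*(f)$ for $f: A \to B$. The modules have explicit
  carriers, so that a single type \<^typ>\<open>'m\<close> for the elements of all of them is no restriction.\<close>

record ('g, 'k, 'm) coefficients =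
  obj :: "'g set set \<Rightarrow> ('k, 'm) module"
  mor :: "'g set set \<Rightarrow> 'g set set \<Rightarrow> ('g set \<Rightarrow> 'g set) \<Rightarrow> 'm \<Rightarrow> 'm"

definition coefficient_system ::
    "('g, 'a) monoid_scheme \<Rightarrow> ('k, 'b) ring_scheme \<Rightarrow> ('g, 'k, 'm) coefficients \<Rightarrow> bool" where
  "coefficient_system G k M \<longleftrightarrow>
     (\<forall>A\<in>orbit_objects G. module k (obj M A)) \<and>
     (\<forall>A\<in>orbit_objects G. \<forall>B\<in>orbit_objects G. \<forall>f\<in>orbit_morphisms G A B.
        mor M A B f \<in> linear_maps k (obj M A) (obj M B)) \<and>
     (\<forall>A\<in>orbit_objects G. \<forall>l\<in>carrier (obj M A). mor M A A (\<lambda>C\<in>A. C) l = l) \<and>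
     (\<forall>A\<in>orbit_objects G. \<forall>B\<in>orbit_objects G. \<forall>D\<in>orbit_objects G.
        \<forall>f\<in>orbit_morphisms G A B. \<forall>h\<in>orbit_morphisms G B D. \<forall>l\<in>carrier (obj M A).
          mor M A D (compose A h f) l = mor M B D h (mor M A B f l))"


section \<open>The modules of functions on a pointed G-set\<close>

record ('g, 'x) pointed_gset =
  pts :: "'x set"
  gact :: "'g \<Rightarrow> 'x \<Rightarrow> 'x"
  base :: "'x"

abbreviation isotropy :: "('g, 'a) monoid_scheme \<Rightarrow> ('g, 'x) pointed_gset \<Rightarrow> 'x \<Rightarrow> 'g set" where
  "isotropy G S x \<equiv> stabilizer G (gact S) x"

text \<open>The $G$-set $G/G_x$.\<close>

abbreviation orb :: "('g, 'a) monoid_scheme \<Rightarrow> ('g, 'x) pointed_gset \<Rightarrow> 'x \<Rightarrow> 'g set set" where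
  "orb G S x \<equiv> lcosets\<^bsub>G\<^esub> (isotropy G S x)"

abbreviation coef ::
    "('g, 'a) monoid_scheme \<Rightarrow> ('g, 'k, 'm) coefficients \<Rightarrow> ('g, 'x) pointed_gset \<Rightarrow> 'x
      \<Rightarrow> ('k, 'm) module" where
  "coef G M S x \<equiv> obj M (orb G S x)"

definition supp ::
    "('g, 'a) monoid_scheme \<Rightarrow> ('g, 'k, 'm) coefficients \<Rightarrow> ('g, 'x) pointed_gset \<Rightarrow> ('x \<Rightarrow> 'm)
      \<Rightarrow> 'x set" where
  "supp G M S u = {x \<in> pts S. u x \<noteq> \<zero>\<^bsub>coef G M S x\<^esub>}"

text \<open>The fields \<open>mult\<close> and \<open>one\<close>, inherited from rings, are irrelevant for modules.\<close>

definition Fmod ::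
    "('g, 'a) monoid_scheme \<Rightarrow> ('g, 'k, 'm) coefficients \<Rightarrow> ('g, 'x) pointed_gset
      \<Rightarrow> ('k, 'x \<Rightarrow> 'm) module" where
  "Fmod G M S =
     \<lparr>carrier = {u \<in> (\<Pi>\<^sub>E x\<in>pts S. carrier (coef G M S x)).
                   u (base S) = \<zero>\<^bsub>coef G M S (base S)\<^esub> \<and> finite (supp G M S u)},
      monoid.mult = undefined, one = undefined,
      zero = (\<lambda>x\<in>pts S. \<zero>\<^bsub>coef G M S x\<^esub>),
      add = (\<lambda>u v. \<lambda>x\<in>pts S. u x \<oplus>\<^bsub>coef G M S x\<^esub> v x),
      smult = (\<lambda>r u. \<lambda>x\<in>pts S. r \<odot>\<^bsub>coef G M S x\<^esub> u x)\<rparr>"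

text \<open>The function $lx$.\<close>

definition gen ::
    "('g, 'a) monoid_scheme \<Rightarrow> ('g, 'k, 'm) coefficients \<Rightarrow> ('g, 'x) pointed_gset \<Rightarrow> 'm \<Rightarrow> 'x
      \<Rightarrow> ('x \<Rightarrow> 'm)" where
  "gen G M S l x =
     (\<lambda>y\<in>pts S. if y = x \<and> x \<noteq> base S then l else \<zero>\<^bsub>coef G M S y\<^esub>)"

text \<open>The extension of $lx \mapsto t\,l\,x$ to all of $F(S,M)$, using $u = \sum_x u(x)x$.\<close>

definition lin_ext ::
    "('g, 'a) monoid_scheme \<Rightarrow> ('g, 'k, 'm) coefficients \<Rightarrow> ('g, 'x) pointed_gset
      \<Rightarrow> ('k, 'n) module \<Rightarrow> ('m \<Rightarrow> 'x \<Rightarrow> 'n) \<Rightarrow> ('x \<Rightarrow> 'm) \<Rightarrow> 'n" where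
  "lin_ext G M S N t = (\<lambda>u\<in>carrier (Fmod G M S). \<Oplus>\<^bsub>N\<^esub>x\<in>supp G M S u. t (u x) x)"

text \<open>$G/H \to G/K$, $aH \mapsto aK$, where $H \subseteq K$.\<close>

definition orb_proj ::
    "('g, 'a) monoid_scheme \<Rightarrow> 'g set \<Rightarrow> 'g set \<Rightarrow> 'g set \<Rightarrow> 'g set" where
  "orb_proj G H K = (\<lambda>C\<in>lcosets\<^bsub>G\<^esub> H. C <#>\<^bsub>G\<^esub> K)"

text \<open>$R_b: G/H \to G/K$, $aH \mapsto abK$, where $Hb \subseteq bK$.\<close>

definition orb_shift ::
    "('g, 'a) monoid_scheme \<Rightarrow> 'g set \<Rightarrow> 'g set \<Rightarrow> 'g \<Rightarrow> 'g set \<Rightarrow> 'g set" where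
  "orb_shift G H K b = (\<lambda>C\<in>lcosets\<^bsub>G\<^esub> H. (C #>\<^bsub>G\<^esub> b) <#>\<^bsub>G\<^esub> K)"

text \<open>$M_*(\widehat f_x)$ and $M_*(R_{g^{-1}})$ on $M(G/G_x)$.\<close>

definition coef_push ::
    "('g, 'a) monoid_scheme \<Rightarrow> ('g, 'k, 'm) coefficients \<Rightarrow> ('g, 'x) pointed_gset
      \<Rightarrow> ('g, 'y) pointed_gset \<Rightarrow> ('x \<Rightarrow> 'y) \<Rightarrow> 'x \<Rightarrow> 'm \<Rightarrow> 'm" where
  "coef_push G M S T f x =
     mor M (orb G S x) (orb G T (f x)) (orb_proj G (isotropy G S x) (isotropy G T (f x)))"

definition coef_act ::
    "('g, 'a) monoid_scheme \<Rightarrow> ('g, 'k, 'm) coefficients \<Rightarrow> ('g, 'x) pointed_gset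
      \<Rightarrow> 'g \<Rightarrow> 'x \<Rightarrow> 'm \<Rightarrow> 'm" where
  "coef_act G M S g x =
     mor M (orb G S x) (orb G S (gact S g x))
       (orb_shift G (isotropy G S x) (isotropy G S (gact S g x)) (inv\<^bsub>G\<^esub> g))"

definition Fpush ::
    "('g, 'a) monoid_scheme \<Rightarrow> ('g, 'k, 'm) coefficients \<Rightarrow> ('g, 'x) pointed_gset
      \<Rightarrow> ('g, 'y) pointed_gset \<Rightarrow> ('x \<Rightarrow> 'y) \<Rightarrow> ('x \<Rightarrow> 'm) \<Rightarrow> ('y \<Rightarrow> 'm)" where
  "Fpush G M S T f =
     lin_ext G M S (Fmod G M T) (\<lambda>l x. gen G M T (coef_push G M S T f x l) (f x))"

definition Fact ::
    "('g, 'a) monoid_scheme \<Rightarrow> ('g, 'k, 'm) coefficients \<Rightarrow> ('g, 'x) pointed_gset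
      \<Rightarrow> 'g \<Rightarrow> ('x \<Rightarrow> 'm) \<Rightarrow> ('x \<Rightarrow> 'm)" where
  "Fact G M S g =
     lin_ext G M S (Fmod G M S) (\<lambda>l x. gen G M S (coef_act G M S g x l) (gact S g x))"

text \<open>The fixed submodule, underlying both $\overline F^G(S,M)$ and $F^G(S,M)$.\<close>

definition Ffix ::
    "('g, 'a) monoid_scheme \<Rightarrow> ('g, 'k, 'm) coefficients \<Rightarrow> ('g, 'x) pointed_gset
      \<Rightarrow> ('k, 'x \<Rightarrow> 'm) module" where
  "Ffix G M S =
     (Fmod G M S)\<lparr>carrier := {u \<in> carrier (Fmod G M S). \<forall>g\<in>carrier G. Fact G M S g u = u}\<rparr>"

text \<open>The summand belonging to $[g] \in G/G_x$ does not depend on the representative.\<close>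

definition gamma ::
    "('g, 'a) monoid_scheme \<Rightarrow> ('g, 'k, 'm) coefficients \<Rightarrow> ('g, 'x) pointed_gset
      \<Rightarrow> 'x \<Rightarrow> 'm \<Rightarrow> ('x \<Rightarrow> 'm)" where
  "gamma G M S x l =
     (\<Oplus>\<^bsub>Fmod G M S\<^esub>C\<in>orb G S x.
        let g = (SOME g. g \<in> C) in gen G M S (coef_act G M S g x l) (gact S g x))"

definition beta ::
    "('g, 'a) monoid_scheme \<Rightarrow> ('g, 'k, 'm) coefficients \<Rightarrow> ('g, 'x) pointed_gset
      \<Rightarrow> ('x \<Rightarrow> 'm) \<Rightarrow> ('x \<Rightarrow> 'm)" where
  "beta G M S = lin_ext G M S (Fmod G M S) (\<lambda>l x. gamma G M S x l)"

definition incl ::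
    "('g, 'a) monoid_scheme \<Rightarrow> ('g, 'k, 'm) coefficients \<Rightarrow> ('g, 'x) pointed_gset
      \<Rightarrow> ('x \<Rightarrow> 'm) \<Rightarrow> ('x \<Rightarrow> 'm)" where
  "incl G M S = (\<lambda>u\<in>carrier (Ffix G M S). u)"

definition alpha ::
    "('g, 'a) monoid_scheme \<Rightarrow> ('g, 'k, 'm) coefficients \<Rightarrow> ('g, 'x) pointed_gset
      \<Rightarrow> ('x \<Rightarrow> 'm) \<Rightarrow> ('x \<Rightarrow> 'm)" where
  "alpha G M S = compose (carrier (Ffix G M S)) (beta G M S) (incl G M S)"

text \<open>The functoriality $\overline f{}^G_*$ of $\overline F^G$, and the functoriality $f^G_*$ of $F^G$.
  The elements $\gamma^G_x(l)$ generate, so the latter is determined by its values on them.\<close>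

definition Fbar_push ::
    "('g, 'a) monoid_scheme \<Rightarrow> ('g, 'k, 'm) coefficients \<Rightarrow> ('g, 'x) pointed_gset
      \<Rightarrow> ('g, 'y) pointed_gset \<Rightarrow> ('x \<Rightarrow> 'y) \<Rightarrow> ('x \<Rightarrow> 'm) \<Rightarrow> ('y \<Rightarrow> 'm)" where
  "Fbar_push G M S T f = restrict (Fpush G M S T f) (carrier (Ffix G M S))"

definition FG_push ::
    "('g, 'a) monoid_scheme \<Rightarrow> ('k, 'b) ring_scheme \<Rightarrow> ('g, 'k, 'm) coefficients
      \<Rightarrow> ('g, 'x) pointed_gset \<Rightarrow> ('g, 'y) pointed_gset \<Rightarrow> ('x \<Rightarrow> 'y)
      \<Rightarrow> ('x \<Rightarrow> 'm) \<Rightarrow> ('y \<Rightarrow> 'm)" where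
  "FG_push G k M S T f =
     (THE h. h \<in> extensional (carrier (Ffix G M S)) \<and>
        h \<in> linear_maps k (Ffix G M S) (Ffix G M T) \<and>
        (\<forall>x\<in>pts S. \<forall>l\<in>carrier (coef G M S x).
           h (gamma G M S x l) = gamma G M T (f x) (coef_push G M S T f x l)))"


section \<open>Simplicial objects and geometric realization\<close>

text \<open>\<open>sop K m n \<theta>\<close> is the operator from level \<open>n\<close> to level \<open>m\<close> induced by a monotone map
  $\theta: [m] \to [n]$. The levels are plain sets, pointed $G$-sets or modules, according to the type
  \<^typ>\<open>'s\<close>.\<close>

record ('s, 'x) simplicial =
  level :: "nat \<Rightarrow> 's"
  sop :: "nat \<Rightarrow> nat \<Rightarrow> (nat \<Rightarrow> nat) \<Rightarrow> 'x \<Rightarrow> 'x"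

definition simplex_maps :: "nat \<Rightarrow> nat \<Rightarrow> (nat \<Rightarrow> nat) set" where
  "simplex_maps m n = {\<theta> \<in> {..m} \<rightarrow> {..n}. mono_on {..m} \<theta>}"

definition simplex_push :: "nat \<Rightarrow> (nat \<Rightarrow> nat) \<Rightarrow> (nat \<Rightarrow> real) \<Rightarrow> nat \<Rightarrow> real" where
  "simplex_push m \<theta> t = (\<lambda>j. \<Sum>i | i \<le> m \<and> \<theta> i = j. t i)"

abbreviation simplex_top :: "nat \<Rightarrow> (nat \<Rightarrow> real) topology" where
  "simplex_top n \<equiv> subtopology (powertop_real UNIV) (standard_simplex n)"

type_synonym 'x cell = "nat \<times> 'x \<times> (nat \<Rightarrow> real)"

definition real_cells :: "('x set, 'x) simplicial \<Rightarrow> 'x cell topology" where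
  "real_cells K =
     sum_topology (\<lambda>n. prod_topology (discrete_topology (level K n)) (simplex_top n)) UNIV"

definition real_step :: "('x set, 'x) simplicial \<Rightarrow> ('x cell \<times> 'x cell) set" where
  "real_step K =
     {((m, sop K m n \<theta> x, t), (n, x, simplex_push m \<theta> t)) |m n \<theta> x t.
        \<theta> \<in> simplex_maps m n \<and> x \<in> level K n \<and> t \<in> standard_simplex m}"

definition real_rel :: "('x set, 'x) simplicial \<Rightarrow> ('x cell \<times> 'x cell) set" where
  "real_rel K = (real_step K \<union> (real_step K)\<inverse>)\<^sup>*"

definition real_class :: "('x set, 'x) simplicial \<Rightarrow> 'x cell \<Rightarrow> 'x cell set" where
  "real_class K c = real_rel K `` {c}"

definition realization :: "('x set, 'x) simplicial \<Rightarrow> 'x cell set topology" where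
  "realization K = identification_topology (real_cells K) (real_class K)"

text \<open>$|f|([x,t]) = [f(x),t]$, formed by applying $f$ to all representatives.\<close>

definition real_map ::
    "('y set, 'y) simplicial \<Rightarrow> (nat \<Rightarrow> 'x \<Rightarrow> 'y) \<Rightarrow> 'x cell set \<Rightarrow> 'y cell set" where
  "real_map L f c = real_rel L `` ((\<lambda>(n, x, t). (n, f n x, t)) ` c)"

definition underlying :: "(('k, 'x) module, 'x) simplicial \<Rightarrow> ('x set, 'x) simplicial" where
  "underlying K = \<lparr>level = (\<lambda>n. carrier (level K n)), sop = sop K\<rparr>"

definition sset_prod ::
    "('x set, 'x) simplicial \<Rightarrow> ('y set, 'y) simplicial \<Rightarrow> (('x \<times> 'y) set, 'x \<times> 'y) simplicial" where
  "sset_prod K L =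
     \<lparr>level = (\<lambda>n. level K n \<times> level L n),
      sop = (\<lambda>m n \<theta>. map_prod (sop K m n \<theta>) (sop L m n \<theta>))\<rparr>"

text \<open>The multiplication on $|K|$ is
  $|K| \times |K| \cong |K \times K| \to |K|$, where the bijection is the inverse of the map given by
  the two projections.\<close>

definition real_group :: "(('k, 'x) module, 'x) simplicial \<Rightarrow> 'x cell set monoid" where
  "real_group K = (let U = underlying K in
     \<lparr>carrier = topspace (realization U),
      monoid.mult = (\<lambda>a b. real_map U (\<lambda>n (x, y). x \<oplus>\<^bsub>level K n\<^esub> y)
                (THE c. c \<in> topspace (realization (sset_prod U U)) \<and>
                   real_map U (\<lambda>n. fst) c = a \<and> real_map U (\<lambda>n. snd) c = b)),
      one = real_class U (0, \<zero>\<^bsub>level K 0\<^esub>, (\<lambda>j. if j = 0 then 1 else 0))\<rparr>)"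

definition real_top :: "(('k, 'x) module, 'x) simplicial \<Rightarrow> 'x cell set topology" where
  "real_top K = realization (underlying K)"


section \<open>Pointed G-spaces and the topological groups attached to them\<close>

record ('g, 'x) pointed_gspace =
  gtop :: "'x topology"
  act :: "'g \<Rightarrow> 'x \<Rightarrow> 'x"
  bpt :: "'x"

definition is_pointed_gspace ::
    "('g, 'a) monoid_scheme \<Rightarrow> ('g, 'x) pointed_gspace \<Rightarrow> bool" where
  "is_pointed_gspace G X \<longleftrightarrow>
     group_action G (topspace (gtop X)) (act X) \<and>
     continuous_map (prod_topology (discrete_topology (carrier G)) (gtop X)) (gtop X)
       (\<lambda>(g, x). act X g x) \<and>
     bpt X \<in> topspace (gtop X) \<and> (\<forall>g\<in>carrier G. act X g (bpt X) = bpt X)"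

definition discrete_gset :: "('g, 'x) pointed_gspace \<Rightarrow> ('g, 'x) pointed_gset" where
  "discrete_gset X = \<lparr>pts = topspace (gtop X), gact = act X, base = bpt X\<rparr>"

definition Sing ::
    "('g, 'x) pointed_gspace
      \<Rightarrow> (('g, (nat \<Rightarrow> real) \<Rightarrow> 'x) pointed_gset, (nat \<Rightarrow> real) \<Rightarrow> 'x) simplicial" where
  "Sing X =
     \<lparr>level = (\<lambda>n. \<lparr>pts = singular_simplex_set n (gtop X),
                     gact = (\<lambda>g. \<lambda>\<sigma>\<in>singular_simplex_set n (gtop X).
                                  \<lambda>t\<in>standard_simplex n. act X g (\<sigma> t)),
                     base = (\<lambda>t\<in>standard_simplex n. bpt X)\<rparr>),
      sop = (\<lambda>m n \<theta>. \<lambda>\<sigma>\<in>singular_simplex_set n (gtop X).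
                \<lambda>t\<in>standard_simplex m. \<sigma> (simplex_push m \<theta> t))\<rparr>"

text \<open>The functors $F(-,M)$, $\overline F^G(-,M)$ and $F^G(-,M)$ applied degreewise.\<close>

definition sF ::
    "('g, 'a) monoid_scheme \<Rightarrow> ('g, 'k, 'm) coefficients \<Rightarrow> (('g, 'x) pointed_gset, 'x) simplicial
      \<Rightarrow> (('k, 'x \<Rightarrow> 'm) module, 'x \<Rightarrow> 'm) simplicial" where
  "sF G M K =
     \<lparr>level = (\<lambda>n. Fmod G M (level K n)),
      sop = (\<lambda>m n \<theta>. Fpush G M (level K n) (level K m) (sop K m n \<theta>))\<rparr>"

definition sFbar ::
    "('g, 'a) monoid_scheme \<Rightarrow> ('g, 'k, 'm) coefficients \<Rightarrow> (('g, 'x) pointed_gset, 'x) simplicial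
      \<Rightarrow> (('k, 'x \<Rightarrow> 'm) module, 'x \<Rightarrow> 'm) simplicial" where
  "sFbar G M K =
     \<lparr>level = (\<lambda>n. Ffix G M (level K n)),
      sop = (\<lambda>m n \<theta>. Fbar_push G M (level K n) (level K m) (sop K m n \<theta>))\<rparr>"

definition sFG ::
    "('g, 'a) monoid_scheme \<Rightarrow> ('k, 'b) ring_scheme \<Rightarrow> ('g, 'k, 'm) coefficients
      \<Rightarrow> (('g, 'x) pointed_gset, 'x) simplicial \<Rightarrow> (('k, 'x \<Rightarrow> 'm) module, 'x \<Rightarrow> 'm) simplicial" where
  "sFG G k M K =
     \<lparr>level = (\<lambda>n. Ffix G M (level K n)),
      sop = (\<lambda>m n \<theta>. FG_push G k M (level K n) (level K m) (sop K m n \<theta>))\<rparr>"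

text \<open>\<open>real_alpha\<close> is $|\alpha_{\mathcal S(X)}|$.\<close>

definition real_alpha ::
    "('g, 'a) monoid_scheme \<Rightarrow> ('k, 'b) ring_scheme \<Rightarrow> ('g, 'k, 'm) coefficients
      \<Rightarrow> ('g, 'x) pointed_gspace
      \<Rightarrow> (((nat \<Rightarrow> real) \<Rightarrow> 'x) \<Rightarrow> 'm) cell set \<Rightarrow> (((nat \<Rightarrow> real) \<Rightarrow> 'x) \<Rightarrow> 'm) cell set" where
  "real_alpha G k M X =
     real_map (underlying (sFG G k M (Sing X))) (\<lambda>n. alpha G M (level (Sing X) n))"

text \<open>$\pi_X([u,t]) = (\mathrm{ev}_t)_*(u)$ for the pointed $G$-function
  $\mathrm{ev}_t: \mathcal S_n(X) \to X^\delta$, $\sigma \mapsto \sigma(t)$. On $u = l\sigma$ this is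
  $M_*(p_{\sigma,t})(l)\,\sigma(t)$, as $p_{\sigma,t}$ is the projection belonging to
  $\mathrm{ev}_t$ and $\sigma$. The value is the same for all representatives.\<close>

definition pi_map ::
    "('g, 'a) monoid_scheme \<Rightarrow> ('g, 'k, 'm) coefficients \<Rightarrow> ('g, 'x) pointed_gspace
      \<Rightarrow> (((nat \<Rightarrow> real) \<Rightarrow> 'x) \<Rightarrow> 'm) cell set \<Rightarrow> ('x \<Rightarrow> 'm)" where
  "pi_map G M X c =
     the_elem ((\<lambda>(n, u, t). Fpush G M (level (Sing X) n) (discrete_gset X) (\<lambda>\<sigma>. \<sigma> t) u) ` c)"

text \<open>$\widehat\pi^G_X$: the restriction of $\pi_X$ along the realization of the degreewise
  inclusion.\<close>

definition pi_hat ::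
    "('g, 'a) monoid_scheme \<Rightarrow> ('g, 'k, 'm) coefficients \<Rightarrow> ('g, 'x) pointed_gspace
      \<Rightarrow> (((nat \<Rightarrow> real) \<Rightarrow> 'x) \<Rightarrow> 'm) cell set \<Rightarrow> ('x \<Rightarrow> 'm)" where
  "pi_hat G M X c =
     pi_map G M X
       (real_map (underlying (sF G M (Sing X))) (\<lambda>n. incl G M (level (Sing X) n)) c)"

definition FF_top ::
    "('g, 'a) monoid_scheme \<Rightarrow> ('g, 'k, 'm) coefficients \<Rightarrow> ('g, 'x) pointed_gspace
      \<Rightarrow> ('x \<Rightarrow> 'm) topology" where
  "FF_top G M X = identification_topology (real_top (sF G M (Sing X))) (pi_map G M X)"

definition FFG_top ::
    "('g, 'a) monoid_scheme \<Rightarrow> ('g, 'k, 'm) coefficients \<Rightarrow> ('g, 'x) pointed_gspace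
      \<Rightarrow> ('x \<Rightarrow> 'm) topology" where
  "FFG_top G M X = identification_topology (FF_top G M X) (beta G M (discrete_gset X))"

definition FFhat_top ::
    "('g, 'a) monoid_scheme \<Rightarrow> ('g, 'k, 'm) coefficients \<Rightarrow> ('g, 'x) pointed_gspace
      \<Rightarrow> ('x \<Rightarrow> 'm) topology" where
  "FFhat_top G M X = identification_topology (real_top (sFbar G M (Sing X))) (pi_hat G M X)"

end

theory Submission
  imports Defs
begin

text \<open>On \<open>F(S,M)\<close> let \<open>e\<close> be the projection \<open>|G|\<^sup>-\<^sup>1 \<Sum>g. g\<close> onto the fixed elements and let \<open>w\<close> multiply the
  value at \<open>x\<close> by \<open>|G : G\<^sub>x|\<close>. Since \<open>\<Sum>g. g \<cdot> lx = |G\<^sub>x| \<gamma>\<^sub>x(l)\<close>, one has \<open>\<beta> = e w = w e\<close>, so \<open>\<alpha> = w\<close> on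
  the fixed elements, which is invertible, and \<open>\<alpha> e = \<beta>\<close>. Hence \<open>\<alpha>\<close> is a degreewise isomorphism, which
  gives (a). For (b), \<open>\<alpha> \<pi>' = \<beta> \<pi> |\<iota>|\<close> and \<open>\<beta> \<pi> = \<alpha> \<pi>' |e|\<close>, where \<open>\<pi>'\<close> is the restriction of \<open>\<pi>\<close>, so that
  a set is open in one identification topology iff it is open in the other.

  The group structure rests on \<open>|K \<times> K| \<rightarrow> |K| \<times> |K|\<close> being a bijection with inverse continuous for the
  k-topology. Two cells are identified in \<open>|K|\<close> iff they have a common refinement, and refinements of
  two barycentric coordinate vectors are merged by their monotone coupling, regarding the vectors as
  probability distributions on chains.\<close>

section \<open>k-spaces and their products\<close>

text \<open>Two obstacles shape the proof. First, a product of quotient maps need not be a quotient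
  map, so continuity of addition cannot be pushed from cells to \<open>|K|\<close>, nor from there
  along \<pi>, in the ordinary product. It does pass to the k-ified product: a test map reduces the
  question to a product with a compact Hausdorff space, where quotient maps survive. Test spaces are
  confined to the type \<open>'z\<close>, while the argument multiplies two of them; as
  \<open>'z\<close> is infinite, its square embeds in it. The summand
  \<open>nat \<Rightarrow> real\<close> of the final type makes room for the simplices, so that
  cells are themselves test maps. Second, the weights |G : G_x| of w are constant on orbits but
  change from x to f(x), so w commutes with the action of G but in general not with f_*. The second
  functoriality is exactly the correction: \<open>FG_push\<close> is w f_* w^-1, so the simplicial
  operators of F^G are conjugate under w = \<alpha> to those of the fixed submodule. By contrast, e
  commutes with every f_*, because f_* is equivariant; hence |e| exists.\<close>

lemma infinite_times_inj:
  assumes "infinite (UNIV :: 't set)"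
  obtains h :: "'t \<times> 't \<Rightarrow> 't" where "inj h"
proof -
  have "|UNIV \<times> UNIV :: ('t \<times> 't) set| \<le>o |UNIV :: 't set|"
    using card_of_Times_same_infinite[OF assms] ordIso_imp_ordLeq by blast
  then show ?thesis
    using card_of_ordLeq[of "UNIV \<times> UNIV :: ('t \<times> 't) set" "UNIV :: 't set"] that by auto
qed

text \<open>The test condition of \<open>kify\<close> without the subset clause, so that it can be
  moved along continuous maps and compared with openness.\<close>

definition kopen :: "'z itself \<Rightarrow> 'a topology \<Rightarrow> 'a set \<Rightarrow> bool" where
  "kopen TYPE('z) X U \<longleftrightarrow>
     (\<forall>(Z :: 'z topology) f. compact_space Z \<and> Hausdorff_space Z \<and> continuous_map Z X f
         \<longrightarrow> openin Z {z \<in> topspace Z. f z \<in> U})"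

lemma kopenD:
  fixes Z :: "'z topology"
  assumes "kopen TYPE('z) X U" "compact_space Z" "Hausdorff_space Z" "continuous_map Z X f"
  shows "openin Z {z \<in> topspace Z. f z \<in> U}"
  using assms unfolding kopen_def by blast

lemma openin_kify_iff: "openin (kify TYPE('z) X) U \<longleftrightarrow> U \<subseteq> topspace X \<and> kopen TYPE('z) X U"
  by (simp add: openin_kify kopen_def)

lemma topspace_kify [simp]: "topspace (kify TYPE('z) X) = topspace X"
proof (rule antisym)
  show "topspace (kify TYPE('z) X) \<subseteq> topspace X"
    using openin_topspace[of "kify TYPE('z) X"] unfolding openin_kify_iff by (rule conjunct1)
  have "kopen TYPE('z) X (topspace X)"
    by (auto simp: kopen_def intro!: openin_continuous_map_preimage)
  then show "topspace X \<subseteq> topspace (kify TYPE('z) X)"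
    by (meson openin_kify_iff openin_subset order_refl)
qed

lemma openin_imp_kopen: "openin X U \<Longrightarrow> kopen TYPE('z) X U"
  by (auto simp: kopen_def intro!: openin_continuous_map_preimage)

text \<open>\<open>kspace\<close> tests closed sets; preimages commute with complements, so testing
  open sets is equivalent.\<close>

lemma kspace_iff_kopen:
  "kspace TYPE('z) X \<longleftrightarrow> (\<forall>U\<subseteq>topspace X. kopen TYPE('z) X U \<longrightarrow> openin X U)"
proof -
  have pre: "topspace Z - {z \<in> topspace Z. f z \<in> U} = {z \<in> topspace Z. f z \<in> topspace X - U}"
    if "continuous_map Z X f" for Z :: "'z topology" and f U
    using continuous_map_image_subset_topspace[OF that] by auto
  have op: "openin Z {z \<in> topspace Z. f z \<in> topspace X - U} \<longleftrightarrow> closedin Z {z \<in> topspace Z. f z \<in> U}"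
    if "continuous_map Z X f" for Z :: "'z topology" and f U
    unfolding pre[OF that, symmetric] by (auto simp: closedin_def)
  have ko: "kopen TYPE('z) X (topspace X - U) \<longleftrightarrow>
     (\<forall>(Z :: 'z topology) f. compact_space Z \<and> Hausdorff_space Z \<and> continuous_map Z X f
            \<longrightarrow> closedin Z {z \<in> topspace Z. f z \<in> U})" for U
    unfolding kopen_def using op by blast
  have "kspace TYPE('z) X \<longleftrightarrow>
     (\<forall>W\<subseteq>topspace X. kopen TYPE('z) X (topspace X - W) \<longrightarrow> openin X (topspace X - W))"
    unfolding kspace_def ko[symmetric] by (auto simp: closedin_def)
  also have "\<dots> \<longleftrightarrow> (\<forall>U\<subseteq>topspace X. kopen TYPE('z) X U \<longrightarrow> openin X U)"
    by (metis Diff_subset double_diff order_refl)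
  finally show ?thesis .
qed

text \<open>A test space on another type is replaced by a copy inside \<open>'z\<close>: with the
  identification topology on its image, an injection becomes a homeomorphism.\<close>

lemma kopen_test:
  fixes Z :: "'s topology" and h :: "'s \<Rightarrow> 'z"
  assumes U: "kopen TYPE('z) X U" and Z: "compact_space Z" "Hausdorff_space Z"
    and f: "continuous_map Z X f" and h: "inj h"
  shows "openin Z {z \<in> topspace Z. f z \<in> U}"
proof -
  define Y where "Y = identification_topology Z h"
  have hm: "homeomorphic_map Z Y h"
    using quotient_map_identification_topology[of Z h] h
    by (metis Y_def homeomorphic_map_def inj_on_subset subset_UNIV)
  then obtain k where k: "homeomorphic_maps Z Y h k"
    using homeomorphic_map_maps by blast
  have "Z homeomorphic_space Y"
    using hm homeomorphic_map_imp_homeomorphic_space by blast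
  then have Y: "compact_space Y" "Hausdorff_space Y"
    using Z homeomorphic_compact_space homeomorphic_Hausdorff_space by blast+
  have "continuous_map Y X (f \<circ> k)"
    using k f by (auto simp: homeomorphic_maps_def intro: continuous_map_compose)
  then have "openin Y {y \<in> topspace Y. (f \<circ> k) y \<in> U}"
    using U Y by (intro kopenD)
  then have "openin Z {z \<in> topspace Z. h z \<in> {y \<in> topspace Y. (f \<circ> k) y \<in> U}}"
    using k unfolding homeomorphic_maps_def
    by (intro openin_continuous_map_preimage[of Z Y h]) auto
  moreover have "{z \<in> topspace Z. h z \<in> {y \<in> topspace Y. (f \<circ> k) y \<in> U}} = {z \<in> topspace Z. f z \<in> U}"
    using k by (auto simp: homeomorphic_maps_def dest: continuous_map_image_subset_topspace)
  ultimately show ?thesis by simp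
qed

lemma kopen_preimage:
  assumes "continuous_map X Y q" "kopen TYPE('z) Y U"
  shows "kopen TYPE('z) X {x \<in> topspace X. q x \<in> U}"
  unfolding kopen_def
proof (intro allI impI)
  fix Z :: "'z topology" and f assume *: "compact_space Z \<and> Hausdorff_space Z \<and> continuous_map Z X f"
  then have "openin Z {z \<in> topspace Z. (q \<circ> f) z \<in> U}"
    using assms by (intro kopenD[OF assms(2)] continuous_map_compose[of Z X f Y q]) auto
  moreover have "{z \<in> topspace Z. (q \<circ> f) z \<in> U} = {z \<in> topspace Z. f z \<in> {x \<in> topspace X. q x \<in> U}}"
    using * by (auto dest: continuous_map_image_subset_topspace)
  ultimately show "openin Z {z \<in> topspace Z. f z \<in> {x \<in> topspace X. q x \<in> U}}" by simp
qed

lemma kspace_quotient: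
  assumes "quotient_map X Y q" "kspace TYPE('z) X"
  shows "kspace TYPE('z) Y"
  using assms unfolding kspace_iff_kopen
  by (metis (no_types, lifting) kopen_preimage mem_Collect_eq quotient_imp_continuous_map
      quotient_map_def subsetI)

text \<open>The ordinary product of a k-space with a compact Hausdorff space is already a k-space. A
  neighbourhood of (x, z) is found as a box: the slice of \<open>W\<close> over \<open>x\<close>
  contains a compact neighbourhood \<open>N\<close> of \<open>z\<close>, and the set
  \<open>Q\<close> of points whose slice contains \<open>N\<close> is k-open, hence open.\<close>

lemma kopen_prod_compact:
  fixes Z :: "'z topology"
  assumes inf: "infinite (UNIV :: 'z set)"
    and X: "kspace TYPE('z) X" and Z: "compact_space Z" "Hausdorff_space Z"
    and W: "W \<subseteq> topspace (prod_topology X Z)" "kopen TYPE('z) (prod_topology X Z) W"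
  shows "openin (prod_topology X Z) W"
  unfolding openin_prod_topology_alt
proof (intro allI impI)
  fix x z assume xz: "(x, z) \<in> W"
  then have x: "x \<in> topspace X" and z: "z \<in> topspace Z" using W by auto
  have cx: "continuous_map Z (prod_topology X Z) (\<lambda>z. (x, z))"
    using x by (simp add: continuous_map_pairwise o_def)
  have K0: "openin Z {z \<in> topspace Z. (x, z) \<in> W}"
    using kopenD[OF W(2) Z cx] by simp
  have "locally_compact_space Z" using Z compact_imp_locally_compact_space by blast
  moreover have "regular_space Z" using Z compact_Hausdorff_imp_regular_space by blast
  ultimately have "neighbourhood_base_of (\<lambda>C. compactin Z C \<and> closedin Z C) Z"
    using locally_compact_regular_space_neighbourhood_base by blast
  then obtain U N where UN: "openin Z U" "compactin Z N" "z \<in> U" "U \<subseteq> N" "N \<subseteq> {z \<in> topspace Z. (x, z) \<in> W}"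
    using K0 z xz unfolding neighbourhood_base_of by (metis (no_types, lifting) mem_Collect_eq)
  define Q where "Q = {a \<in> topspace X. \<forall>n\<in>N. (a, n) \<in> W}"
  obtain h :: "'z \<times> 'z \<Rightarrow> 'z" where h: "inj h" using infinite_times_inj[OF inf] .
  have NZ: "N \<subseteq> topspace Z" using UN compactin_subset_topspace by blast
  have "kopen TYPE('z) X Q"
    unfolding kopen_def
  proof (intro allI impI, elim conjE)
    fix D :: "'z topology" and c
    assume D: "compact_space D" "Hausdorff_space D" "continuous_map D X c"
    \<comment> \<open>This test space is carried by \<open>'z \<times> 'z\<close>; the injection
      \<open>h\<close> brings it back to \<open>'z\<close>.\<close>
    let ?E = "prod_topology D (subtopology Z N)"
    have E: "compact_space ?E" "Hausdorff_space ?E"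
      using D Z UN by (auto simp: compact_space_prod_topology Hausdorff_space_prod_topology
          compact_space_subtopology Hausdorff_space_subtopology)
    have cE: "continuous_map ?E (prod_topology X Z) (\<lambda>(d, n). (c d, n))"
    proof -
      have "continuous_map ?E X (c \<circ> fst)" "continuous_map ?E Z (id \<circ> snd)"
        using D continuous_map_id_subt[of Z N]
        by (metis continuous_map_compose continuous_map_fst continuous_map_snd)+
      then show ?thesis by (simp add: continuous_map_pairwise o_def case_prod_unfold)
    qed
    have op: "openin ?E {e \<in> topspace ?E. (\<lambda>(d, n). (c d, n)) e \<in> W}"
      by (rule kopen_test[OF W(2) E cE h])
    show "openin D {d \<in> topspace D. c d \<in> Q}"
    proof (subst openin_subopen, intro ballI)
      fix d assume d: "d \<in> {d \<in> topspace D. c d \<in> Q}"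
      have "compactin (subtopology Z N) N"
        using UN by (simp add: compactin_subtopology)
      moreover have "{d} \<times> N \<subseteq> {e \<in> topspace ?E. (\<lambda>(d, n). (c d, n)) e \<in> W}"
        using d NZ by (auto simp: Q_def)
      \<comment> \<open>Tube lemma for the compact \<open>N\<close>: some neighbourhood
        \<open>A\<close> of \<open>d\<close> has all of \<open>A \<times> N\<close> in the preimage
        of \<open>W\<close>.\<close>
      ultimately obtain A B where AB: "openin D A" "openin (subtopology Z N) B" "{d} \<subseteq> A" "N \<subseteq> B"
        "A \<times> B \<subseteq> {e \<in> topspace ?E. (\<lambda>(d, n). (c d, n)) e \<in> W}"
        using Wallace_theorem_prod_topology[OF _ _ op, of "{d}" N] d by (simp add: compactin_sing) blast
      have "A \<subseteq> {d \<in> topspace D. c d \<in> Q}"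
        using AB(4,5) openin_subset[OF AB(1)] continuous_map_image_subset_topspace[OF D(3)]
        by (fastforce simp: Q_def)
      then show "\<exists>T. openin D T \<and> d \<in> T \<and> T \<subseteq> {d \<in> topspace D. c d \<in> Q}"
        using AB by blast
    qed
  qed
  then have "openin X Q"
    using X unfolding kspace_iff_kopen by (simp add: Q_def subset_iff)
  moreover have "x \<in> Q" using x UN by (auto simp: Q_def)
  moreover have "Q \<times> U \<subseteq> W" using UN by (auto simp: Q_def)
  ultimately show "\<exists>U V. openin X U \<and> openin Z V \<and> x \<in> U \<and> z \<in> V \<and> U \<times> V \<subseteq> W"
    using UN by blast
qed

text \<open>Cartesian closedness of k-spaces in disguise.\<close>

lemma kopen_prod_quotient_left:
  assumes inf: "infinite (UNIV :: 'z set)"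
    and A: "kspace TYPE('z) A" and q: "quotient_map A B q"
    and V: "V \<subseteq> topspace (prod_topology B C)"
      "kopen TYPE('z) (prod_topology A C) {p \<in> topspace (prod_topology A C). (q (fst p), snd p) \<in> V}"
  shows "kopen TYPE('z) (prod_topology B C) V"
  unfolding kopen_def
proof (intro allI impI, elim conjE)
  fix Z :: "'z topology" and f
  assume Z: "compact_space Z" "Hausdorff_space Z" and f: "continuous_map Z (prod_topology B C) f"
  define g where "g = snd \<circ> f"
  have g: "continuous_map Z C g" and f1: "continuous_map Z B (fst \<circ> f)"
    using f by (auto simp: g_def continuous_map_pairwise)
  have gC: "g z \<in> topspace C" if "z \<in> topspace Z" for z
    using g that continuous_map_image_subset_topspace by fastforce
  have qB: "q a \<in> topspace B" if "a \<in> topspace A" for a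
    using q that by (auto simp: quotient_map_def)
  \<comment> \<open>The test map is the pair of \<open>fst \<circ> f\<close> and \<open>g\<close>.
    Pulling \<open>V\<close> back along \<open>g\<close> replaces \<open>C\<close> by the compact
    \<open>Z\<close>; there \<open>q\<close> times the identity is a quotient map, and the preimage
    of \<open>V\<close> under \<open>f\<close> is recovered by restricting \<open>W\<close> to the
    graph of \<open>fst \<circ> f\<close>.\<close>
  define W where "W = {p \<in> topspace (prod_topology B Z). (fst p, g (snd p)) \<in> V}"
  define W' where "W' = {p \<in> topspace (prod_topology A Z). (q (fst p), snd p) \<in> W}"
  have cg: "continuous_map (prod_topology A Z) (prod_topology A C) (\<lambda>p. (fst p, g (snd p)))"
    using g by (auto simp: continuous_map_pairwise o_def
      intro: continuous_map_compose[OF continuous_map_snd, unfolded o_def] continuous_map_fst)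
  have "W' = {p \<in> topspace (prod_topology A Z).
       (fst p, g (snd p)) \<in> {p \<in> topspace (prod_topology A C). (q (fst p), snd p) \<in> V}}"
    using gC qB by (auto simp: W_def W'_def)
  then have "kopen TYPE('z) (prod_topology A Z) W'"
    using kopen_preimage[OF cg V(2)] by simp
  then have "openin (prod_topology A Z) W'"
    using kopen_prod_compact[OF inf A Z, of W'] by (auto simp: W'_def)
  moreover have "quotient_map (prod_topology A Z) (prod_topology B Z) (\<lambda>(x, y). (q x, y))"
    using Z q by (intro quotient_map_prod_left) (auto simp: compact_imp_locally_compact_space)
  moreover have "W \<subseteq> topspace (prod_topology B Z)" by (auto simp: W_def)
  ultimately have "openin (prod_topology B Z) W"
    unfolding quotient_map_def W'_def by (simp add: case_prod_unfold)
  moreover have "continuous_map Z (prod_topology B Z) (\<lambda>z. ((fst \<circ> f) z, z))"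
    using f1 by (simp add: continuous_map_pairwise o_def)
  ultimately have "openin Z {z \<in> topspace Z. ((fst \<circ> f) z, z) \<in> W}"
    by (rule openin_continuous_map_preimage[rotated])
  moreover have "{z \<in> topspace Z. ((fst \<circ> f) z, z) \<in> W} = {z \<in> topspace Z. f z \<in> V}"
    using continuous_map_image_subset_topspace[OF f1] by (auto simp: W_def g_def)
  ultimately show "openin Z {z \<in> topspace Z. f z \<in> V}" by simp
qed

lemma kopen_prod_swap:
  assumes "kopen TYPE('z) (prod_topology A B) V"
  shows "kopen TYPE('z) (prod_topology B A) {p \<in> topspace (prod_topology B A). prod.swap p \<in> V}"
proof -
  have "continuous_map (prod_topology B A) (prod_topology A B) prod.swap"
    using continuous_map_snd continuous_map_fst
    by (auto simp: continuous_map_pairwise o_def prod.swap_def)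
  then show ?thesis using assms kopen_preimage by blast
qed

text \<open>One factor is replaced at a time, with a swap in between. In effect, products of
  quotient maps of k-spaces are quotient maps for the k-ified products.\<close>

lemma kopen_prod_quotient:
  assumes inf: "infinite (UNIV :: 'z set)"
    and A: "kspace TYPE('z) A" "quotient_map A B q"
    and A': "kspace TYPE('z) A'" "quotient_map A' B' q'"
    and V: "V \<subseteq> topspace (prod_topology B B')"
      "kopen TYPE('z) (prod_topology A A')
         {p \<in> topspace (prod_topology A A'). (q (fst p), q' (snd p)) \<in> V}"
  shows "kopen TYPE('z) (prod_topology B B') V"
proof -
  have qB: "q a \<in> topspace B" if "a \<in> topspace A" for a
    using A that by (auto simp: quotient_map_def)
  have qB': "q' a \<in> topspace B'" if "a \<in> topspace A'" for a
    using A' that by (auto simp: quotient_map_def)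
  define V1 where "V1 = {p \<in> topspace (prod_topology A B'). (q (fst p), snd p) \<in> V}"
  define V2 where "V2 = {p \<in> topspace (prod_topology B' A). prod.swap p \<in> V1}"
  have "{p \<in> topspace (prod_topology A' A). (q' (fst p), snd p) \<in> V2} =
        {p \<in> topspace (prod_topology A' A). prod.swap p \<in>
          {p \<in> topspace (prod_topology A A'). (q (fst p), q' (snd p)) \<in> V}}"
    using qB' by (auto simp: V2_def V1_def)
  then have "kopen TYPE('z) (prod_topology A' A) {p \<in> topspace (prod_topology A' A). (q' (fst p), snd p) \<in> V2}"
    using kopen_prod_swap[OF V(2)] by simp
  then have "kopen TYPE('z) (prod_topology B' A) V2"
    by (intro kopen_prod_quotient_left[OF inf A']) (auto simp: V2_def)
  then have "kopen TYPE('z) (prod_topology A B') V1"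
  proof -
    assume "kopen TYPE('z) (prod_topology B' A) V2"
    from kopen_prod_swap[OF this] show ?thesis
      by (rule back_subst[of "kopen TYPE('z) (prod_topology A B')"]) (auto simp: V1_def V2_def)
  qed
  then show ?thesis
    using V unfolding V1_def by (intro kopen_prod_quotient_left[OF inf A]) auto
qed

text \<open>Multiplication descends because \<open>f\<close> times \<open>f\<close> is a quotient
  map for the k-ified products; inversion needs only that \<open>f\<close> is one.\<close>

lemma k_topological_group_quotient:
  assumes inf: "infinite (UNIV :: 'z set)"
    and A: "k_topological_group TYPE('z) A T" and B: "group B"
    and f: "f \<in> hom A B" "f ` carrier A = carrier B"
  shows "k_topological_group TYPE('z) B (identification_topology T f)"
proof -
  let ?U = "identification_topology T f"
  have gA: "group A" and tT: "topspace T = carrier A" and kT: "kspace TYPE('z) T"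
    and mT: "continuous_map (kify TYPE('z) (prod_topology T T)) T (\<lambda>(x, y). x \<otimes>\<^bsub>A\<^esub> y)"
    and iT: "continuous_map T T (\<lambda>x. inv\<^bsub>A\<^esub> x)"
    using A by (auto simp: k_topological_group_def)
  interpret group_hom A B f
    using gA B f by (simp add: group_hom_def group_hom_axioms_def)
  have q: "quotient_map T ?U f" by (rule quotient_map_identification_topology)
  have tU: "topspace ?U = carrier B"
    by (simp add: topspace_identification_topology tT f)
  have kU: "kspace TYPE('z) ?U" using kspace_quotient q kT by blast
  have inv: "continuous_map ?U ?U (\<lambda>x. inv\<^bsub>B\<^esub> x)"
  proof -
    have "continuous_map T ?U (f \<circ> (\<lambda>x. inv\<^bsub>A\<^esub> x))"
      using iT quotient_imp_continuous_map[OF q] continuous_map_compose by blast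
    then have "continuous_map T ?U ((\<lambda>x. inv\<^bsub>B\<^esub> x) \<circ> f)"
      by (rule continuous_map_eq) (simp add: tT)
    then show ?thesis
      using q continuous_compose_quotient_map by blast
  qed
  have mult: "continuous_map (kify TYPE('z) (prod_topology ?U ?U)) ?U (\<lambda>(x, y). x \<otimes>\<^bsub>B\<^esub> y)"
    unfolding continuous_map
  proof (intro conjI allI impI)
    show "(\<lambda>(x, y). x \<otimes>\<^bsub>B\<^esub> y) ` topspace (kify TYPE('z) (prod_topology ?U ?U)) \<subseteq> topspace ?U"
      using B by (auto simp: tU)
    fix U assume U: "openin ?U U"
    let ?V = "{x \<in> topspace (kify TYPE('z) (prod_topology ?U ?U)). (case x of (x, y) \<Rightarrow> x \<otimes>\<^bsub>B\<^esub> y) \<in> U}"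
    have "openin T {x \<in> topspace T. f x \<in> U}"
      using U by (simp add: openin_identification_topology)
    from openin_continuous_map_preimage[OF mT this]
    have "kopen TYPE('z) (prod_topology T T)
        {p \<in> topspace (prod_topology T T). (case p of (x, y) \<Rightarrow> x \<otimes>\<^bsub>A\<^esub> y) \<in> {x \<in> topspace T. f x \<in> U}}"
      by (simp add: openin_kify_iff)
    also have "{p \<in> topspace (prod_topology T T). (case p of (x, y) \<Rightarrow> x \<otimes>\<^bsub>A\<^esub> y) \<in> {x \<in> topspace T. f x \<in> U}}
      = {p \<in> topspace (prod_topology T T). (f (fst p), f (snd p)) \<in> ?V}"
      by (auto simp: tT tU)
    finally have "kopen TYPE('z) (prod_topology ?U ?U) ?V"
      by (intro kopen_prod_quotient[OF inf kT q kT q]) auto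
    then show "openin (kify TYPE('z) (prod_topology ?U ?U)) ?V"
      by (auto simp: openin_kify_iff)
  qed
  show ?thesis
    using B tU kU inv mult by (simp add: k_topological_group_def)
qed

section \<open>Geometric realization\<close>

lemma simplex_maps_mono:
  "\<theta> \<in> simplex_maps m n \<Longrightarrow> i \<le> j \<Longrightarrow> j \<le> m \<Longrightarrow> \<theta> i \<le> \<theta> j"
  by (auto simp: simplex_maps_def mono_on_def)

lemma simplex_maps_le: "\<theta> \<in> simplex_maps m n \<Longrightarrow> i \<le> m \<Longrightarrow> \<theta> i \<le> n"
  by (auto simp: simplex_maps_def Pi_iff)

lemma simplex_mapsI:
  "(\<And>i. i \<le> m \<Longrightarrow> \<theta> i \<le> n) \<Longrightarrow> (\<And>i j. i \<le> j \<Longrightarrow> j \<le> m \<Longrightarrow> \<theta> i \<le> \<theta> j) \<Longrightarrow> \<theta> \<in> simplex_maps m n"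
  by (auto simp: simplex_maps_def mono_on_def)

lemma simplex_maps_id: "(\<lambda>i. i) \<in> simplex_maps n n"
  by (auto intro: simplex_mapsI)

lemma simplex_maps_comp:
  "\<psi> \<in> simplex_maps l m \<Longrightarrow> \<theta> \<in> simplex_maps m n \<Longrightarrow> (\<lambda>i. \<theta> (\<psi> i)) \<in> simplex_maps l n"
  by (auto intro!: simplex_mapsI intro: simplex_maps_le simplex_maps_mono)

lemma simplex_push_cong:
  "(\<And>i. i \<le> m \<Longrightarrow> \<theta> i = \<psi> i) \<Longrightarrow> simplex_push m \<theta> = simplex_push m \<psi>"
  by (auto simp: simplex_push_def fun_eq_iff intro!: sum.cong)

lemma simplex_push_id:
  assumes "\<And>i. n < i \<Longrightarrow> t i = 0"
  shows "simplex_push n (\<lambda>i. i) t = t"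
proof
  fix j
  have "{i. i \<le> n \<and> i = j} = (if j \<le> n then {j} else {})" by auto
  then show "simplex_push n (\<lambda>i. i) t j = t j"
    using assms by (simp add: simplex_push_def)
qed

text \<open>\<open>simplex_push\<close> is the image of a measure. For an initial segment
  \<open>J\<close> the two sides are values of distribution functions, which
  \<open>simplex_maps_determined\<close> compares.\<close>

lemma sum_simplex_push:
  assumes "finite J"
  shows "(\<Sum>j\<in>J. simplex_push m \<theta> t j) = (\<Sum>i | i \<le> m \<and> \<theta> i \<in> J. t i)"
proof -
  have "(\<Sum>i | i \<le> m \<and> \<theta> i \<in> J. t i) = (\<Sum>j\<in>J. \<Sum>i | i \<in> {i. i \<le> m \<and> \<theta> i \<in> J} \<and> \<theta> i = j. t i)"
    using assms by (intro sum.group[symmetric]) auto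
  also have "\<dots> = (\<Sum>j\<in>J. simplex_push m \<theta> t j)"
    unfolding simplex_push_def by (intro sum.cong) auto
  finally show ?thesis ..
qed

lemma simplex_push_comp:
  assumes "\<psi> \<in> simplex_maps l m"
  shows "simplex_push m \<theta> (simplex_push l \<psi> t) = simplex_push l (\<lambda>i. \<theta> (\<psi> i)) t"
proof
  fix j
  have "simplex_push m \<theta> (simplex_push l \<psi> t) j = (\<Sum>i | i \<le> l \<and> \<psi> i \<in> {i. i \<le> m \<and> \<theta> i = j}. t i)"
    unfolding simplex_push_def[of m] by (rule sum_simplex_push) simp
  also have "\<dots> = simplex_push l (\<lambda>i. \<theta> (\<psi> i)) t j"
    unfolding simplex_push_def using simplex_maps_le[OF assms] by (intro sum.cong) auto
  finally show "simplex_push m \<theta> (simplex_push l \<psi> t) j = simplex_push l (\<lambda>i. \<theta> (\<psi> i)) t j" .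
qed

lemma standard_simplex_iff:
  "t \<in> standard_simplex n \<longleftrightarrow> (\<forall>i. 0 \<le> t i) \<and> (\<forall>i>n. t i = 0) \<and> (\<Sum>i\<le>n. t i) = 1"
proof -
  have "t i \<le> 1" if "\<forall>i. 0 \<le> t i" "\<forall>i>n. t i = 0" "(\<Sum>i\<le>n. t i) = 1" for i
    using that member_le_sum[of i "{..n}" t] by (cases "i \<le> n") auto
  then show ?thesis by (auto simp: standard_simplex_def)
qed

lemma simplex_push_in:
  assumes \<theta>: "\<theta> \<in> simplex_maps m n" and t: "t \<in> standard_simplex m"
  shows "simplex_push m \<theta> t \<in> standard_simplex n"
  unfolding standard_simplex_iff
proof (intro conjI allI impI)
  show "0 \<le> simplex_push m \<theta> t i" for i
    using t by (auto simp: simplex_push_def standard_simplex_iff intro: sum_nonneg)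
  show "simplex_push m \<theta> t i = 0" if "n < i" for i
  proof -
    have "{k. k \<le> m \<and> \<theta> k = i} = {}" using simplex_maps_le[OF \<theta>] that by fastforce
    then show ?thesis unfolding simplex_push_def by (simp only: sum.empty)
  qed
  have "(\<Sum>j\<le>n. simplex_push m \<theta> t j) = (\<Sum>i | i \<le> m \<and> \<theta> i \<in> {..n}. t i)"
    by (rule sum_simplex_push) simp
  also have "{i. i \<le> m \<and> \<theta> i \<in> {..n}} = {..m}" using simplex_maps_le[OF \<theta>] by auto
  finally show "(\<Sum>j\<le>n. simplex_push m \<theta> t j) = 1" using t by (simp add: standard_simplex_iff)
qed

section \<open>Monotone couplings and common refinements\<close>

lemma simplex_push_Suc:
  "simplex_push (Suc m) \<theta> t j = simplex_push m \<theta> t j + (if \<theta> (Suc m) = j then t (Suc m) else 0)"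
proof -
  have "{i. i \<le> Suc m \<and> \<theta> i = j} =
    (if \<theta> (Suc m) = j then insert (Suc m) {i. i \<le> m \<and> \<theta> i = j} else {i. i \<le> m \<and> \<theta> i = j})"
    by (auto simp: le_Suc_eq)
  then show ?thesis by (simp add: simplex_push_def)
qed

text \<open>A coupling of two distributions on chains that is carried by a chain. Being monotone, it is
  mapped to the monotone coupling of the images under monotone maps; if the images agree, that is
  the diagonal (see \<open>simplex_refinement\<close> below).\<close>

definition coupled ::
    "nat \<Rightarrow> nat \<Rightarrow> nat \<Rightarrow> (nat \<Rightarrow> real) \<Rightarrow> (nat \<Rightarrow> real) \<Rightarrow> bool" where
  "coupled P n n' v v' \<longleftrightarrow> (\<exists>w a b. a \<in> simplex_maps P n \<and> b \<in> simplex_maps P n' \<and>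
     (\<forall>i. 0 \<le> w i) \<and> (\<forall>i>P. w i = 0) \<and> simplex_push P a w = v \<and> simplex_push P b w = v')"

lemma coupled_sym: "coupled P n n' v v' \<Longrightarrow> coupled P n' n v' v"
  unfolding coupled_def by blast

text \<open>The mass \<open>d\<close> is put at the pair (m, m') as a new last point of the chain;
  the inequalities keep the two projections monotone.\<close>

lemma coupled_extend:
  assumes "coupled P n n' v v'" "n \<le> m" "n' \<le> m'" "0 \<le> d"
  shows "coupled (Suc P) m m' (v(m := v m + d)) (v'(m' := v' m' + d))"
proof -
  obtain w a b where w: "a \<in> simplex_maps P n" "b \<in> simplex_maps P n'"
     "\<forall>i. 0 \<le> w i" "\<forall>i>P. w i = 0" "simplex_push P a w = v" "simplex_push P b w = v'"
    using assms unfolding coupled_def by blast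
  have maps: "c(Suc P := j) \<in> simplex_maps (Suc P) j" if "c \<in> simplex_maps P i" "i \<le> j" for c i j
    using that by (intro simplex_mapsI)
      (auto simp: le_Suc_eq intro: simplex_maps_mono order_trans[OF simplex_maps_le])
  have push: "simplex_push (Suc P) (c(Suc P := j)) (w(Suc P := d)) =
      (simplex_push P c w)(j := simplex_push P c w j + d)" for c j
  proof -
    have "simplex_push P (c(Suc P := j)) (w(Suc P := d)) = simplex_push P c w"
      unfolding simplex_push_def by (intro ext sum.cong) auto
    then show ?thesis by (auto simp: simplex_push_Suc)
  qed
  show ?thesis
    unfolding coupled_def
    using w assms maps[OF w(1) assms(2)] maps[OF w(2) assms(3)] push[of a m] push[of b m']
    by (intro exI[of _ "w(Suc P := d)"] exI[of _ "a(Suc P := m)"] exI[of _ "b(Suc P := m')"]) auto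
qed

text \<open>The masses at the top ends are matched greedily: the smaller one is placed at the pair
  (n, n'), after which one of the two dimensions drops. A maximal chain from (0, 0) to (n, n') has n
  + n' + 1 points, whence the dimension of the coupling. The total mass shrinks on the way, so
  \<open>coupled\<close> is stated for arbitrary nonnegative weights.\<close>

lemma coupled_exists:
  assumes "\<forall>i. 0 \<le> v i" "\<forall>i>n. v i = 0" "\<forall>i. 0 \<le> v' i" "\<forall>i>n'. v' i = 0"
    and "sum v {..n} = sum v' {..n'}"
  shows "coupled (n + n') n n' v v'"
  using assms
proof (induction "n + n'" arbitrary: n n' v v' rule: less_induct)
  case less
  \<comment> \<open>On a one-point chain there is no choice: the other distribution is itself the
    coupling.\<close>
  have zero: "coupled (0 + m) 0 m u u'"
    if "\<forall>i>0. u i = 0" "\<forall>i. 0 \<le> u' i" "\<forall>i>m. u' i = 0" "sum u {..0} = sum u' {..m}" for m and u u' :: "nat \<Rightarrow> real"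
  proof -
    have "simplex_push m (\<lambda>i. 0) u' = u"
    proof
      fix j show "simplex_push m (\<lambda>i. 0) u' j = u j"
        using that by (cases "j = 0") (auto simp: simplex_push_def atMost_def)
    qed
    then show ?thesis
      unfolding coupled_def using that simplex_push_id[of m u']
      by (intro exI[of _ u'] exI[of _ "\<lambda>i. 0"] exI[of _ "\<lambda>i. i"]) (auto intro: simplex_mapsI)
  qed
  have step: "coupled (Suc m + Suc m') (Suc m) (Suc m') u u'"
    if u: "\<forall>i. 0 \<le> u i" "\<forall>i>Suc m. u i = 0" "\<forall>i. 0 \<le> u' i" "\<forall>i>Suc m'. u' i = 0"
      and s: "sum u {..Suc m} = sum u' {..Suc m'}" and le: "u (Suc m) \<le> u' (Suc m')"
      and nn: "Suc m + Suc m' = n + n'" for m m' u u'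
  proof -
    define d where "d = u (Suc m)"
    define u1 where "u1 = u(Suc m := 0)"
    define u1' where "u1' = u'(Suc m' := u' (Suc m') - d)"
    have "sum u1 {..m} = sum u1' {..Suc m'}" using s by (simp add: u1_def u1'_def d_def)
    moreover have "\<forall>i>m. u1 i = 0" using u(2) by (auto simp: u1_def)
    ultimately have "coupled (m + Suc m') m (Suc m') u1 u1'"
      using u le nn by (intro less.hyps) (auto simp: u1_def u1'_def d_def)
    from coupled_extend[OF this, of "Suc m" "Suc m'" d] show ?thesis
      using u by (simp add: u1_def u1'_def d_def)
  qed
  show ?case
  proof (cases n)
    case 0
    then show ?thesis using less.prems zero[of v v' n'] by simp
  next
    case n: (Suc m)
    show ?thesis
    proof (cases n')
      case 0
      then show ?thesis using less.prems zero[of v' v n] by (simp add: coupled_sym)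
    next
      case n': (Suc m')
      show ?thesis
      proof (cases "v (Suc m) \<le> v' (Suc m')")
        case True
        then show ?thesis using step[of v m v' m'] less.prems n n' by simp
      next
        case False
        then have "coupled (Suc m' + Suc m) (Suc m') (Suc m) v' v"
          using less.prems n n' by (intro step) auto
        then show ?thesis using n n' coupled_sym by (simp add: add.commute)
      qed
    qed
  qed
qed

lemma simplex_coupling:
  assumes "v \<in> standard_simplex n" "v' \<in> standard_simplex n'"
  obtains w a b where "w \<in> standard_simplex (n + n')" "a \<in> simplex_maps (n + n') n"
    "b \<in> simplex_maps (n + n') n'" "simplex_push (n + n') a w = v" "simplex_push (n + n') b w = v'"
proof -
  obtain w a b where w: "a \<in> simplex_maps (n + n') n" "b \<in> simplex_maps (n + n') n'"
     "\<forall>i. 0 \<le> w i" "\<forall>i>n + n'. w i = 0" "simplex_push (n + n') a w = v" "simplex_push (n + n') b w = v'"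
    using assms coupled_exists[of v n v' n'] unfolding coupled_def standard_simplex_iff by auto
  have "sum w {..n + n'} = sum v {..n}"
  proof -
    have "{i. i \<le> n + n' \<and> a i \<in> {..n}} = {..n + n'}" using simplex_maps_le[OF w(1)] by auto
    then show ?thesis using sum_simplex_push[of "{..n}" "n + n'" a w] w by simp
  qed
  then show ?thesis using w assms that by (simp add: standard_simplex_iff)
qed

text \<open>Discarding the vanishing coordinates moves the point into the interior of the face
  spanned by its support, which provides the positivity required by
  \<open>simplex_maps_determined\<close>.\<close>

lemma simplex_interior:
  assumes w: "w \<in> standard_simplex n"
  obtains m d w0 where "d \<in> simplex_maps m n" "w0 \<in> standard_simplex m" "\<And>i. i \<le> m \<Longrightarrow> 0 < w0 i"
    "simplex_push m d w0 = w"
proof -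
  define S where "S = {i. i \<le> n \<and> 0 < w i}"
  have S: "finite S" by (simp add: S_def)
  have "S \<noteq> {}"
  proof
    assume "S = {}"
    then have "\<forall>i\<le>n. w i = 0" using w unfolding S_def standard_simplex_iff
      by (metis (mono_tags, lifting) antisym_conv2 empty_iff mem_Collect_eq)
    then show False using w by (simp add: standard_simplex_iff)
  qed
  then obtain m where m: "card S = Suc m" using S by (metis card_eq_0_iff not0_implies_Suc)
  obtain d where d: "strict_mono_on {..<card S} d" "\<forall>i<card S. d i \<in> S"
    using finite_enumerate[OF S] by blast
  have inj: "inj_on d {..m}"
    using strict_mono_on_imp_inj_on[OF d(1)] by (simp add: m lessThan_Suc_atMost)
  have im: "d ` {..m} = S"
    using d m S inj by (intro card_subset_eq) (auto simp: card_image)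
  have dm: "d \<in> simplex_maps m n"
  proof (rule simplex_mapsI)
    show "d i \<le> n" if "i \<le> m" for i using d m that by (auto simp: S_def)
    show "d i \<le> d j" if "i \<le> j" "j \<le> m" for i j
      using strict_mono_on_leD[OF d(1)] m that by auto
  qed
  define w0 where "w0 = (\<lambda>i. if i \<le> m then w (d i) else 0)"
  have push: "simplex_push m d w0 = w"
  proof
    fix j
    show "simplex_push m d w0 j = w j"
    proof (cases "j \<in> S")
      case True
      then obtain i where i: "i \<le> m" "d i = j" using im by auto
      then have "{k. k \<le> m \<and> d k = j} = {i}" using inj by (auto simp: inj_on_def)
      then show ?thesis using i by (simp add: simplex_push_def w0_def)
    next
      case False
      then have "{k. k \<le> m \<and> d k = j} = {}" using im by auto
      moreover have "w j = 0" using False w unfolding S_def standard_simplex_iff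
        by (metis (mono_tags, lifting) antisym_conv2 mem_Collect_eq not_le_imp_less)
      ultimately show ?thesis unfolding simplex_push_def by (simp only: sum.empty)
    qed
  qed
  have "sum w0 {..m} = 1"
  proof -
    have "{i. i \<le> m \<and> d i \<in> {..n}} = {..m}" using simplex_maps_le[OF dm] by auto
    then show ?thesis
      using sum_simplex_push[of "{..n}" m d w0] push w by (simp add: standard_simplex_iff)
  qed
  then have "w0 \<in> standard_simplex m"
    using w by (auto simp: standard_simplex_iff w0_def)
  moreover have "0 < w0 i" if "i \<le> m" for i
    using d m that by (auto simp: w0_def S_def)
  ultimately show ?thesis using that dm push by blast
qed

text \<open>If f i < g i, compare the masses that the two images give to the segment up to f i. For
  \<open>f\<close> this includes all weights up to \<open>i\<close>, for \<open>g\<close> only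
  weights strictly below \<open>i\<close>, and the weight at \<open>i\<close> is positive.\<close>

lemma simplex_maps_determined:
  assumes f: "f \<in> simplex_maps m n" and g: "g \<in> simplex_maps m n"
    and pos: "\<And>i. i \<le> m \<Longrightarrow> 0 < w i" and eq: "simplex_push m f w = simplex_push m g w"
    and i: "i \<le> m"
  shows "f i = g i"
proof -
  have less: False if f: "f \<in> simplex_maps m n" and g: "g \<in> simplex_maps m n"
    and eq: "simplex_push m f w = simplex_push m g w" and lt: "f i < g i" for f g :: "nat \<Rightarrow> nat"
  proof -
    have "{k. k \<le> m \<and> g k \<in> {..f i}} \<subseteq> {..<i}"
      using simplex_maps_mono[OF g] lt i by (fastforce simp: not_less[symmetric])
    then have "(\<Sum>k | k \<le> m \<and> g k \<in> {..f i}. w k) \<le> (\<Sum>k<i. w k)"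
      using pos i by (intro sum_mono2) (auto intro: less_imp_le)
    also have "\<dots> < (\<Sum>k\<le>i. w k)"
      using pos[OF i] by (simp add: lessThan_Suc_atMost[symmetric])
    also have "\<dots> \<le> (\<Sum>k | k \<le> m \<and> f k \<in> {..f i}. w k)"
      using simplex_maps_mono[OF f] i pos by (intro sum_mono2) (auto intro: less_imp_le)
    finally show False
      using eq sum_simplex_push[of "{..f i}" m f w] sum_simplex_push[of "{..f i}" m g w] by simp
  qed
  then show ?thesis using f g eq by (metis linorder_neqE_nat)
qed

text \<open>The coupling is restricted to its support. If \<theta> and \<psi> send \<open>v\<close>
  and \<open>v'\<close> to the same point, then \<theta> a and \<psi> b send the interior point
  \<open>w\<close> to the same point and therefore coincide. The refinement is chosen before
  \<theta> and \<psi>, so it serves several such pairs at once.\<close>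

lemma simplex_refinement:
  assumes v: "v \<in> standard_simplex n" and v': "v' \<in> standard_simplex n'"
  obtains m w a b where "w \<in> standard_simplex m" "a \<in> simplex_maps m n" "b \<in> simplex_maps m n'"
    "simplex_push m a w = v" "simplex_push m b w = v'"
    "\<And>l \<theta> \<psi> i. \<theta> \<in> simplex_maps n l \<Longrightarrow> \<psi> \<in> simplex_maps n' l \<Longrightarrow>
       simplex_push n \<theta> v = simplex_push n' \<psi> v' \<Longrightarrow> i \<le> m \<Longrightarrow> \<theta> (a i) = \<psi> (b i)"
proof -
  obtain w a b where w: "w \<in> standard_simplex (n + n')" "a \<in> simplex_maps (n + n') n"
    "b \<in> simplex_maps (n + n') n'" "simplex_push (n + n') a w = v" "simplex_push (n + n') b w = v'"
    using simplex_coupling[OF v v'] .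
  obtain m d w0 where d: "d \<in> simplex_maps m (n + n')" "w0 \<in> standard_simplex m"
      "\<And>i. i \<le> m \<Longrightarrow> 0 < w0 i" "simplex_push m d w0 = w"
    using simplex_interior[OF w(1)] by metis
  let ?a = "\<lambda>i. a (d i)" and ?b = "\<lambda>i. b (d i)"
  have ab: "?a \<in> simplex_maps m n" "?b \<in> simplex_maps m n'"
    using d w by (auto intro: simplex_maps_comp)
  have push: "simplex_push m ?a w0 = v" "simplex_push m ?b w0 = v'"
    using simplex_push_comp[OF d(1)] d w by metis+
  have "\<theta> (?a i) = \<psi> (?b i)" if \<theta>: "\<theta> \<in> simplex_maps n l" "\<psi> \<in> simplex_maps n' l"
    and eq: "simplex_push n \<theta> v = simplex_push n' \<psi> v'" and i: "i \<le> m" for l \<theta> \<psi> i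
  proof (rule simplex_maps_determined[OF simplex_maps_comp[OF ab(1) \<theta>(1)] simplex_maps_comp[OF ab(2) \<theta>(2)]])
    show "0 < w0 i" if "i \<le> m" for i using d that by simp
    show "simplex_push m (\<lambda>i. \<theta> (?a i)) w0 = simplex_push m (\<lambda>i. \<psi> (?b i)) w0"
      using simplex_push_comp[OF ab(1)] simplex_push_comp[OF ab(2)] push eq by metis
  qed fact
  then show ?thesis using that[of w0 m ?a ?b] d ab push by blast
qed

section \<open>Simplicial sets and the equivalence relation on cells\<close>

locale simplicial_set =
  fixes K :: "('x set, 'x) simplicial"
  assumes sop_closed: "\<theta> \<in> simplex_maps m n \<Longrightarrow> x \<in> level K n \<Longrightarrow> sop K m n \<theta> x \<in> level K m"
    and sop_cong: "x \<in> level K n \<Longrightarrow> (\<And>i. i \<le> m \<Longrightarrow> \<theta> i = \<psi> i) \<Longrightarrow> sop K m n \<theta> x = sop K m n \<psi> x"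
    and sop_id: "x \<in> level K n \<Longrightarrow> sop K n n (\<lambda>i. i) x = x"
    and sop_comp: "\<psi> \<in> simplex_maps l m \<Longrightarrow> \<theta> \<in> simplex_maps m n \<Longrightarrow> x \<in> level K n \<Longrightarrow>
      sop K l m \<psi> (sop K m n \<theta> x) = sop K l n (\<lambda>i. \<theta> (\<psi> i)) x"
begin

definition cells :: "'x cell set" where
  "cells = {(n, x, t). x \<in> level K n \<and> t \<in> standard_simplex n}"

text \<open>A single span of operators over one point \<open>v\<close>; it replaces the zigzags of
  arbitrary length in \<open>real_rel\<close>.\<close>

definition common_refinement :: "'x cell \<Rightarrow> 'x cell \<Rightarrow> bool" where
  "common_refinement = (\<lambda>(n, x, t) (n', x', t'). \<exists>m v \<theta> \<theta>'. v \<in> standard_simplex m \<and>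
     \<theta> \<in> simplex_maps m n \<and> \<theta>' \<in> simplex_maps m n' \<and>
     simplex_push m \<theta> v = t \<and> simplex_push m \<theta>' v = t' \<and> sop K m n \<theta> x = sop K m n' \<theta>' x')"

lemma common_refinement_sym: "common_refinement c c' \<Longrightarrow> common_refinement c' c"
  unfolding common_refinement_def by (fastforce split: prod.splits)

lemma common_refinement_refl: "c \<in> cells \<Longrightarrow> common_refinement c c"
proof -
  assume c: "c \<in> cells"
  obtain n x t where [simp]: "c = (n, x, t)" by (metis prod.exhaust)
  have t: "t \<in> standard_simplex n" using c by (simp add: cells_def)
  have "simplex_push n (\<lambda>i. i) t = t"
    using t by (intro simplex_push_id) (simp add: standard_simplex_iff)
  then show ?thesis
    using t simplex_maps_id[of n] by (auto simp: common_refinement_def)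
qed

text \<open>The two spans meet in the middle cell at the same point t'. A common refinement of
  \<open>v\<close> and \<open>v'\<close> that equalizes the two maps into the middle cell is the
  apex of the composite span.\<close>

lemma common_refinement_trans:
  assumes "c \<in> cells" "c' \<in> cells" "c'' \<in> cells"
    and "common_refinement c c'" "common_refinement c' c''"
  shows "common_refinement c c''"
proof -
  obtain n x t n' x' t' n'' x'' t'' where c: "c = (n, x, t)" "c' = (n', x', t')" "c'' = (n'', x'', t'')"
    by (metis prod.exhaust)
  have x: "x \<in> level K n" "x' \<in> level K n'" "x'' \<in> level K n''"
    using assms c by (auto simp: cells_def)
  obtain m v \<theta> \<theta>' where 1: "v \<in> standard_simplex m" "\<theta> \<in> simplex_maps m n" "\<theta>' \<in> simplex_maps m n'"
     "simplex_push m \<theta> v = t" "simplex_push m \<theta>' v = t'" "sop K m n \<theta> x = sop K m n' \<theta>' x'"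
    using assms(4) by (auto simp: common_refinement_def c)
  obtain m' v' \<psi> \<psi>' where 2: "v' \<in> standard_simplex m'" "\<psi> \<in> simplex_maps m' n'" "\<psi>' \<in> simplex_maps m' n''"
     "simplex_push m' \<psi> v' = t'" "simplex_push m' \<psi>' v' = t''" "sop K m' n' \<psi> x' = sop K m' n'' \<psi>' x''"
    using assms(5) by (auto simp: common_refinement_def c)
  obtain p w a b where 3: "w \<in> standard_simplex p" "a \<in> simplex_maps p m" "b \<in> simplex_maps p m'"
    "simplex_push p a w = v" "simplex_push p b w = v'"
    "\<And>l \<theta> \<psi> i. \<theta> \<in> simplex_maps m l \<Longrightarrow> \<psi> \<in> simplex_maps m' l \<Longrightarrow>
       simplex_push m \<theta> v = simplex_push m' \<psi> v' \<Longrightarrow> i \<le> p \<Longrightarrow> \<theta> (a i) = \<psi> (b i)"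
    using simplex_refinement[OF 1(1) 2(1)] by metis
  have "sop K p n (\<lambda>i. \<theta> (a i)) x = sop K p m a (sop K m n \<theta> x)"
    by (rule sop_comp[OF 3(2) 1(2) x(1), symmetric])
  also have "\<dots> = sop K p n' (\<lambda>i. \<theta>' (a i)) x'"
    unfolding 1(6) by (rule sop_comp[OF 3(2) 1(3) x(2)])
  \<comment> \<open>The maps \<open>\<theta>'\<close> and \<psi> push \<open>v\<close> and
    \<open>v'\<close> to the same t', so they agree after refinement.\<close>
  also have "\<dots> = sop K p n' (\<lambda>i. \<psi> (b i)) x'"
    using 3(6)[OF 1(3) 2(2)] 1 2 x by (intro sop_cong) auto
  also have "\<dots> = sop K p m' b (sop K m' n' \<psi> x')"
    by (rule sop_comp[OF 3(3) 2(2) x(2), symmetric])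
  also have "\<dots> = sop K p n'' (\<lambda>i. \<psi>' (b i)) x''"
    unfolding 2(6) by (rule sop_comp[OF 3(3) 2(3) x(3)])
  finally have "sop K p n (\<lambda>i. \<theta> (a i)) x = sop K p n'' (\<lambda>i. \<psi>' (b i)) x''" .
  moreover have "simplex_push p (\<lambda>i. \<theta> (a i)) w = t" "simplex_push p (\<lambda>i. \<psi>' (b i)) w = t''"
    using simplex_push_comp[OF 3(2)] simplex_push_comp[OF 3(3)] 1 2 3 by metis+
  ultimately show ?thesis
    unfolding common_refinement_def c
    using 3 simplex_maps_comp[OF 3(2) 1(2)] simplex_maps_comp[OF 3(3) 2(3)] by blast
qed

text \<open>A generating step is a span with one identity leg, so transitivity absorbs every zigzag.
  Conversely, the two legs of a span are two steps out of its apex.\<close>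

lemma real_rel_common_refinement:
  assumes "c \<in> cells"
  shows "(c, c') \<in> real_rel K \<longleftrightarrow> c' \<in> cells \<and> common_refinement c c'"
proof
  assume "(c, c') \<in> real_rel K"
  then show "c' \<in> cells \<and> common_refinement c c'"
    unfolding real_rel_def
  proof (induction rule: rtrancl_induct)
    case base
    then show ?case using assms common_refinement_refl by simp
  next
    case (step y z)
    have *: "d \<in> cells \<and> d' \<in> cells \<and> common_refinement d d'" if st: "(d, d') \<in> real_step K" for d d'
    proof -
      obtain m n \<theta> x t where d: "d = (m, sop K m n \<theta> x, t)" "d' = (n, x, simplex_push m \<theta> t)"
        and \<theta>: "\<theta> \<in> simplex_maps m n" and x: "x \<in> level K n" and t: "t \<in> standard_simplex m"
        using st unfolding real_step_def by blast
      have "common_refinement d d'"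
        unfolding d common_refinement_def prod.case
        using t \<theta> x simplex_maps_id sop_id sop_closed[OF \<theta> x]
        by (intro exI[of _ m] exI[of _ t] exI[of _ "\<lambda>i. i"] exI[of _ \<theta>])
          (auto intro!: simplex_push_id simp: standard_simplex_iff)
      then show ?thesis
        using t \<theta> x sop_closed simplex_push_in by (auto simp: d cells_def)
    qed
    from step(2) have "z \<in> cells \<and> common_refinement y z"
    proof
      assume "(y, z) \<in> real_step K"
      then show ?thesis using * by blast
    next
      assume "(y, z) \<in> (real_step K)\<inverse>"
      then show ?thesis using *[of z y] common_refinement_sym by blast
    qed
    then show ?case using step.IH common_refinement_trans assms by blast
  qed
next
  assume r: "c' \<in> cells \<and> common_refinement c c'"
  obtain n x t n' x' t' where c: "c = (n, x, t)" "c' = (n', x', t')" by (metis prod.exhaust)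
  obtain m v \<theta> \<theta>' where 1: "v \<in> standard_simplex m" "\<theta> \<in> simplex_maps m n" "\<theta>' \<in> simplex_maps m n'"
     "simplex_push m \<theta> v = t" "simplex_push m \<theta>' v = t'" "sop K m n \<theta> x = sop K m n' \<theta>' x'"
    using r by (auto simp: common_refinement_def c)
  have x: "x \<in> level K n" "x' \<in> level K n'" using assms r by (auto simp: c cells_def)
  have "((m, sop K m n \<theta> x, v), c) \<in> real_step K"
    using 1(1,2,4) x unfolding real_step_def c by blast
  moreover have "((m, sop K m n \<theta> x, v), c') \<in> real_step K"
    using 1(1,3,5) x unfolding real_step_def c 1(6) by blast
  ultimately show "(c, c') \<in> real_rel K"
    unfolding real_rel_def by (meson UnCI converse_iff r_into_rtrancl rtrancl.rtrancl_into_rtrancl)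
qed

lemma real_class_eq_iff:
  assumes "c \<in> cells" "c' \<in> cells"
  shows "real_class K c = real_class K c' \<longleftrightarrow> common_refinement c c'"
proof
  assume "real_class K c = real_class K c'"
  moreover have "c' \<in> real_class K c'" by (simp add: real_class_def real_rel_def)
  ultimately have "(c, c') \<in> real_rel K" by (auto simp: real_class_def)
  then show "common_refinement c c'" using real_rel_common_refinement assms by blast
next
  assume "common_refinement c c'"
  then have "(c, d) \<in> real_rel K \<longleftrightarrow> (c', d) \<in> real_rel K" for d
    using assms common_refinement_trans common_refinement_sym
    unfolding real_rel_common_refinement[OF assms(1)] real_rel_common_refinement[OF assms(2)] by blast
  then show "real_class K c = real_class K c'" by (auto simp: real_class_def)
qed

lemma real_class_members:
  assumes "c \<in> cells" "d \<in> real_class K c"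
  shows "d \<in> cells" "real_class K d = real_class K c"
proof -
  have "(c, d) \<in> real_rel K" using assms by (simp add: real_class_def)
  then show "d \<in> cells" "real_class K d = real_class K c"
    using real_rel_common_refinement[OF assms(1)] real_class_eq_iff assms(1) by metis+
qed

lemma real_class_step:
  assumes "\<theta> \<in> simplex_maps m n" "x \<in> level K n" "t \<in> standard_simplex m"
  shows "real_class K (m, sop K m n \<theta> x, t) = real_class K (n, x, simplex_push m \<theta> t)"
proof -
  have "((m, sop K m n \<theta> x, t), (n, x, simplex_push m \<theta> t)) \<in> real_step K"
    using assms unfolding real_step_def by blast
  then have "(n, x, simplex_push m \<theta> t) \<in> real_class K (m, sop K m n \<theta> x, t)"
    unfolding real_class_def real_rel_def by (simp only: Image_singleton_iff r_into_rtrancl UnI1)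
  then show ?thesis
    using real_class_members(2)[of "(m, sop K m n \<theta> x, t)" "(n, x, simplex_push m \<theta> t)"]
      assms sop_closed[OF assms(1,2)] by (auto simp: cells_def)
qed

lemma topspace_real_cells: "topspace (real_cells K) = cells"
  by (auto simp: real_cells_def cells_def)

lemma topspace_realization: "topspace (realization K) = real_class K ` cells"
  by (simp add: realization_def topspace_identification_topology topspace_real_cells)

lemma real_class_in_realization:
  "x \<in> level K n \<Longrightarrow> t \<in> standard_simplex n \<Longrightarrow> real_class K (n, x, t) \<in> topspace (realization K)"
  by (auto simp: topspace_realization cells_def)

lemma realization_cases:
  assumes "a \<in> topspace (realization K)"
  obtains n x t where "a = real_class K (n, x, t)" "x \<in> level K n" "t \<in> standard_simplex n"
  using assms by (auto simp: topspace_realization cells_def)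

end

section \<open>The topology of the realization\<close>

lemma compact_space_simplex_top: "compact_space (simplex_top n)"
  by (simp add: compact_space_subtopology compactin_standard_simplex)

lemma Hausdorff_space_simplex_top: "Hausdorff_space (simplex_top n)"
  by (simp add: Hausdorff_space_subtopology Hausdorff_space_product_topology)

lemma continuous_map_simplex_push:
  assumes "\<theta> \<in> simplex_maps m n"
  shows "continuous_map (simplex_top m) (simplex_top n) (simplex_push m \<theta>)"
proof -
  have "continuous_map (simplex_top m) (powertop_real UNIV) (simplex_push m \<theta>)"
    unfolding continuous_map_componentwise simplex_push_def
    by (auto intro!: continuous_map_sum continuous_map_from_subtopology continuous_map_product_projection)
  then show ?thesis
    using simplex_push_in[OF assms] by (simp add: continuous_map_in_subtopology image_subset_iff)
qed

lemma openin_prod_discrete: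
  "openin (prod_topology (discrete_topology A) Y) V \<longleftrightarrow>
     V \<subseteq> A \<times> topspace Y \<and> (\<forall>x\<in>A. openin Y {y \<in> topspace Y. (x, y) \<in> V})"
proof (intro iffI conjI ballI; (elim conjE)?)
  assume V: "openin (prod_topology (discrete_topology A) Y) V"
  then show "V \<subseteq> A \<times> topspace Y" using openin_subset by fastforce
  fix x assume "x \<in> A"
  then have "continuous_map Y (prod_topology (discrete_topology A) Y) (\<lambda>y. (x, y))"
    by (simp add: continuous_map_pairwise o_def)
  then show "openin Y {y \<in> topspace Y. (x, y) \<in> V}"
    using V openin_continuous_map_preimage by blast
next
  assume V: "V \<subseteq> A \<times> topspace Y" "\<forall>x\<in>A. openin Y {y \<in> topspace Y. (x, y) \<in> V}"
  have "V = (\<Union>x\<in>A. {x} \<times> {y \<in> topspace Y. (x, y) \<in> V})" using V(1) by auto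
  moreover have "openin (prod_topology (discrete_topology A) Y) ({x} \<times> {y \<in> topspace Y. (x, y) \<in> V})"
    if "x \<in> A" for x
    using V(2) that by (auto simp: openin_prod_Times_iff)
  ultimately show "openin (prod_topology (discrete_topology A) Y) V"
    by (metis (no_types, lifting) openin_Union imageE)
qed

context simplicial_set
begin

lemma openin_real_cells:
  "openin (real_cells K) U \<longleftrightarrow> U \<subseteq> cells \<and>
     (\<forall>n. \<forall>x\<in>level K n. openin (simplex_top n) {t \<in> standard_simplex n. (n, x, t) \<in> U})"
proof -
  have "U \<subseteq> cells \<longleftrightarrow> (\<forall>n. {y. (n, y) \<in> U} \<subseteq> level K n \<times> standard_simplex n)"
    by (auto simp: cells_def)
  moreover have "U \<subseteq> cells \<longleftrightarrow> U \<subseteq> Sigma UNIV (topspace \<circ> (\<lambda>n. prod_topology (discrete_topology (level K n)) (simplex_top n)))"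
    by (auto simp: cells_def)
  ultimately show ?thesis
    unfolding real_cells_def openin_sum_topology openin_prod_discrete by auto
qed

lemma openin_realization:
  "openin (realization K) U \<longleftrightarrow> U \<subseteq> topspace (realization K) \<and>
     (\<forall>n. \<forall>x\<in>level K n. openin (simplex_top n) {t \<in> standard_simplex n. real_class K (n, x, t) \<in> U})"
proof -
  have "{t \<in> standard_simplex n. (n, x, t) \<in> {c \<in> cells. real_class K c \<in> U}} =
        {t \<in> standard_simplex n. real_class K (n, x, t) \<in> U}" if "x \<in> level K n" for n x
    using that by (auto simp: cells_def)
  then show ?thesis
    unfolding realization_def openin_identification_topology topspace_identification_topology
      topspace_real_cells openin_real_cells by auto
qed

lemma quotient_map_real_class: "quotient_map (real_cells K) (realization K) (real_class K)"
  unfolding realization_def by (rule quotient_map_identification_topology)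

lemma continuous_map_real_class:
  assumes "x \<in> level K n"
  shows "continuous_map (simplex_top n) (realization K) (\<lambda>t. real_class K (n, x, t))"
  using assms by (auto simp: continuous_map openin_realization image_subset_iff intro: real_class_in_realization)

lemma continuous_map_from_realization:
  "continuous_map (realization K) Y f \<longleftrightarrow>
     (\<forall>n. \<forall>x\<in>level K n. continuous_map (simplex_top n) Y (\<lambda>t. f (real_class K (n, x, t))))"
proof
  assume "continuous_map (realization K) Y f"
  then show "\<forall>n. \<forall>x\<in>level K n. continuous_map (simplex_top n) Y (\<lambda>t. f (real_class K (n, x, t)))"
    using continuous_map_compose[OF continuous_map_real_class] by (auto simp: o_def)
next
  assume r: "\<forall>n. \<forall>x\<in>level K n. continuous_map (simplex_top n) Y (\<lambda>t. f (real_class K (n, x, t)))"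
  show "continuous_map (realization K) Y f"
    unfolding continuous_map
  proof (intro conjI allI impI)
    show "f ` topspace (realization K) \<subseteq> topspace Y"
      using r by (fastforce elim: realization_cases simp: continuous_map)
    fix U assume U: "openin Y U"
    have "{t \<in> standard_simplex n. real_class K (n, x, t) \<in> {x \<in> topspace (realization K). f x \<in> U}}
      = {t \<in> topspace (simplex_top n). f (real_class K (n, x, t)) \<in> U}" if "x \<in> level K n" for n x
      using that by (auto intro: real_class_in_realization)
    moreover have "openin (simplex_top n) {t \<in> topspace (simplex_top n). f (real_class K (n, x, t)) \<in> U}"
      if "x \<in> level K n" for n x
      using r that U by (intro openin_continuous_map_preimage) auto
    ultimately show "openin (realization K) {x \<in> topspace (realization K). f x \<in> U}"
      unfolding openin_realization by auto
  qed
qed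

text \<open>The topology of \<open>|K|\<close> is detected by the characteristic maps of the cells,
  and these are test maps once the simplices embed in \<open>'z\<close>.\<close>

lemma kspace_realization:
  fixes h :: "(nat \<Rightarrow> real) \<Rightarrow> 'z"
  assumes "inj h"
  shows "kspace TYPE('z) (realization K)"
  unfolding kspace_iff_kopen openin_realization
proof (intro allI impI conjI ballI)
  fix U n x assume "kopen TYPE('z) (realization K) U" "x \<in> level K n"
  from kopen_test[OF this(1) compact_space_simplex_top Hausdorff_space_simplex_top
      continuous_map_real_class[OF this(2)] assms]
  show "openin (simplex_top n) {t \<in> standard_simplex n. real_class K (n, x, t) \<in> U}"
    by simp
qed

lemma kspace_real_cells:
  fixes h :: "(nat \<Rightarrow> real) \<Rightarrow> 'z"
  assumes "inj h"
  shows "kspace TYPE('z) (real_cells K)"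
proof -
  have c: "continuous_map (simplex_top n) (real_cells K) (\<lambda>t. (n, x, t))" if "x \<in> level K n" for n x
    using that by (auto simp: continuous_map openin_real_cells topspace_real_cells cells_def)
  show ?thesis
    unfolding kspace_iff_kopen openin_real_cells
  proof (intro allI impI conjI ballI)
    fix U n x assume "kopen TYPE('z) (real_cells K) U" "x \<in> level K n"
    from kopen_test[OF this(1) compact_space_simplex_top Hausdorff_space_simplex_top
        c[OF this(2)] assms]
    show "openin (simplex_top n) {t \<in> standard_simplex n. (n, x, t) \<in> U}" by simp
  qed (simp add: topspace_real_cells)
qed

text \<open>The space of cells is a disjoint sum of simplices, so an open box inside a pair of them
  is open in the whole square.\<close>

lemma openin_real_cells_square:
  assumes "V \<subseteq> cells \<times> cells"
    and V: "\<And>n x m y. x \<in> level K n \<Longrightarrow> y \<in> level K m \<Longrightarrow>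
      openin (prod_topology (simplex_top n) (simplex_top m))
        {(s, t) \<in> standard_simplex n \<times> standard_simplex m. ((n, x, s), (m, y, t)) \<in> V}"
  shows "openin (prod_topology (real_cells K) (real_cells K)) V"
  unfolding openin_prod_topology_alt
proof (intro allI impI)
  fix c d assume cd: "(c, d) \<in> V"
  obtain n x s m y t where [simp]: "c = (n, x, s)" "d = (m, y, t)" by (metis prod.exhaust)
  have c: "x \<in> level K n" "s \<in> standard_simplex n" and d: "y \<in> level K m" "t \<in> standard_simplex m"
    using cd assms(1) by (auto simp: cells_def)
  obtain A B where AB: "openin (simplex_top n) A" "openin (simplex_top m) B" "s \<in> A" "t \<in> B"
    "A \<times> B \<subseteq> {(s, t) \<in> standard_simplex n \<times> standard_simplex m. ((n, x, s), (m, y, t)) \<in> V}"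
    using V[OF c(1) d(1), unfolded openin_prod_topology_alt, rule_format, of s t] cd c d by auto
  have op: "openin (real_cells K) ((\<lambda>t. (k, z, t)) ` C)"
    if "z \<in> level K k" "openin (simplex_top k) C" for k z C
  proof -
    have "C \<subseteq> standard_simplex k" using openin_subset[OF that(2)] by simp
    moreover have "{t \<in> standard_simplex n. (n, x, t) \<in> (\<lambda>t. (k, z, t)) ` C} =
        (if n = k \<and> x = z then C else {})" if "x \<in> level K n" for n x
      using calculation by auto
    ultimately show ?thesis using that by (auto simp: openin_real_cells cells_def)
  qed
  have "(\<lambda>t. (n, x, t)) ` A \<times> (\<lambda>t. (m, y, t)) ` B \<subseteq> V" using AB(5) by auto
  then show "\<exists>U W. openin (real_cells K) U \<and> openin (real_cells K) W \<and> c \<in> U \<and> d \<in> W \<and> U \<times> W \<subseteq> V"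
    using op[OF c(1) AB(1)] op[OF d(1) AB(2)] AB(3,4)
    by (intro exI[of _ "(\<lambda>t. (n, x, t)) ` A"] exI[of _ "(\<lambda>t. (m, y, t)) ` B"]) auto
qed

end

section \<open>Maps between realizations, and products\<close>

definition simplicial_map ::
    "('x set, 'x) simplicial \<Rightarrow> ('y set, 'y) simplicial \<Rightarrow> (nat \<Rightarrow> 'x \<Rightarrow> 'y) \<Rightarrow> bool" where
  "simplicial_map K L f \<longleftrightarrow> (\<forall>n. f n \<in> level K n \<rightarrow> level L n) \<and>
     (\<forall>m n. \<forall>\<theta>\<in>simplex_maps m n. \<forall>x\<in>level K n. f m (sop K m n \<theta> x) = sop L m n \<theta> (f n x))"

text \<open>A simplicial map carries common refinements to common refinements. Hence all
  representatives of a class go into one class, and the union formed by \<open>real_map\<close> is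
  that class.\<close>

lemma real_map_class:
  assumes K: "simplicial_set K" and L: "simplicial_set L" and f: "simplicial_map K L f"
    and x: "x \<in> level K n" and t: "t \<in> standard_simplex n"
  shows "real_map L f (real_class K (n, x, t)) = real_class L (n, f n x, t)"
proof -
  interpret K: simplicial_set K by fact
  interpret L: simplicial_set L by fact
  have cl: "real_class L (n', f n' x', t') = real_class L (n, f n x, t)"
    if c: "(n', x', t') \<in> real_class K (n, x, t)" for n' x' t'
  proof -
    have c0: "(n, x, t) \<in> K.cells" using x t by (simp add: K.cells_def)
    have c': "(n', x', t') \<in> K.cells" "K.common_refinement (n, x, t) (n', x', t')"
      using K.real_class_members[OF c0 c] K.real_class_eq_iff[OF c0] by metis+
    then obtain m v \<theta> \<theta>' where 1: "v \<in> standard_simplex m" "\<theta> \<in> simplex_maps m n" "\<theta>' \<in> simplex_maps m n'"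
     "simplex_push m \<theta> v = t" "simplex_push m \<theta>' v = t'" "sop K m n \<theta> x = sop K m n' \<theta>' x'"
      unfolding K.common_refinement_def by auto
    have x': "x' \<in> level K n'" "t' \<in> standard_simplex n'" using c' by (auto simp: K.cells_def)
    have "sop L m n \<theta> (f n x) = f m (sop K m n \<theta> x)"
      using f 1(2) x by (simp add: simplicial_map_def)
    also have "\<dots> = sop L m n' \<theta>' (f n' x')"
      unfolding 1(6) using f 1(3) x' by (simp add: simplicial_map_def)
    finally have "L.common_refinement (n, f n x, t) (n', f n' x', t')"
      unfolding L.common_refinement_def using 1 by auto
    moreover have "(n, f n x, t) \<in> L.cells" "(n', f n' x', t') \<in> L.cells"
      using f x t x' by (auto simp: L.cells_def simplicial_map_def)
    ultimately show ?thesis using L.real_class_eq_iff by metis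
  qed
  have "real_map L f (real_class K (n, x, t)) =
    (\<Union>(n', x', t')\<in>real_class K (n, x, t). real_class L (n', f n' x', t'))"
    unfolding real_map_def real_class_def[of L] by (force simp: Image_iff)
  also have "\<dots> = real_class L (n, f n x, t)"
  proof -
    have "(n, x, t) \<in> real_class K (n, x, t)" by (simp add: real_class_def real_rel_def)
    then have "(\<Union>c\<in>real_class K (n, x, t). real_class L (n, f n x, t)) = real_class L (n, f n x, t)"
      by blast
    moreover have "(\<Union>(n', x', t')\<in>real_class K (n, x, t). real_class L (n', f n' x', t')) =
      (\<Union>c\<in>real_class K (n, x, t). real_class L (n, f n x, t))"
      using cl by (intro SUP_cong refl) (auto simp only: split_paired_all prod.case)
    ultimately show ?thesis by (rule trans[rotated])
  qed
  finally show ?thesis .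
qed

lemma continuous_map_real_map:
  assumes K: "simplicial_set K" and L: "simplicial_set L" and f: "simplicial_map K L f"
  shows "continuous_map (realization K) (realization L) (real_map L f)"
proof -
  interpret K: simplicial_set K by fact
  interpret L: simplicial_set L by fact
  have "continuous_map (simplex_top n) (realization L) (\<lambda>t. real_map L f (real_class K (n, x, t)))"
    if x: "x \<in> level K n" for n x
  proof (rule continuous_map_eq)
    show "continuous_map (simplex_top n) (realization L) (\<lambda>t. real_class L (n, f n x, t))"
      using f x by (intro L.continuous_map_real_class) (auto simp: simplicial_map_def)
  qed (simp add: real_map_class[OF K L f x])
  then show ?thesis by (simp add: K.continuous_map_from_realization)
qed

lemma simplicial_set_sset_prod:
  assumes "simplicial_set K" "simplicial_set L"
  shows "simplicial_set (sset_prod K L)"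
proof -
  interpret K: simplicial_set K by fact
  interpret L: simplicial_set L by fact
  show ?thesis
    by unfold_locales
      (auto simp: sset_prod_def K.sop_closed L.sop_closed K.sop_id L.sop_id K.sop_comp L.sop_comp
        intro!: K.sop_cong L.sop_cong)
qed

lemma simplicial_map_fst: "simplicial_map (sset_prod K L) K (\<lambda>n. fst)"
  and simplicial_map_snd: "simplicial_map (sset_prod K L) L (\<lambda>n. snd)"
  by (auto simp: simplicial_map_def sset_prod_def)

text \<open>One coupling of the two refinements serves both components, so a pair of classes determines
  its preimage.\<close>

lemma real_prod_inj:
  assumes K: "simplicial_set K" and L: "simplicial_set L"
    and c: "c \<in> topspace (realization (sset_prod K L))" and d: "d \<in> topspace (realization (sset_prod K L))"
    and 1: "real_map K (\<lambda>n. fst) c = real_map K (\<lambda>n. fst) d"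
    and 2: "real_map L (\<lambda>n. snd) c = real_map L (\<lambda>n. snd) d"
  shows "c = d"
proof -
  interpret K: simplicial_set K by fact
  interpret L: simplicial_set L by fact
  interpret P: simplicial_set "sset_prod K L" using simplicial_set_sset_prod K L .
  note P = P.simplicial_set_axioms
  obtain n p t where c': "c = real_class (sset_prod K L) (n, p, t)" "p \<in> level (sset_prod K L) n" "t \<in> standard_simplex n"
    using c P.realization_cases by metis
  obtain n' p' t' where d': "d = real_class (sset_prod K L) (n', p', t')" "p' \<in> level (sset_prod K L) n'" "t' \<in> standard_simplex n'"
    using d P.realization_cases by metis
  obtain x y where p: "p = (x, y)" "x \<in> level K n" "y \<in> level L n" using c' by (auto simp: sset_prod_def)
  obtain x' y' where p': "p' = (x', y')" "x' \<in> level K n'" "y' \<in> level L n'" using d' by (auto simp: sset_prod_def)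
  have "real_class K (n, x, t) = real_class K (n', x', t')"
    using 1 real_map_class[OF P K simplicial_map_fst] c' d' p p' by simp
  then have "K.common_refinement (n, x, t) (n', x', t')"
    using K.real_class_eq_iff p p' c' d' by (simp add: K.cells_def)
  then obtain k v \<theta> \<theta>' where 1: "v \<in> standard_simplex k" "\<theta> \<in> simplex_maps k n" "\<theta>' \<in> simplex_maps k n'"
     "simplex_push k \<theta> v = t" "simplex_push k \<theta>' v = t'" "sop K k n \<theta> x = sop K k n' \<theta>' x'"
    unfolding K.common_refinement_def by auto
  have "real_class L (n, y, t) = real_class L (n', y', t')"
    using 2 real_map_class[OF P L simplicial_map_snd] c' d' p p' by simp
  then have "L.common_refinement (n, y, t) (n', y', t')"
    using L.real_class_eq_iff p p' c' d' by (simp add: L.cells_def)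
  then obtain l w \<psi> \<psi>' where 2: "w \<in> standard_simplex l" "\<psi> \<in> simplex_maps l n" "\<psi>' \<in> simplex_maps l n'"
     "simplex_push l \<psi> w = t" "simplex_push l \<psi>' w = t'" "sop L l n \<psi> y = sop L l n' \<psi>' y'"
    unfolding L.common_refinement_def by auto
  obtain m u a b where 3: "u \<in> standard_simplex m" "a \<in> simplex_maps m k" "b \<in> simplex_maps m l"
    "simplex_push m a u = v" "simplex_push m b u = w"
    "\<And>q \<theta> \<psi> i. \<theta> \<in> simplex_maps k q \<Longrightarrow> \<psi> \<in> simplex_maps l q \<Longrightarrow>
       simplex_push k \<theta> v = simplex_push l \<psi> w \<Longrightarrow> i \<le> m \<Longrightarrow> \<theta> (a i) = \<psi> (b i)"
    using simplex_refinement[OF 1(1) 2(1)] by metis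
  have "sop K m n (\<lambda>i. \<theta> (a i)) x = sop K m k a (sop K k n \<theta> x)"
    by (rule K.sop_comp[OF 3(2) 1(2) p(2), symmetric])
  also have "\<dots> = sop K m n' (\<lambda>i. \<theta>' (a i)) x'"
    unfolding 1(6) by (rule K.sop_comp[OF 3(2) 1(3) p'(2)])
  finally have eqK: "sop K m n (\<lambda>i. \<theta> (a i)) x = sop K m n' (\<lambda>i. \<theta>' (a i)) x'" .
  \<comment> \<open>The operators found for \<open>K\<close> are imposed on \<open>L\<close>: since
    \<theta> and \<psi> push \<open>v\<close> and \<open>w\<close> to the same t, \<theta> a may be
    exchanged for \<psi> b, and back again for the primed maps.\<close>
  have "sop L m n (\<lambda>i. \<theta> (a i)) y = sop L m n (\<lambda>i. \<psi> (b i)) y"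
    using 3(6)[OF 1(2) 2(2)] 1 2 p by (intro L.sop_cong) auto
  also have "\<dots> = sop L m l b (sop L l n \<psi> y)"
    by (rule L.sop_comp[OF 3(3) 2(2) p(3), symmetric])
  also have "\<dots> = sop L m n' (\<lambda>i. \<psi>' (b i)) y'"
    unfolding 2(6) by (rule L.sop_comp[OF 3(3) 2(3) p'(3)])
  also have "\<dots> = sop L m n' (\<lambda>i. \<theta>' (a i)) y'"
    using 3(6)[OF 1(3) 2(3)] 1 2 p' by (intro L.sop_cong) auto
  finally have eqL: "sop L m n (\<lambda>i. \<theta> (a i)) y = sop L m n' (\<lambda>i. \<theta>' (a i)) y'" .
  have "P.common_refinement (n, p, t) (n', p', t')"
    unfolding P.common_refinement_def p p'
    unfolding prod.case
    using 3(1) simplex_maps_comp[OF 3(2) 1(2)] simplex_maps_comp[OF 3(2) 1(3)]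
      simplex_push_comp[OF 3(2)] 3(4) 1(4,5) eqK eqL
    by (intro exI[of _ m] exI[of _ u] exI[of _ "\<lambda>i. \<theta> (a i)"] exI[of _ "\<lambda>i. \<theta>' (a i)"])
      (auto simp: sset_prod_def)
  then show ?thesis
    using P.real_class_eq_iff c' d' by (simp add: P.cells_def)
qed

section \<open>The group structure on the realization of a simplicial abelian group\<close>

locale simplicial_abelian_group =
  fixes K :: "(('k, 'x) module, 'x) simplicial"
  assumes level_group: "abelian_group (level K n)"
    and simplicial: "simplicial_set (underlying K)"
    and sop_add: "\<theta> \<in> simplex_maps m n \<Longrightarrow> x \<in> carrier (level K n) \<Longrightarrow> y \<in> carrier (level K n) \<Longrightarrow>
      sop K m n \<theta> (x \<oplus>\<^bsub>level K n\<^esub> y) = sop K m n \<theta> x \<oplus>\<^bsub>level K m\<^esub> sop K m n \<theta> y"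
begin

lemma underlying_simps [simp]:
  "level (underlying K) n = carrier (level K n)" "sop (underlying K) = sop K"
  by (simp_all add: underlying_def)

sublocale U: simplicial_set "underlying K" by (rule simplicial)

abbreviation cls :: "nat \<Rightarrow> 'x \<Rightarrow> (nat \<Rightarrow> real) \<Rightarrow> 'x cell set" where
  "cls n x t \<equiv> real_class (underlying K) (n, x, t)"

abbreviation R where "R \<equiv> real_group K"

lemma carrier_real_group: "carrier R = topspace (real_top K)"
  by (simp add: real_group_def real_top_def Let_def)

lemma cls_in: "x \<in> carrier (level K n) \<Longrightarrow> t \<in> standard_simplex n \<Longrightarrow> cls n x t \<in> carrier R"
  using U.real_class_in_realization by (simp add: carrier_real_group real_top_def)

lemma real_group_cases:
  assumes "a \<in> carrier R"
  obtains n x t where "a = cls n x t" "x \<in> carrier (level K n)" "t \<in> standard_simplex n"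
  using assms U.realization_cases unfolding carrier_real_group real_top_def underlying_simps by metis

lemma sop_in: "\<theta> \<in> simplex_maps m n \<Longrightarrow> x \<in> carrier (level K n) \<Longrightarrow> sop K m n \<theta> x \<in> carrier (level K m)"
  using U.sop_closed by simp

lemma cls_step:
  assumes "\<theta> \<in> simplex_maps m n" "x \<in> carrier (level K n)" "t \<in> standard_simplex m"
  shows "cls n x (simplex_push m \<theta> t) = cls m (sop K m n \<theta> x) t"
  using U.real_class_step assms by simp

lemma add_in:
  "x \<in> carrier (level K n) \<Longrightarrow> y \<in> carrier (level K n) \<Longrightarrow> x \<oplus>\<^bsub>level K n\<^esub> y \<in> carrier (level K n)"
  by (simp add: abelian_groupE(1) level_group)

text \<open>Over one point \<open>t\<close> the pair (x, y) is a cell of the product, and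
  \<open>real_prod_inj\<close> makes its class the only candidate in the definite description of
  \<open>real_group\<close>.\<close>

lemma real_mult_cls:
  assumes x: "x \<in> carrier (level K n)" and y: "y \<in> carrier (level K n)" and t: "t \<in> standard_simplex n"
  shows "cls n x t \<otimes>\<^bsub>R\<^esub> cls n y t = cls n (x \<oplus>\<^bsub>level K n\<^esub> y) t"
proof -
  let ?U = "underlying K"
  let ?P = "sset_prod ?U ?U"
  interpret P: simplicial_set ?P by (intro simplicial_set_sset_prod simplicial)
  note P = P.simplicial_set_axioms
  have xy: "(x, y) \<in> level ?P n" using x y by (simp add: sset_prod_def)
  have add: "simplicial_map ?P ?U (\<lambda>n (x, y). x \<oplus>\<^bsub>level K n\<^esub> y)"
    by (auto simp: simplicial_map_def sset_prod_def add_in sop_add)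
  have "(THE c. c \<in> topspace (realization ?P) \<and> real_map ?U (\<lambda>n. fst) c = cls n x t \<and>
     real_map ?U (\<lambda>n. snd) c = cls n y t) = real_class ?P (n, (x, y), t)"
  proof (rule the_equality)
    have 1: "real_map ?U (\<lambda>n. fst) (real_class ?P (n, (x, y), t)) = cls n x t"
      using real_map_class[OF P simplicial simplicial_map_fst xy t] by simp
    have 2: "real_map ?U (\<lambda>n. snd) (real_class ?P (n, (x, y), t)) = cls n y t"
      using real_map_class[OF P simplicial simplicial_map_snd xy t] by simp
    show *: "real_class ?P (n, (x, y), t) \<in> topspace (realization ?P) \<and>
       real_map ?U (\<lambda>n. fst) (real_class ?P (n, (x, y), t)) = cls n x t \<and>
       real_map ?U (\<lambda>n. snd) (real_class ?P (n, (x, y), t)) = cls n y t"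
      using 1 2 P.real_class_in_realization[OF xy t] by blast
    show "c = real_class ?P (n, (x, y), t)"
      if "c \<in> topspace (realization ?P) \<and> real_map ?U (\<lambda>n. fst) c = cls n x t \<and>
        real_map ?U (\<lambda>n. snd) c = cls n y t" for c
      using that * by (intro real_prod_inj[OF simplicial simplicial]) auto
  qed
  then show ?thesis
    using real_map_class[OF P simplicial add xy t] by (simp add: real_group_def Let_def)
qed

text \<open>The operator of the map from [n] to [0] takes zero to zero and every \<open>t\<close> to
  the vertex, so zero over \<open>t\<close> is identified with the zero vertex.\<close>

lemma cls_zero:
  assumes "t \<in> standard_simplex n"
  shows "cls n \<zero>\<^bsub>level K n\<^esub> t = \<one>\<^bsub>R\<^esub>"
proof -
  have z: "(\<lambda>i. 0) \<in> simplex_maps n 0" by (auto intro: simplex_mapsI)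
  have p: "simplex_push n (\<lambda>i. 0) t = (\<lambda>j. if j = 0 then 1 else 0)"
    using assms simplex_push_in[OF z assms] by (simp add: standard_simplex_0)
  interpret L0: abelian_group "level K 0" by (rule level_group)
  interpret Ln: abelian_group "level K n" by (rule level_group)
  let ?z = "sop K n 0 (\<lambda>i. 0) \<zero>\<^bsub>level K 0\<^esub>"
  \<comment> \<open>Only additivity of the operators is assumed; it makes the image of zero
    idempotent, hence zero.\<close>
  have "?z \<oplus>\<^bsub>level K n\<^esub> ?z = ?z"
    using sop_add[OF z L0.zero_closed L0.zero_closed] by simp
  moreover have "?z \<in> carrier (level K n)" using sop_in z by blast
  ultimately have "?z = \<zero>\<^bsub>level K n\<^esub>" by (metis Ln.add.l_cancel_one')
  then show ?thesis
    using cls_step[OF z L0.zero_closed assms] p by (simp add: real_group_def Let_def)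
qed

text \<open>This is the surjectivity of
  \<open>|K \<times> K| \<rightarrow> |K| \<times> |K|\<close>: a coupling of the two points
  represents both classes over one point of a common simplex.\<close>

lemma real_group_cases2:
  assumes "a \<in> carrier R" "x \<in> carrier (level K n)" "t \<in> standard_simplex n"
  obtains m \<theta> y s where "\<theta> \<in> simplex_maps m n" "y \<in> carrier (level K m)" "s \<in> standard_simplex m"
    "simplex_push m \<theta> s = t" "a = cls m y s" "cls n x t = cls m (sop K m n \<theta> x) s"
proof -
  obtain l z r where a: "a = cls l z r" "z \<in> carrier (level K l)" "r \<in> standard_simplex l"
    using assms real_group_cases by metis
  obtain w \<theta> \<psi> where w: "w \<in> standard_simplex (n + l)" "\<theta> \<in> simplex_maps (n + l) n"
    "\<psi> \<in> simplex_maps (n + l) l" "simplex_push (n + l) \<theta> w = t" "simplex_push (n + l) \<psi> w = r"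
    using simplex_coupling[OF assms(3) a(3)] .
  show ?thesis
    using that[OF w(2) sop_in[OF w(3) a(2)] w(1,4)] cls_step[OF w(3) a(2) w(1)] cls_step[OF w(2) assms(2) w(1)] a w
    by simp
qed

text \<open>The axioms are inherited from the levels by taking representatives over one point. For
  associativity the third element is coupled with the cell that already carries the first
  two.\<close>

lemma group_real_group: "group R"
proof (rule groupI)
  fix a b assume a: "a \<in> carrier R" and b: "b \<in> carrier R"
  obtain n x t where 1: "a = cls n x t" "x \<in> carrier (level K n)" "t \<in> standard_simplex n"
    using a real_group_cases by metis
  obtain m \<theta> y s where 2: "\<theta> \<in> simplex_maps m n" "y \<in> carrier (level K m)" "s \<in> standard_simplex m"
    "simplex_push m \<theta> s = t" "b = cls m y s" "cls n x t = cls m (sop K m n \<theta> x) s"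
    using real_group_cases2[OF b 1(2,3)] .
  show "a \<otimes>\<^bsub>R\<^esub> b \<in> carrier R"
    using 1 2 real_mult_cls sop_in cls_in add_in by simp
  fix c assume c: "c \<in> carrier R"
  let ?x = "sop K m n \<theta> x"
  have x: "?x \<in> carrier (level K m)" using sop_in 1 2 by blast
  have xy: "?x \<oplus>\<^bsub>level K m\<^esub> y \<in> carrier (level K m)" using add_in x 2 by blast
  obtain l \<psi> z r where 3: "\<psi> \<in> simplex_maps l m" "z \<in> carrier (level K l)" "r \<in> standard_simplex l"
    "simplex_push l \<psi> r = s" "c = cls l z r" "cls m (?x \<oplus>\<^bsub>level K m\<^esub> y) s = cls l (sop K l m \<psi> (?x \<oplus>\<^bsub>level K m\<^esub> y)) r"
    using real_group_cases2[OF c xy 2(3)] .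
  let ?x' = "sop K l m \<psi> ?x" and ?y' = "sop K l m \<psi> y"
  have x': "?x' \<in> carrier (level K l)" and y': "?y' \<in> carrier (level K l)" using sop_in 2 3 x by auto
  interpret Ll: abelian_group "level K l" by (rule level_group)
  have rep: "a = cls l ?x' r" "b = cls l ?y' r"
    using 1 2 3 x cls_step by auto
  show "a \<otimes>\<^bsub>R\<^esub> b \<otimes>\<^bsub>R\<^esub> c = a \<otimes>\<^bsub>R\<^esub> (b \<otimes>\<^bsub>R\<^esub> c)"
    unfolding rep 3(5) using x' y' 3 by (simp add: real_mult_cls Ll.a_assoc)
next
  interpret L0: abelian_group "level K 0" by (rule level_group)
  show "\<one>\<^bsub>R\<^esub> \<in> carrier R"
    using cls_in[OF L0.zero_closed, of "\<lambda>j. if j = 0 then 1 else 0"] by (simp add: cls_zero)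
next
  fix a assume "a \<in> carrier R"
  then obtain n x t where 1: "a = cls n x t" "x \<in> carrier (level K n)" "t \<in> standard_simplex n"
    using real_group_cases by metis
  interpret Ln: abelian_group "level K n" by (rule level_group)
  show "\<one>\<^bsub>R\<^esub> \<otimes>\<^bsub>R\<^esub> a = a"
    using 1 cls_zero[OF 1(3), symmetric] by (simp add: real_mult_cls)
  show "\<exists>b\<in>carrier R. b \<otimes>\<^bsub>R\<^esub> a = \<one>\<^bsub>R\<^esub>"
    using 1 cls_zero[OF 1(3), symmetric]
    by (intro bexI[of _ "cls n (\<ominus>\<^bsub>level K n\<^esub> x) t"]) (simp_all add: real_mult_cls Ln.l_neg cls_in)
qed

lemma inv_cls:
  assumes "x \<in> carrier (level K n)" "t \<in> standard_simplex n"
  shows "inv\<^bsub>R\<^esub> (cls n x t) = cls n (\<ominus>\<^bsub>level K n\<^esub> x) t"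
proof -
  interpret Ln: abelian_group "level K n" by (rule level_group)
  interpret R: group R by (rule group_real_group)
  show ?thesis
    using assms by (intro R.inv_equality) (simp_all add: real_mult_cls Ln.l_neg cls_zero cls_in)
qed

text \<open>Finitely many simplices of dimension \<open>n + m\<close> cover the product of the two simplices, and on each
  of them the multiplication is the characteristic map of a single cell.\<close>

lemma closedin_real_mult:
  assumes F: "closedin (real_top K) F" and x: "x \<in> carrier (level K n)" and y: "y \<in> carrier (level K m)"
  shows "closedin (prod_topology (simplex_top n) (simplex_top m))
    {(s, t) \<in> standard_simplex n \<times> standard_simplex m. cls n x s \<otimes>\<^bsub>R\<^esub> cls m y t \<in> F}"
proof -
  let ?N = "n + m"
  let ?T = "prod_topology (simplex_top n) (simplex_top m)"
  \<comment> \<open>Monotone maps are represented by functions on all of \<open>nat\<close>; cutting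
    them off above \<open>?N\<close> leaves finitely many.\<close>
  define I where "I = (simplex_maps ?N n \<inter> extensional {..?N}) \<times> (simplex_maps ?N m \<inter> extensional {..?N})"
  define C where "C = (\<lambda>(a, b). {u \<in> standard_simplex ?N.
     cls ?N (sop K ?N n a x \<oplus>\<^bsub>level K ?N\<^esub> sop K ?N m b y) u \<in> F})"
  define P where "P = (\<lambda>(a, b) u. (simplex_push ?N a u, simplex_push ?N b u))"
  have "finite I"
  proof -
    have "simplex_maps ?N k \<inter> extensional {..?N} \<subseteq> {..?N} \<rightarrow>\<^sub>E {..k}" for k
      by (auto simp: simplex_maps_def PiE_def)
    then show ?thesis unfolding I_def
      by (meson finite_PiE finite_SigmaI finite_atMost finite_subset)
  qed
  have mult: "cls n x (simplex_push ?N a u) \<otimes>\<^bsub>R\<^esub> cls m y (simplex_push ?N b u) =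
      cls ?N (sop K ?N n a x \<oplus>\<^bsub>level K ?N\<^esub> sop K ?N m b y) u"
    if "a \<in> simplex_maps ?N n" "b \<in> simplex_maps ?N m" "u \<in> standard_simplex ?N" for a b u
    using that x y by (simp add: cls_step real_mult_cls sop_in)
  have "closedin ?T (P i ` C i)" if iI: "i \<in> I" for i
  proof -
    obtain a b where i: "i = (a, b)" "a \<in> simplex_maps ?N n" "b \<in> simplex_maps ?N m"
      using iI by (auto simp: I_def)
    let ?z = "sop K ?N n a x \<oplus>\<^bsub>level K ?N\<^esub> sop K ?N m b y"
    have z: "?z \<in> level (underlying K) ?N" using i x y by (simp add: add_in sop_in)
    have "closedin (simplex_top ?N) {u \<in> topspace (simplex_top ?N). cls ?N ?z u \<in> F}"
      using F U.continuous_map_real_class[OF z] unfolding real_top_def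
      by (intro closedin_continuous_map_preimage)
    then have "closedin (simplex_top ?N) (C i)" by (simp add: C_def i)
    then have "compactin (simplex_top ?N) (C i)"
      using closedin_compact_space compact_space_simplex_top by blast
    moreover have "continuous_map (simplex_top ?N) ?T (P i)"
      using continuous_map_simplex_push i by (simp add: P_def continuous_map_pairwise o_def)
    \<comment> \<open>\<open>P i\<close> is not an embedding in general; the image is closed because
      it is compact in a Hausdorff space.\<close>
    ultimately have "compactin ?T (P i ` C i)" by (rule image_compactin)
    then show ?thesis
      by (intro compactin_imp_closedin)
        (simp_all add: Hausdorff_space_prod_topology Hausdorff_space_simplex_top)
  qed
  then have "closedin ?T (\<Union>i\<in>I. P i ` C i)"
    using \<open>finite I\<close> by (intro closedin_Union) auto
  also have "(\<Union>i\<in>I. P i ` C i) =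
      {(s, t) \<in> standard_simplex n \<times> standard_simplex m. cls n x s \<otimes>\<^bsub>R\<^esub> cls m y t \<in> F}" (is "?L = ?R")
  proof (rule antisym)
    show "?L \<subseteq> ?R"
    proof (intro UN_least image_subsetI)
      fix i u assume "i \<in> I" "u \<in> C i"
      then obtain a b where "i = (a, b)" "a \<in> simplex_maps ?N n" "b \<in> simplex_maps ?N m"
        "u \<in> standard_simplex ?N" "cls ?N (sop K ?N n a x \<oplus>\<^bsub>level K ?N\<^esub> sop K ?N m b y) u \<in> F"
        by (auto simp: I_def C_def)
      then show "P i u \<in> ?R" by (simp add: P_def simplex_push_in mult)
    qed
    show "?R \<subseteq> ?L"
    proof clarify
      fix s t assume s: "s \<in> standard_simplex n" and t: "t \<in> standard_simplex m"
        and st: "cls n x s \<otimes>\<^bsub>R\<^esub> cls m y t \<in> F"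
      obtain w a b where w: "w \<in> standard_simplex ?N" "a \<in> simplex_maps ?N n"
        "b \<in> simplex_maps ?N m" "simplex_push ?N a w = s" "simplex_push ?N b w = t"
        using simplex_coupling[OF s t] .
      let ?a = "restrict a {..?N}" and ?b = "restrict b {..?N}"
      have ab: "?a \<in> simplex_maps ?N n" "?b \<in> simplex_maps ?N m"
        using w by (auto simp: simplex_maps_def mono_on_def)
      have push: "simplex_push ?N ?a w = s" "simplex_push ?N ?b w = t"
        using w(4,5) simplex_push_cong[of ?N ?a a] simplex_push_cong[of ?N ?b b] by simp_all
      have "(?a, ?b) \<in> I" using ab by (simp add: I_def)
      moreover have "w \<in> C (?a, ?b)" using mult[OF ab w(1)] st w(1) unfolding push by (simp add: C_def)
      moreover have "P (?a, ?b) w = (s, t)" unfolding P_def prod.case push ..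
      ultimately show "(s, t) \<in> ?L" by (intro UN_I[of "(?a, ?b)"] image_eqI[of _ _ w]) simp_all
    qed
  qed
  finally show ?thesis .
qed

text \<open>Multiplication is first studied on the product of the spaces of cells, where
  \<open>closedin_real_mult\<close> gives openness in the ordinary product;
  \<open>kopen_prod_quotient\<close> then brings it down to the k-ified product of the
  realizations.\<close>

theorem k_topological_group_realization:
  fixes h :: "(nat \<Rightarrow> real) \<Rightarrow> 'z"
  assumes h: "inj h" and inf: "infinite (UNIV :: 'z set)"
  shows "k_topological_group TYPE('z) R (real_top K)"
proof -
  let ?T = "real_top K" and ?A = "real_cells (underlying K)" and ?q = "real_class (underlying K)"
  interpret R: group R by (rule group_real_group)
  have inv: "continuous_map ?T ?T (\<lambda>a. inv\<^bsub>R\<^esub> a)"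
    unfolding real_top_def U.continuous_map_from_realization
  proof (intro allI ballI)
    fix n x assume "x \<in> level (underlying K) n"
    then have x: "x \<in> carrier (level K n)" by simp
    interpret Ln: abelian_group "level K n" by (rule level_group)
    show "continuous_map (simplex_top n) (realization (underlying K)) (\<lambda>t. inv\<^bsub>R\<^esub> cls n x t)"
      by (rule continuous_map_eq[OF U.continuous_map_real_class[of "\<ominus>\<^bsub>level K n\<^esub> x"]])
        (simp_all add: x inv_cls)
  qed
  have mult: "continuous_map (kify TYPE('z) (prod_topology ?T ?T)) ?T (\<lambda>(a, b). a \<otimes>\<^bsub>R\<^esub> b)"
    unfolding continuous_map
  proof (intro conjI allI impI)
    show "(\<lambda>(a, b). a \<otimes>\<^bsub>R\<^esub> b) ` topspace (kify TYPE('z) (prod_topology ?T ?T)) \<subseteq> topspace ?T"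
      by (auto simp: carrier_real_group[symmetric])
    fix Q assume Q: "openin ?T Q"
    let ?V = "{p \<in> topspace (kify TYPE('z) (prod_topology ?T ?T)). (case p of (a, b) \<Rightarrow> a \<otimes>\<^bsub>R\<^esub> b) \<in> Q}"
    let ?W = "{p \<in> topspace (prod_topology ?A ?A). (?q (fst p), ?q (snd p)) \<in> ?V}"
    have q: "quotient_map ?A ?T ?q" unfolding real_top_def by (rule U.quotient_map_real_class)
    have kA: "kspace TYPE('z) ?A" by (rule U.kspace_real_cells[OF h])
    have "openin (prod_topology ?A ?A) ?W"
    proof (rule U.openin_real_cells_square)
      show "?W \<subseteq> U.cells \<times> U.cells" by (auto simp: U.topspace_real_cells)
      fix n x m y assume "x \<in> level (underlying K) n" "y \<in> level (underlying K) m"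
      then have x: "x \<in> carrier (level K n)" and y: "y \<in> carrier (level K m)" by simp_all
      let ?S = "prod_topology (simplex_top n) (simplex_top m)"
      let ?F = "{(s, t) \<in> standard_simplex n \<times> standard_simplex m. cls n x s \<otimes>\<^bsub>R\<^esub> cls m y t \<in> topspace ?T - Q}"
      have "closedin ?S ?F"
        using Q x y by (intro closedin_real_mult) auto
      then have "openin ?S (topspace ?S - ?F)" by blast
      moreover have "topspace ?S - ?F =
        {(s, t) \<in> standard_simplex n \<times> standard_simplex m. ((n, x, s), (m, y, t)) \<in> ?W}"
        using x y cls_in R.m_closed
        by (auto simp: U.topspace_real_cells U.cells_def carrier_real_group[symmetric])
      ultimately show "openin ?S {(s, t) \<in> standard_simplex n \<times> standard_simplex m. ((n, x, s), (m, y, t)) \<in> ?W}"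
        by simp
    qed
    then have "kopen TYPE('z) (prod_topology ?A ?A) ?W" by (rule openin_imp_kopen)
    then have "kopen TYPE('z) (prod_topology ?T ?T) ?V"
      by (intro kopen_prod_quotient[OF inf kA q kA q]) auto
    then show "openin (kify TYPE('z) (prod_topology ?T ?T)) ?V"
      by (auto simp: openin_kify_iff)
  qed
  show ?thesis
    using group_real_group carrier_real_group U.kspace_realization[OF h] inv mult
    by (simp add: k_topological_group_def real_top_def)
qed

end

section \<open>The modules of functions on a pointed $G$-set\<close>

lemma linear_mapsI:
  assumes "\<And>x. x \<in> carrier V \<Longrightarrow> f x \<in> carrier W"
    and "\<And>x y. x \<in> carrier V \<Longrightarrow> y \<in> carrier V \<Longrightarrow> f (x \<oplus>\<^bsub>V\<^esub> y) = f x \<oplus>\<^bsub>W\<^esub> f y"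
    and "\<And>r x. r \<in> carrier R \<Longrightarrow> x \<in> carrier V \<Longrightarrow> f (r \<odot>\<^bsub>V\<^esub> x) = r \<odot>\<^bsub>W\<^esub> f x"
  shows "f \<in> linear_maps R V W"
  using assms by (auto simp: linear_maps_def)

lemma linear_maps_closed: "f \<in> linear_maps R V W \<Longrightarrow> x \<in> carrier V \<Longrightarrow> f x \<in> carrier W"
  and linear_maps_add: "f \<in> linear_maps R V W \<Longrightarrow> x \<in> carrier V \<Longrightarrow> y \<in> carrier V \<Longrightarrow>
    f (x \<oplus>\<^bsub>V\<^esub> y) = f x \<oplus>\<^bsub>W\<^esub> f y"
  and linear_maps_smult: "f \<in> linear_maps R V W \<Longrightarrow> r \<in> carrier R \<Longrightarrow> x \<in> carrier V \<Longrightarrow>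
    f (r \<odot>\<^bsub>V\<^esub> x) = r \<odot>\<^bsub>W\<^esub> f x"
  by (auto simp: linear_maps_def)

lemma linear_maps_zero:
  assumes f: "f \<in> linear_maps R V W" and "module R V" "module R W"
  shows "f \<zero>\<^bsub>V\<^esub> = \<zero>\<^bsub>W\<^esub>"
proof -
  interpret V: module R V by fact
  interpret W: module R W by fact
  show ?thesis
    using linear_maps_smult[OF f, of "\<zero>\<^bsub>R\<^esub>" "\<zero>\<^bsub>V\<^esub>"] linear_maps_closed[OF f, of "\<zero>\<^bsub>V\<^esub>"] by simp
qed

lemma linear_maps_comp:
  "f \<in> linear_maps R V W \<Longrightarrow> g \<in> linear_maps R W U \<Longrightarrow> (\<lambda>x. g (f x)) \<in> linear_maps R V U"
  by (simp add: linear_maps_def Pi_iff)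

lemma linear_maps_cong:
  assumes "f \<in> linear_maps R V W" "module R V" "\<And>x. x \<in> carrier V \<Longrightarrow> g x = f x"
  shows "g \<in> linear_maps R V W"
proof -
  interpret V: module R V by fact
  show ?thesis using assms(1,3) by (simp add: linear_maps_def Pi_iff)
qed

lemma linear_maps_finsum:
  assumes f: "f \<in> linear_maps R V W" and V: "module R V" and W: "module R W"
    and g: "g \<in> A \<rightarrow> carrier V"
  shows "f (\<Oplus>\<^bsub>V\<^esub>i\<in>A. g i) = (\<Oplus>\<^bsub>W\<^esub>i\<in>A. f (g i))"
proof -
  interpret V: module R V by fact
  interpret W: module R W by fact
  show ?thesis
    using g
  proof (induction A rule: infinite_finite_induct)
    case (insert a A)
    then have "f (finsum V g (insert a A)) = f (g a \<oplus>\<^bsub>V\<^esub> finsum V g A)"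
      by (subst V.M.finsum_insert) auto
    also have "\<dots> = f (g a) \<oplus>\<^bsub>W\<^esub> finsum W (\<lambda>i. f (g i)) A"
      using insert by (subst linear_maps_add[OF f]) auto
    also have "\<dots> = finsum W (\<lambda>i. f (g i)) (insert a A)"
      using insert linear_maps_closed[OF f] by (subst W.M.finsum_insert) auto
    finally show ?case .
  qed (simp_all add: linear_maps_zero[OF f V W])
qed

lemma linear_maps_finsum_pointwise:
  assumes f: "\<And>i. i \<in> A \<Longrightarrow> f i \<in> linear_maps R V W" and V: "module R V" and W: "module R W"
  shows "(\<lambda>x. \<Oplus>\<^bsub>W\<^esub>i\<in>A. f i x) \<in> linear_maps R V W"
proof -
  interpret V: module R V by fact
  interpret W: module R W by fact
  show ?thesis
    using f
  proof (induction A rule: infinite_finite_induct)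
    case (insert a A)
    have eq: "(\<Oplus>\<^bsub>W\<^esub>i\<in>insert a A. f i x) = f a x \<oplus>\<^bsub>W\<^esub> (\<Oplus>\<^bsub>W\<^esub>i\<in>A. f i x)" if "x \<in> carrier V" for x
      using insert that by (subst W.M.finsum_insert) (auto intro: linear_maps_closed)
    have A: "(\<lambda>x. \<Oplus>\<^bsub>W\<^esub>i\<in>A. f i x) \<in> linear_maps R V W" and a: "f a \<in> linear_maps R V W"
      using insert by auto
    note cl = linear_maps_closed[OF A] linear_maps_closed[OF a]
    show ?case
    proof (rule linear_mapsI)
      fix x y assume "x \<in> carrier V" "y \<in> carrier V"
      then show "(\<Oplus>\<^bsub>W\<^esub>i\<in>insert a A. f i (x \<oplus>\<^bsub>V\<^esub> y)) =
          (\<Oplus>\<^bsub>W\<^esub>i\<in>insert a A. f i x) \<oplus>\<^bsub>W\<^esub> (\<Oplus>\<^bsub>W\<^esub>i\<in>insert a A. f i y)"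
        using cl by (simp add: eq linear_maps_add[OF A] linear_maps_add[OF a] W.M.a_ac)
    next
      fix r x assume "r \<in> carrier R" "x \<in> carrier V"
      then show "(\<Oplus>\<^bsub>W\<^esub>i\<in>insert a A. f i (r \<odot>\<^bsub>V\<^esub> x)) = r \<odot>\<^bsub>W\<^esub> (\<Oplus>\<^bsub>W\<^esub>i\<in>insert a A. f i x)"
        using cl by (simp add: eq linear_maps_smult[OF A] linear_maps_smult[OF a] W.smult_r_distr)
    qed (use eq cl in simp)
  qed (auto intro!: linear_mapsI)
qed

section \<open>Morphisms of the orbit category and their effect on coefficients\<close>

locale coefficients = group G for G (structure) +
  fixes k :: "('k, 'b) ring_scheme" and M :: "('g, 'k, 'm) coefficients"
  assumes coefficient_system: "coefficient_system G k M"
begin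

lemma lcosets_obj: "subgroup H G \<Longrightarrow> lcosets H \<in> orbit_objects G"
  by (auto simp: orbit_objects_def)

lemma module_obj: "subgroup H G \<Longrightarrow> module k (obj M (lcosets H))"
  using coefficient_system lcosets_obj by (auto simp: coefficient_system_def)

text \<open>This says \<open>Hb \<subseteq> bK\<close>, the condition for
  \<open>aH \<mapsto> abK\<close> to be well defined. Projections have b = 1 and the R_{g^-1} have b
  = g^-1, so one calculus of \<open>tr\<close> covers both.\<close>

definition subconj :: "'g set \<Rightarrow> 'g set \<Rightarrow> 'g \<Rightarrow> bool" where
  "subconj H K b \<longleftrightarrow> subgroup H G \<and> subgroup K G \<and> b \<in> carrier G \<and> (\<forall>h\<in>H. inv b \<otimes> h \<otimes> b \<in> K)"

definition tr :: "'g set \<Rightarrow> 'g set \<Rightarrow> 'g \<Rightarrow> 'm \<Rightarrow> 'm" where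
  "tr H K b = mor M (lcosets H) (lcosets K) (orb_shift G H K b)"

lemma mem_lcosets: "C \<in> lcosets H \<longleftrightarrow> (\<exists>a\<in>carrier G. C = a <#\<^bsub>G\<^esub> H)"
  by (auto simp: LCOSETS_def)

lemma orb_shift_coset:
  assumes s: "subconj H K b" and a: "a \<in> carrier G"
  shows "orb_shift G H K b (a <#\<^bsub>G\<^esub> H) = (a \<otimes> b) <#\<^bsub>G\<^esub> K"
proof -
  interpret H: subgroup H G using s by (simp add: subconj_def)
  interpret K: subgroup K G using s by (simp add: subconj_def)
  have b: "b \<in> carrier G" using s by (simp add: subconj_def)
  have "(a <#\<^bsub>G\<^esub> H #> b) <#> K = (a \<otimes> b) <#\<^bsub>G\<^esub> K"
  proof (rule antisym)
    show "(a <#\<^bsub>G\<^esub> H #> b) <#> K \<subseteq> (a \<otimes> b) <#\<^bsub>G\<^esub> K"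
    proof
      fix z assume "z \<in> (a <#\<^bsub>G\<^esub> H #> b) <#> K"
      then obtain h l where z: "h \<in> H" "l \<in> K" "z = a \<otimes> h \<otimes> b \<otimes> l"
        by (auto simp: set_mult_def r_coset_def l_coset_def)
      have c: "h \<in> carrier G" "l \<in> carrier G" using z H.subset K.subset by auto
      have "b \<otimes> (inv b \<otimes> h \<otimes> b) = h \<otimes> b"
        using b c by (metis inv_closed m_assoc m_closed r_inv l_one)
      then have "z = (a \<otimes> b) \<otimes> ((inv b \<otimes> h \<otimes> b) \<otimes> l)"
        using z a b c by (metis inv_closed m_assoc m_closed)
      moreover have "(inv b \<otimes> h \<otimes> b) \<otimes> l \<in> K" using s z by (simp add: subconj_def)
      ultimately show "z \<in> (a \<otimes> b) <#\<^bsub>G\<^esub> K" by (auto simp: l_coset_def)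
    qed
    show "(a \<otimes> b) <#\<^bsub>G\<^esub> K \<subseteq> (a <#\<^bsub>G\<^esub> H #> b) <#> K"
    proof
      fix z assume "z \<in> (a \<otimes> b) <#\<^bsub>G\<^esub> K"
      then obtain l where "l \<in> K" "z = (a \<otimes> \<one>) \<otimes> b \<otimes> l" using a by (auto simp: l_coset_def)
      then show "z \<in> (a <#\<^bsub>G\<^esub> H #> b) <#> K"
        using H.one_closed unfolding set_mult_def r_coset_def l_coset_def by blast
    qed
  qed
  then show ?thesis using a by (auto simp: orb_shift_def mem_lcosets)
qed

lemma orb_shift_morphism:
  assumes s: "subconj H K b"
  shows "orb_shift G H K b \<in> orbit_morphisms G (lcosets H) (lcosets K)"
proof -
  interpret H: subgroup H G using s by (simp add: subconj_def)
  interpret K: subgroup K G using s by (simp add: subconj_def)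
  have b: "b \<in> carrier G" using s by (simp add: subconj_def)
  have "orb_shift G H K b \<in> lcosets H \<rightarrow>\<^sub>E lcosets K"
    using orb_shift_coset[OF s] b by (auto simp: mem_lcosets) (auto simp: orb_shift_def mem_lcosets)
  moreover have "orb_shift G H K b (g <#\<^bsub>G\<^esub> (a <#\<^bsub>G\<^esub> H)) = g <#\<^bsub>G\<^esub> orb_shift G H K b (a <#\<^bsub>G\<^esub> H)"
    if "g \<in> carrier G" "a \<in> carrier G" for g a
    using that b H.subset K.subset by (simp add: lcos_m_assoc orb_shift_coset[OF s] m_assoc)
  ultimately show ?thesis by (auto simp: orbit_morphisms_def mem_lcosets)
qed

lemma tr_linear: "subconj H K b \<Longrightarrow> tr H K b \<in> linear_maps k (obj M (lcosets H)) (obj M (lcosets K))"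
  using coefficient_system orb_shift_morphism lcosets_obj
  unfolding coefficient_system_def tr_def subconj_def by metis

lemma subconj_comp:
  assumes "subconj H K b" "subconj K L c"
  shows "subconj H L (b \<otimes> c)"
proof -
  have "inv (b \<otimes> c) \<otimes> h \<otimes> (b \<otimes> c) = inv c \<otimes> (inv b \<otimes> h \<otimes> b) \<otimes> c" if "h \<in> H" for h
  proof -
    have "h \<in> carrier G" "b \<in> carrier G" "c \<in> carrier G"
      using assms that by (auto simp: subconj_def dest: subgroup.mem_carrier)
    then show ?thesis by (simp add: inv_mult_group m_assoc)
  qed
  then show ?thesis using assms by (simp add: subconj_def)
qed

lemma tr_comp:
  assumes s: "subconj H K b" "subconj K L c" and l: "l \<in> carrier (obj M (lcosets H))"
  shows "tr K L c (tr H K b l) = tr H L (b \<otimes> c) l"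
proof -
  have bc: "b \<in> carrier G" "c \<in> carrier G" using s by (auto simp: subconj_def)
  have "compose (lcosets H) (orb_shift G K L c) (orb_shift G H K b) = orb_shift G H L (b \<otimes> c)"
  proof
    fix C
    show "compose (lcosets H) (orb_shift G K L c) (orb_shift G H K b) C = orb_shift G H L (b \<otimes> c) C"
    proof (cases "C \<in> lcosets H")
      case True
      then obtain a where "a \<in> carrier G" "C = a <#\<^bsub>G\<^esub> H" by (auto simp: mem_lcosets)
      then show ?thesis
        using True bc by (simp add: compose_def orb_shift_coset[OF s(1)] orb_shift_coset[OF s(2)]
            orb_shift_coset[OF subconj_comp[OF s]] m_assoc)
    qed (simp add: compose_def orb_shift_def)
  qed
  moreover have "mor M (lcosets H) (lcosets L) (compose (lcosets H) (orb_shift G K L c) (orb_shift G H K b)) l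
      = tr K L c (tr H K b l)"
    using coefficient_system orb_shift_morphism[OF s(1)] orb_shift_morphism[OF s(2)] lcosets_obj s l
    unfolding coefficient_system_def tr_def subconj_def by blast
  ultimately show ?thesis by (simp add: tr_def)
qed

text \<open>The last hypothesis means \<open>bK = b'K\<close>, and the shift depends on
  \<open>b\<close> only through this coset.\<close>

lemma tr_cong:
  assumes s: "subconj H K b" "subconj H K b'" and c: "inv b \<otimes> b' \<in> K"
  shows "tr H K b = tr H K b'"
proof -
  have K: "subgroup K G" and b: "b \<in> carrier G" "b' \<in> carrier G" using s by (auto simp: subconj_def)
  have "orb_shift G H K b C = orb_shift G H K b' C" for C
  proof (cases "C \<in> lcosets H")
    case True
    then obtain a where a: "a \<in> carrier G" "C = a <#\<^bsub>G\<^esub> H" by (auto simp: mem_lcosets)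
    have "(inv b \<otimes> b') <#\<^bsub>G\<^esub> K = K"
      using c K by (simp add: coset_join3 subgroup.mem_carrier)
    then have "(a \<otimes> b \<otimes> (inv b \<otimes> b')) <#\<^bsub>G\<^esub> K = (a \<otimes> b) <#\<^bsub>G\<^esub> K"
      using a b K by (metis inv_closed lcos_m_assoc m_closed subgroup.subset)
    moreover have "a \<otimes> b \<otimes> (inv b \<otimes> b') = a \<otimes> b'"
      using a b by (metis inv_closed m_assoc m_closed r_inv l_one)
    ultimately show ?thesis using a by (simp add: orb_shift_coset[OF s(1)] orb_shift_coset[OF s(2)])
  qed (simp add: orb_shift_def)
  then have "orb_shift G H K b = orb_shift G H K b'" by auto
  then show ?thesis by (simp add: tr_def)
qed

text \<open>As bH = H, the shift is the identity morphism. Consequently G_x fixes every lx, which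
  makes the summands of \<open>gamma\<close> depend on cosets only.\<close>

lemma tr_id:
  assumes H: "subgroup H G" and b: "b \<in> H" and l: "l \<in> carrier (obj M (lcosets H))"
  shows "tr H H b l = l"
proof -
  interpret H: subgroup H G by fact
  have s: "subconj H H \<one>" "subconj H H b" using H b by (auto simp: subconj_def)
  have "tr H H b = tr H H \<one>" using s b by (intro tr_cong[symmetric]) auto
  moreover have "orb_shift G H H \<one> = (\<lambda>C\<in>lcosets H. C)"
  proof
    fix C show "orb_shift G H H \<one> C = (\<lambda>C\<in>lcosets H. C) C"
    proof (cases "C \<in> lcosets H")
      case True
      then show ?thesis using orb_shift_coset[OF s(1)] by (auto simp: mem_lcosets)
    qed (simp add: orb_shift_def)
  qed
  ultimately show ?thesis
    using coefficient_system l lcosets_obj[OF H] by (simp add: coefficient_system_def tr_def)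
qed

section \<open>Pointed G-sets and the module F(S,M)\<close>

definition gset :: "('g, 'x) pointed_gset \<Rightarrow> bool" where
  "gset S \<longleftrightarrow> (\<forall>g\<in>carrier G. \<forall>x\<in>pts S. gact S g x \<in> pts S) \<and> (\<forall>x\<in>pts S. gact S \<one> x = x) \<and>
     (\<forall>g\<in>carrier G. \<forall>h\<in>carrier G. \<forall>x\<in>pts S. gact S (g \<otimes> h) x = gact S g (gact S h x)) \<and>
     base S \<in> pts S \<and> (\<forall>g\<in>carrier G. gact S g (base S) = base S)"

abbreviation st :: "('g, 'x) pointed_gset \<Rightarrow> 'x \<Rightarrow> 'g set" where "st \<equiv> isotropy G"
abbreviation cf :: "('g, 'x) pointed_gset \<Rightarrow> 'x \<Rightarrow> ('k, 'm) module" where "cf \<equiv> coef G M"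
abbreviation FM :: "('g, 'x) pointed_gset \<Rightarrow> ('k, 'x \<Rightarrow> 'm) module" where "FM \<equiv> Fmod G M"
abbreviation FX :: "('g, 'x) pointed_gset \<Rightarrow> ('k, 'x \<Rightarrow> 'm) module" where "FX \<equiv> Ffix G M"

lemma gset_act: "gset S \<Longrightarrow> g \<in> carrier G \<Longrightarrow> x \<in> pts S \<Longrightarrow> gact S g x \<in> pts S"
  and gset_one: "gset S \<Longrightarrow> x \<in> pts S \<Longrightarrow> gact S \<one> x = x"
  and gset_mult: "gset S \<Longrightarrow> g \<in> carrier G \<Longrightarrow> h \<in> carrier G \<Longrightarrow> x \<in> pts S \<Longrightarrow>
    gact S (g \<otimes> h) x = gact S g (gact S h x)"
  and gset_base: "gset S \<Longrightarrow> base S \<in> pts S"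
  and gset_base_fixed: "gset S \<Longrightarrow> g \<in> carrier G \<Longrightarrow> gact S g (base S) = base S"
  by (simp_all add: gset_def)

lemma gact_inverse:
  assumes "gset S" "g \<in> carrier G" "x \<in> pts S"
  shows "gact S (inv g) (gact S g x) = x" "gact S g (gact S (inv g) x) = x"
  using gset_mult[of S "inv g" g x] gset_mult[of S g "inv g" x] assms by (simp_all add: gset_one)

lemma subgroup_isotropy:
  assumes S: "gset S" and x: "x \<in> pts S"
  shows "subgroup (st S x) G"
proof (rule subgroupI)
  fix a assume a: "a \<in> st S x"
  then have "a \<in> carrier G" "gact S a x = x" by (simp_all add: stabilizer_def)
  then show "inv a \<in> st S x" using gact_inverse(1)[OF S _ x, of a] by (simp add: stabilizer_def)
next
  have "\<one> \<in> st S x" using gset_one[OF S x] by (simp add: stabilizer_def)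
  then show "st S x \<noteq> {}" by blast
next
  fix a b assume "a \<in> st S x" "b \<in> st S x"
  then show "a \<otimes> b \<in> st S x" using gset_mult[OF S _ _ x] by (simp add: stabilizer_def)
qed (simp add: stabilizer_def subset_iff)

lemma module_cf: "gset S \<Longrightarrow> x \<in> pts S \<Longrightarrow> module k (cf S x)"
  by (intro module_obj subgroup_isotropy)

lemma FM_simps [simp]:
  "\<zero>\<^bsub>FM S\<^esub> = (\<lambda>x\<in>pts S. \<zero>\<^bsub>cf S x\<^esub>)"
  "u \<oplus>\<^bsub>FM S\<^esub> v = (\<lambda>x\<in>pts S. u x \<oplus>\<^bsub>cf S x\<^esub> v x)"
  "r \<odot>\<^bsub>FM S\<^esub> u = (\<lambda>x\<in>pts S. r \<odot>\<^bsub>cf S x\<^esub> u x)"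
  by (simp_all add: Fmod_def)

lemma FM_carrier: "u \<in> carrier (FM S) \<longleftrightarrow> u \<in> extensional (pts S) \<and> (\<forall>x\<in>pts S. u x \<in> carrier (cf S x)) \<and>
   u (base S) = \<zero>\<^bsub>cf S (base S)\<^esub> \<and> finite {x \<in> pts S. u x \<noteq> \<zero>\<^bsub>cf S x\<^esub>}"
  by (auto simp: Fmod_def supp_def PiE_def)

lemma FM_value: "u \<in> carrier (FM S) \<Longrightarrow> x \<in> pts S \<Longrightarrow> u x \<in> carrier (cf S x)"
  by (simp add: FM_carrier)

lemma FM_eqI:
  assumes "u \<in> carrier (FM S)" "v \<in> carrier (FM S)" "\<And>x. x \<in> pts S \<Longrightarrow> u x = v x"
  shows "u = v"
  using assms by (auto simp: FM_carrier intro: extensionalityI)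

lemma pointwise_in_FM:
  assumes "\<And>x. x \<in> pts S \<Longrightarrow> w x \<in> carrier (cf S x)" and "finite F"
    and "\<And>x. x \<in> pts S \<Longrightarrow> x \<notin> F \<Longrightarrow> w x = \<zero>\<^bsub>cf S x\<^esub>" and "w (base S) = \<zero>\<^bsub>cf S (base S)\<^esub>" "base S \<in> pts S"
  shows "(\<lambda>x\<in>pts S. w x) \<in> carrier (FM S)"
proof -
  have "{x \<in> pts S. restrict w (pts S) x \<noteq> \<zero>\<^bsub>cf S x\<^esub>} \<subseteq> F" using assms by auto
  then show ?thesis using assms by (auto simp: FM_carrier intro: finite_subset)
qed

lemma module_FM:
  assumes S: "gset S"
  shows "module k (FM S)"
proof -
  have b: "base S \<in> pts S" using S by (simp add: gset_def)
  note mod = module_cf[OF S]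
  note ag = module.axioms(2)[OF mod]
  have fin: "finite {x \<in> pts S. u x \<noteq> \<zero>\<^bsub>cf S x\<^esub>}" if "u \<in> carrier (FM S)" for u
    using that by (simp add: FM_carrier)
  have addc: "u \<oplus>\<^bsub>FM S\<^esub> v \<in> carrier (FM S)" if uv: "u \<in> carrier (FM S)" "v \<in> carrier (FM S)" for u v
    unfolding FM_simps
  proof (rule pointwise_in_FM[OF _ finite_UnI[OF fin[OF uv(1)] fin[OF uv(2)]] _ _ b])
    fix x assume x: "x \<in> pts S"
    interpret X: abelian_group "cf S x" by (rule ag[OF x])
    show "u x \<oplus>\<^bsub>cf S x\<^esub> v x \<in> carrier (cf S x)" using uv x by (simp add: FM_carrier)
    show "u x \<oplus>\<^bsub>cf S x\<^esub> v x = \<zero>\<^bsub>cf S x\<^esub>"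
      if "x \<notin> {x \<in> pts S. u x \<noteq> \<zero>\<^bsub>cf S x\<^esub>} \<union> {x \<in> pts S. v x \<noteq> \<zero>\<^bsub>cf S x\<^esub>}"
      using that x by simp
  next
    interpret X: abelian_group "cf S (base S)" by (rule ag[OF b])
    show "u (base S) \<oplus>\<^bsub>cf S (base S)\<^esub> v (base S) = \<zero>\<^bsub>cf S (base S)\<^esub>"
      using uv by (simp add: FM_carrier)
  qed
  have smc: "r \<odot>\<^bsub>FM S\<^esub> u \<in> carrier (FM S)" if r: "r \<in> carrier k" and u: "u \<in> carrier (FM S)" for r u
    unfolding FM_simps
  proof (rule pointwise_in_FM[OF _ fin[OF u] _ _ b])
    fix x assume x: "x \<in> pts S"
    interpret X: module k "cf S x" by (rule mod[OF x])
    show "r \<odot>\<^bsub>cf S x\<^esub> u x \<in> carrier (cf S x)" using r u x by (simp add: FM_carrier)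
    show "r \<odot>\<^bsub>cf S x\<^esub> u x = \<zero>\<^bsub>cf S x\<^esub>" if "x \<notin> {x \<in> pts S. u x \<noteq> \<zero>\<^bsub>cf S x\<^esub>}"
      using that x r by simp
  next
    interpret X: module k "cf S (base S)" by (rule mod[OF b])
    show "r \<odot>\<^bsub>cf S (base S)\<^esub> u (base S) = \<zero>\<^bsub>cf S (base S)\<^esub>"
      using u r by (simp add: FM_carrier)
  qed
  have zc: "\<zero>\<^bsub>FM S\<^esub> \<in> carrier (FM S)"
    unfolding FM_simps by (rule pointwise_in_FM[OF _ finite.emptyI _ _ b]) (simp_all add: abelian_groupE(2)[OF ag])
  interpret cring k using mod[OF b] by (simp add: module_def)
  note v = FM_value
  show ?thesis
  proof (rule moduleI[OF cring_axioms abelian_groupI])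
    fix u v w assume u: "u \<in> carrier (FM S)" and v: "v \<in> carrier (FM S)" and w: "w \<in> carrier (FM S)"
    show "u \<oplus>\<^bsub>FM S\<^esub> v \<oplus>\<^bsub>FM S\<^esub> w = u \<oplus>\<^bsub>FM S\<^esub> (v \<oplus>\<^bsub>FM S\<^esub> w)"
      using u v w by (auto simp: FM_value abelian_groupE(3)[OF ag] intro!: restrict_ext)
  next
    fix u v assume u: "u \<in> carrier (FM S)" and v: "v \<in> carrier (FM S)"
    show "u \<oplus>\<^bsub>FM S\<^esub> v = v \<oplus>\<^bsub>FM S\<^esub> u"
      using u v by (auto simp: FM_value abelian_groupE(4)[OF ag] intro!: restrict_ext)
    show "r \<odot>\<^bsub>FM S\<^esub> (u \<oplus>\<^bsub>FM S\<^esub> v) = r \<odot>\<^bsub>FM S\<^esub> u \<oplus>\<^bsub>FM S\<^esub> r \<odot>\<^bsub>FM S\<^esub> v" if "r \<in> carrier k" for r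
      using u v that by (auto simp: FM_value module.smult_r_distr[OF mod] intro!: restrict_ext)
  next
    fix u assume u: "u \<in> carrier (FM S)"
    show "\<zero>\<^bsub>FM S\<^esub> \<oplus>\<^bsub>FM S\<^esub> u = u"
      using u addc[OF zc u] by (auto intro!: FM_eqI[of _ S] simp: FM_value abelian_groupE(5)[OF ag])
    \<comment> \<open>The negative is taken to be (-1)u, so that its finite support comes from
      closure under scaling.\<close>
    show "\<exists>v\<in>carrier (FM S). v \<oplus>\<^bsub>FM S\<^esub> u = \<zero>\<^bsub>FM S\<^esub>"
    proof (intro bexI[of _ "(\<ominus>\<^bsub>k\<^esub> \<one>\<^bsub>k\<^esub>) \<odot>\<^bsub>FM S\<^esub> u"] smc u)
      have "(\<ominus>\<^bsub>k\<^esub> \<one>\<^bsub>k\<^esub>) \<odot>\<^bsub>cf S x\<^esub> u x \<oplus>\<^bsub>cf S x\<^esub> u x = \<zero>\<^bsub>cf S x\<^esub>" if x: "x \<in> pts S" for x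
      proof -
        interpret X: module k "cf S x" by (rule mod[OF x])
        show ?thesis using FM_value[OF u x] by (simp add: X.smult_l_minus X.M.l_neg)
      qed
      then show "(\<ominus>\<^bsub>k\<^esub> \<one>\<^bsub>k\<^esub>) \<odot>\<^bsub>FM S\<^esub> u \<oplus>\<^bsub>FM S\<^esub> u = \<zero>\<^bsub>FM S\<^esub>"
        by (auto intro!: restrict_ext)
    qed simp
    show "\<one>\<^bsub>k\<^esub> \<odot>\<^bsub>FM S\<^esub> u = u"
      using u smc[OF one_closed u] by (auto intro!: FM_eqI[of _ S] simp: FM_value module.smult_one[OF mod])
    show "(r \<oplus>\<^bsub>k\<^esub> s) \<odot>\<^bsub>FM S\<^esub> u = r \<odot>\<^bsub>FM S\<^esub> u \<oplus>\<^bsub>FM S\<^esub> s \<odot>\<^bsub>FM S\<^esub> u" if "r \<in> carrier k" "s \<in> carrier k" for r s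
      using u that by (auto simp: FM_value module.smult_l_distr[OF mod] intro!: restrict_ext)
    show "(r \<otimes>\<^bsub>k\<^esub> s) \<odot>\<^bsub>FM S\<^esub> u = r \<odot>\<^bsub>FM S\<^esub> (s \<odot>\<^bsub>FM S\<^esub> u)" if "r \<in> carrier k" "s \<in> carrier k" for r s
      using u that by (auto simp: FM_value module.smult_assoc1[OF mod] intro!: restrict_ext)
  qed (rule addc smc zc; assumption)+
qed

end

context coefficients
begin

lemma cf_zero: "gset S \<Longrightarrow> x \<in> pts S \<Longrightarrow> \<zero>\<^bsub>cf S x\<^esub> \<in> carrier (cf S x)"
  by (rule abelian_groupE(2)[OF module.axioms(2)[OF module_cf]])

lemma gen_in:
  assumes S: "gset S" and x: "x \<in> pts S" and l: "l \<in> carrier (cf S x)"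
  shows "gen G M S l x \<in> carrier (FM S)"
  unfolding gen_def
  by (rule pointwise_in_FM[of _ _ "{x}"]) (use S l in \<open>auto simp: cf_zero gset_base\<close>)

lemma gen_base: "gen G M S l (base S) = \<zero>\<^bsub>FM S\<^esub>"
  by (auto simp: gen_def)

lemma gen_linear:
  assumes S: "gset S" and x: "x \<in> pts S"
  shows "(\<lambda>l. gen G M S l x) \<in> linear_maps k (cf S x) (FM S)"
proof (rule linear_mapsI)
  note mod = module_cf[OF S]
  note ag = module.axioms(2)[OF mod]
  show "gen G M S (l \<oplus>\<^bsub>cf S x\<^esub> m) x = gen G M S l x \<oplus>\<^bsub>FM S\<^esub> gen G M S m x" for l m
    by (auto simp: gen_def abelian_groupE(5)[OF ag] cf_zero[OF S] intro!: restrict_ext)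
  show "gen G M S (r \<odot>\<^bsub>cf S x\<^esub> l) x = r \<odot>\<^bsub>FM S\<^esub> gen G M S l x" if "r \<in> carrier k" for r l
    using that by (auto simp: gen_def module.smult_r_null[OF mod] intro!: restrict_ext)
qed (rule gen_in[OF S x])

lemma supp_finite: "u \<in> carrier (FM S) \<Longrightarrow> finite (supp G M S u)"
  by (simp add: FM_carrier supp_def)

text \<open>The lx span: by induction over a finite set containing the support, the summand u(a)a is
  split off. Identities between linear maps are checked on generators through this lemma.\<close>

lemma FM_linear_eq:
  assumes S: "gset S" and N: "module k N"
    and f: "f \<in> linear_maps k (FM S) N" and g: "g \<in> linear_maps k (FM S) N"
    and eq: "\<And>l x. x \<in> pts S \<Longrightarrow> l \<in> carrier (cf S x) \<Longrightarrow> f (gen G M S l x) = g (gen G M S l x)"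
    and u: "u \<in> carrier (FM S)"
  shows "f u = g u"
proof -
  note ag = module.axioms(2)[OF module_cf[OF S]]
  have "f u = g u" if "finite F" "u \<in> carrier (FM S)" "supp G M S u \<subseteq> F" for F u
    using that
  proof (induction F arbitrary: u rule: finite_induct)
    case empty
    then have "u = \<zero>\<^bsub>FM S\<^esub>"
      by (auto simp: supp_def FM_carrier intro: extensionalityI[of _ "pts S"])
    then show ?case using linear_maps_zero[OF f module_FM[OF S] N] linear_maps_zero[OF g module_FM[OF S] N] by metis
  next
    case (insert a F)
    show ?case
    proof (cases "a \<in> pts S")
      case False
      then have "supp G M S u \<subseteq> F" using insert by (auto simp: supp_def)
      then show ?thesis using insert by blast
    next
      case a: True
      define v where "v = (\<lambda>x\<in>pts S. if x = a then \<zero>\<^bsub>cf S x\<^esub> else u x)"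
      have v: "v \<in> carrier (FM S)"
        unfolding v_def using insert.prems(1)
        by (intro pointwise_in_FM[OF _ supp_finite[OF insert.prems(1)]])
          (auto simp: supp_def FM_carrier cf_zero[OF S] gset_base[OF S])
      have sv: "supp G M S v \<subseteq> F"
        using insert.prems(2) by (auto simp: supp_def v_def)
      have ua: "u a \<in> carrier (cf S a)" using insert.prems a by (simp add: FM_value)
      have uz: "u (base S) = \<zero>\<^bsub>cf S (base S)\<^esub>" using insert.prems by (simp add: FM_carrier)
      have "u x = (v \<oplus>\<^bsub>FM S\<^esub> gen G M S (u a) a) x" if x: "x \<in> pts S" for x
      proof -
        interpret X: abelian_group "cf S x" by (rule ag[OF x])
        show ?thesis using x uz FM_value[OF insert.prems(1) x] by (auto simp: v_def gen_def abelian_groupE(5)[OF ag] cf_zero[OF S])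
      qed
      then have "u = v \<oplus>\<^bsub>FM S\<^esub> gen G M S (u a) a"
        using insert.prems(1) by (intro extensionalityI[of _ "pts S"]) (auto simp: FM_carrier)
      moreover have "f (v \<oplus>\<^bsub>FM S\<^esub> gen G M S (u a) a) = g (v \<oplus>\<^bsub>FM S\<^esub> gen G M S (u a) a)"
        using linear_maps_add[OF f v gen_in[OF S a ua]] linear_maps_add[OF g v gen_in[OF S a ua]]
          insert.IH[OF v sv] eq[OF a ua] by metis
      ultimately show ?thesis by metis
    qed
  qed
  then show ?thesis using u supp_finite by blast
qed

section \<open>Linear extension from the generators lx\<close>

context
  fixes S :: "('g, 'x) pointed_gset" and N :: "('k, 'n) module" and t :: "'m \<Rightarrow> 'x \<Rightarrow> 'n"
  assumes S: "gset S" and N: "module k N"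
    and t: "\<And>x. x \<in> pts S \<Longrightarrow> (\<lambda>l. t l x) \<in> linear_maps k (cf S x) N"
    and t_base: "\<And>l. t l (base S) = \<zero>\<^bsub>N\<^esub>"
begin

text \<open>The supports of u, v and their sum differ; additivity needs the three sums over one
  common index set.\<close>

lemma lin_ext_superset:
  assumes u: "u \<in> carrier (FM S)" and W: "finite W" "supp G M S u \<subseteq> W" "W \<subseteq> pts S"
  shows "lin_ext G M S N t u = (\<Oplus>\<^bsub>N\<^esub>x\<in>W. t (u x) x)"
proof -
  interpret N: module k N by (rule N)
  have "finsum N (\<lambda>x. t (u x) x) (supp G M S u) = finsum N (\<lambda>x. t (u x) x) W"
  proof (rule N.M.add.finprod_mono_neutral_cong_left[OF W(1,2)])
    show "t (u x) x = \<zero>\<^bsub>N\<^esub>" if "x \<in> W - supp G M S u" for x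
    proof -
      have "x \<in> pts S" "u x = \<zero>\<^bsub>cf S x\<^esub>" using that W by (auto simp: supp_def)
      then show ?thesis using linear_maps_zero[OF t module_cf[OF S] N] by simp
    qed
    show "(\<lambda>x. t (u x) x) \<in> W \<rightarrow> carrier N"
      using W by (intro funcsetI linear_maps_closed[OF t] FM_value[OF u]) auto
  qed simp
  then show ?thesis using u by (simp add: lin_ext_def)
qed

lemma lin_ext_linear: "lin_ext G M S N t \<in> linear_maps k (FM S) N"
proof (rule linear_mapsI)
  interpret N: module k N by (rule N)
  interpret F: module k "FM S" by (rule module_FM[OF S])
  have cl: "(\<lambda>x. t (u x) x) \<in> W \<rightarrow> carrier N" if "u \<in> carrier (FM S)" "W \<subseteq> pts S" for u W
    using that by (intro funcsetI linear_maps_closed[OF t] FM_value) auto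
  have sub: "supp G M S u \<subseteq> pts S" for u by (auto simp: supp_def)
  show "lin_ext G M S N t u \<in> carrier N" if u: "u \<in> carrier (FM S)" for u
    using lin_ext_superset[OF u supp_finite[OF u] order_refl sub] cl[OF u sub] by simp
  show "lin_ext G M S N t (u \<oplus>\<^bsub>FM S\<^esub> v) = lin_ext G M S N t u \<oplus>\<^bsub>N\<^esub> lin_ext G M S N t v"
    if u: "u \<in> carrier (FM S)" and v: "v \<in> carrier (FM S)" for u v
  proof -
    let ?W = "supp G M S u \<union> supp G M S v \<union> supp G M S (u \<oplus>\<^bsub>FM S\<^esub> v)"
    have uv: "u \<oplus>\<^bsub>FM S\<^esub> v \<in> carrier (FM S)" using u v F.M.a_closed by blast
    have W: "finite ?W" "?W \<subseteq> pts S" using supp_finite u v uv sub by auto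
    have "lin_ext G M S N t (u \<oplus>\<^bsub>FM S\<^esub> v) = (\<Oplus>\<^bsub>N\<^esub>x\<in>?W. t ((u \<oplus>\<^bsub>FM S\<^esub> v) x) x)"
      by (rule lin_ext_superset[OF uv W(1) _ W(2)]) blast
    also have "\<dots> = (\<Oplus>\<^bsub>N\<^esub>x\<in>?W. t (u x) x \<oplus>\<^bsub>N\<^esub> t (v x) x)"
    proof (rule N.M.finsum_cong')
      show "t ((u \<oplus>\<^bsub>FM S\<^esub> v) x) x = t (u x) x \<oplus>\<^bsub>N\<^esub> t (v x) x" if "x \<in> ?W" for x
        using that W(2) linear_maps_add[OF t, of x "u x" "v x"] FM_value[OF u] FM_value[OF v] by auto
      show "(\<lambda>x. t (u x) x \<oplus>\<^bsub>N\<^esub> t (v x) x) \<in> ?W \<rightarrow> carrier N"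
        using cl[OF u W(2)] cl[OF v W(2)] by auto
    qed simp
    also have "\<dots> = lin_ext G M S N t u \<oplus>\<^bsub>N\<^esub> lin_ext G M S N t v"
    proof -
      have "supp G M S u \<subseteq> ?W" "supp G M S v \<subseteq> ?W" by blast+
      then show ?thesis
        using N.M.finsum_addf[OF cl[OF u W(2)] cl[OF v W(2)]]
          lin_ext_superset[OF u W(1) _ W(2)] lin_ext_superset[OF v W(1) _ W(2)] by simp
    qed
    finally show ?thesis .
  qed
  show "lin_ext G M S N t (r \<odot>\<^bsub>FM S\<^esub> u) = r \<odot>\<^bsub>N\<^esub> lin_ext G M S N t u"
    if r: "r \<in> carrier k" and u: "u \<in> carrier (FM S)" for r u
  proof -
    let ?W = "supp G M S u \<union> supp G M S (r \<odot>\<^bsub>FM S\<^esub> u)"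
    have ru: "r \<odot>\<^bsub>FM S\<^esub> u \<in> carrier (FM S)" using r u F.smult_closed by blast
    have W: "finite ?W" "?W \<subseteq> pts S" using supp_finite u ru sub by auto
    have "lin_ext G M S N t (r \<odot>\<^bsub>FM S\<^esub> u) = (\<Oplus>\<^bsub>N\<^esub>x\<in>?W. t ((r \<odot>\<^bsub>FM S\<^esub> u) x) x)"
      by (rule lin_ext_superset[OF ru W(1) _ W(2)]) blast
    also have "\<dots> = (\<Oplus>\<^bsub>N\<^esub>x\<in>?W. r \<odot>\<^bsub>N\<^esub> t (u x) x)"
    proof (rule N.M.finsum_cong')
      show "t ((r \<odot>\<^bsub>FM S\<^esub> u) x) x = r \<odot>\<^bsub>N\<^esub> t (u x) x" if "x \<in> ?W" for x
        using that W(2) linear_maps_smult[OF t r, of x "u x"] FM_value[OF u] by auto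
      show "(\<lambda>x. r \<odot>\<^bsub>N\<^esub> t (u x) x) \<in> ?W \<rightarrow> carrier N"
        using cl[OF u W(2)] r by auto
    qed simp
    also have "\<dots> = r \<odot>\<^bsub>N\<^esub> lin_ext G M S N t u"
      using N.finsum_smult_ldistr[OF W(1) r cl[OF u W(2)]] lin_ext_superset[OF u W(1) _ W(2)] by simp
    finally show ?thesis .
  qed
qed

text \<open>At the base point lx is zero whatever l is, and \<open>t_base\<close> is the matching
  condition on \<open>t\<close>.\<close>

lemma lin_ext_gen:
  assumes x: "x \<in> pts S" and l: "l \<in> carrier (cf S x)"
  shows "lin_ext G M S N t (gen G M S l x) = t l x"
proof -
  interpret N: module k N by (rule N)
  have "supp G M S (gen G M S l x) \<subseteq> {x}" by (auto simp: supp_def gen_def)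
  then have "lin_ext G M S N t (gen G M S l x) = (\<Oplus>\<^bsub>N\<^esub>y\<in>{x}. t (gen G M S l x y) y)"
    using x by (intro lin_ext_superset gen_in[OF S x l]) auto
  also have "\<dots> = t (gen G M S l x x) x"
    using linear_maps_closed[OF t[OF x] FM_value[OF gen_in[OF S x l] x]] by simp
  also have "\<dots> = t l x"
    using x by (cases "x = base S") (auto simp: gen_def t_base)
  finally show ?thesis .
qed

end

section \<open>Induced maps and the action of G, treated as one construction\<close>

definition twisted :: "('g, 'x) pointed_gset \<Rightarrow> ('g, 'y) pointed_gset \<Rightarrow> ('x \<Rightarrow> 'y) \<Rightarrow> 'g \<Rightarrow> bool" where
  "twisted S T \<phi> b \<longleftrightarrow> gset S \<and> gset T \<and> \<phi> (base S) = base T \<and>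
     (\<forall>x\<in>pts S. \<phi> x \<in> pts T \<and> subconj (st S x) (st T (\<phi> x)) b)"

text \<open>Both \<open>f\<^sub>*\<close> and the action of \<open>g\<close> have this form, with \<open>b\<close> being \<open>\<one>\<close> and \<open>inv g\<close>.\<close>

definition push :: "('g, 'x) pointed_gset \<Rightarrow> ('g, 'y) pointed_gset \<Rightarrow> ('x \<Rightarrow> 'y) \<Rightarrow> 'g
    \<Rightarrow> ('x \<Rightarrow> 'm) \<Rightarrow> ('y \<Rightarrow> 'm)" where
  "push S T \<phi> b = lin_ext G M S (FM T) (\<lambda>l x. gen G M T (tr (st S x) (st T (\<phi> x)) b l) (\<phi> x))"

lemma push_conditions:
  assumes "twisted S T \<phi> b"
  shows "gset S" "module k (FM T)"
    "\<And>x. x \<in> pts S \<Longrightarrow> (\<lambda>l. gen G M T (tr (st S x) (st T (\<phi> x)) b l) (\<phi> x)) \<in> linear_maps k (cf S x) (FM T)"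
    "\<And>l. gen G M T (tr (st S (base S)) (st T (\<phi> (base S))) b l) (\<phi> (base S)) = \<zero>\<^bsub>FM T\<^esub>"
proof -
  show "gset S" "module k (FM T)" using assms module_FM by (auto simp: twisted_def)
  show "(\<lambda>l. gen G M T (tr (st S x) (st T (\<phi> x)) b l) (\<phi> x)) \<in> linear_maps k (cf S x) (FM T)"
    if "x \<in> pts S" for x
    using assms that by (intro linear_maps_comp[OF tr_linear gen_linear]) (auto simp: twisted_def)
  show "gen G M T (tr (st S (base S)) (st T (\<phi> (base S))) b l) (\<phi> (base S)) = \<zero>\<^bsub>FM T\<^esub>" for l
    using assms gen_base[of T] by (simp add: twisted_def)
qed

lemma push_linear:
  assumes "twisted S T \<phi> b"
  shows "push S T \<phi> b \<in> linear_maps k (FM S) (FM T)"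
  unfolding push_def by (rule lin_ext_linear) (rule push_conditions[OF assms]; assumption?)+

lemma push_gen:
  assumes "twisted S T \<phi> b" "x \<in> pts S" "l \<in> carrier (cf S x)"
  shows "push S T \<phi> b (gen G M S l x) = gen G M T (tr (st S x) (st T (\<phi> x)) b l) (\<phi> x)"
  unfolding push_def by (rule lin_ext_gen[OF push_conditions[OF assms(1)] assms(2,3)])

text \<open>Twists multiply under composition. With the twists 1 and g^-1 this yields functoriality,
  the action law and the equivariance of induced maps.\<close>

lemma push_comp:
  assumes t: "twisted S T \<phi> b" "twisted T U \<psi> c" and u: "u \<in> carrier (FM S)"
    and \<omega>: "\<And>x. x \<in> pts S \<Longrightarrow> \<omega> x = \<psi> (\<phi> x)"
  shows "push T U \<psi> c (push S T \<phi> b u) = push S U \<omega> (b \<otimes> c) u"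
proof (rule FM_linear_eq[OF _ _ _ _ _ u])
  have S: "gset S" using t by (simp add: twisted_def)
  have tc: "twisted S U \<omega> (b \<otimes> c)"
    using t \<omega> gset_base[OF S] subconj_comp by (auto simp: twisted_def)
  show "gset S" "module k (FM U)" using t module_FM by (auto simp: twisted_def)
  show "(\<lambda>u. push T U \<psi> c (push S T \<phi> b u)) \<in> linear_maps k (FM S) (FM U)"
    using t by (intro linear_maps_comp[OF push_linear push_linear])
  show "push S U \<omega> (b \<otimes> c) \<in> linear_maps k (FM S) (FM U)" by (rule push_linear[OF tc])
  fix l x assume x: "x \<in> pts S" and l: "l \<in> carrier (cf S x)"
  have s: "subconj (st S x) (st T (\<phi> x)) b" "subconj (st T (\<phi> x)) (st U (\<psi> (\<phi> x))) c" "\<phi> x \<in> pts T"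
    using t x by (auto simp: twisted_def)
  show "push T U \<psi> c (push S T \<phi> b (gen G M S l x)) = push S U \<omega> (b \<otimes> c) (gen G M S l x)"
    using x l s \<omega> by (simp add: push_gen[OF t(1)] push_gen[OF t(2)] push_gen[OF tc]
        linear_maps_closed[OF tr_linear] tr_comp)
qed

lemma push_cong:
  assumes t: "twisted S T \<phi> b" and u: "u \<in> carrier (FM S)" and eq: "\<And>x. x \<in> pts S \<Longrightarrow> \<phi> x = \<psi> x"
  shows "push S T \<phi> b u = push S T \<psi> b u"
proof (rule FM_linear_eq[OF _ _ _ _ _ u])
  have S: "gset S" using t by (simp add: twisted_def)
  have t': "twisted S T \<psi> b" using t eq gset_base[OF S] by (auto simp: twisted_def)
  show "gset S" "module k (FM T)" using t module_FM by (auto simp: twisted_def)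
  show "push S T \<phi> b \<in> linear_maps k (FM S) (FM T)" by (rule push_linear[OF t])
  show "push S T \<psi> b \<in> linear_maps k (FM S) (FM T)" by (rule push_linear[OF t'])
  fix l x assume "x \<in> pts S" "l \<in> carrier (cf S x)"
  then show "push S T \<phi> b (gen G M S l x) = push S T \<psi> b (gen G M S l x)"
    using eq by (simp add: push_gen[OF t] push_gen[OF t'])
qed

lemma twisted_id: "gset S \<Longrightarrow> twisted S S (\<lambda>x. x) \<one>"
  by (auto simp: twisted_def subconj_def subgroup_isotropy subgroup.mem_carrier[OF subgroup_isotropy])

lemma push_id:
  assumes S: "gset S" and u: "u \<in> carrier (FM S)"
  shows "push S S (\<lambda>x. x) \<one> u = u"
proof (rule FM_linear_eq[OF S module_FM[OF S] push_linear[OF twisted_id[OF S]] _ _ u, where g = "\<lambda>u. u"])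
  show "(\<lambda>u. u) \<in> linear_maps k (FM S) (FM S)" by (rule linear_mapsI) simp_all
  fix l x assume x: "x \<in> pts S" and l: "l \<in> carrier (cf S x)"
  then show "push S S (\<lambda>x. x) \<one> (gen G M S l x) = gen G M S l x"
    using subgroup_isotropy[OF S x]
    by (simp add: push_gen[OF twisted_id[OF S]] tr_id subgroup.one_closed)
qed

definition gmap :: "('g, 'x) pointed_gset \<Rightarrow> ('g, 'y) pointed_gset \<Rightarrow> ('x \<Rightarrow> 'y) \<Rightarrow> bool" where
  "gmap S T f \<longleftrightarrow> gset S \<and> gset T \<and> f \<in> pts S \<rightarrow> pts T \<and> f (base S) = base T \<and>
     (\<forall>g\<in>carrier G. \<forall>x\<in>pts S. f (gact S g x) = gact T g (f x))"

lemma gmap_gset: "gmap S T f \<Longrightarrow> gset S" "gmap S T f \<Longrightarrow> gset T"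
  by (simp_all add: gmap_def)

lemma gmap_in: "gmap S T f \<Longrightarrow> x \<in> pts S \<Longrightarrow> f x \<in> pts T"
  by (auto simp: gmap_def)

lemma twisted_gmap:
  assumes "gmap S T f"
  shows "twisted S T f \<one>"
proof -
  have "h \<in> st T (f x)" if "x \<in> pts S" "h \<in> st S x" for h x
    using assms that by (auto simp: gmap_def stabilizer_def) metis
  then show ?thesis
    using assms subgroup_isotropy[OF gmap_gset(1)[OF assms]] subgroup_isotropy[OF gmap_gset(2)[OF assms]]
      subgroup.mem_carrier[OF subgroup_isotropy[OF gmap_gset(1)[OF assms]]]
    by (auto simp: twisted_def subconj_def gmap_def Pi_iff)
qed

text \<open>The map given by g need not be equivariant, but it conjugates the isotropy group G_x
  into that of gx, and the twist \<open>inv g\<close> undoes the conjugation.\<close>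

lemma twisted_gact:
  assumes S: "gset S" and g: "g \<in> carrier G"
  shows "twisted S S (gact S g) (inv g)"
proof -
  have "g \<otimes> h \<otimes> inv g \<in> st S (gact S g x)" if x: "x \<in> pts S" and h: "h \<in> st S x" for h x
  proof -
    have h': "h \<in> carrier G" "gact S h x = x" using h by (auto simp: stabilizer_def)
    have "gact S (g \<otimes> h \<otimes> inv g) (gact S g x) = gact S (g \<otimes> h) (gact S (inv g) (gact S g x))"
      using S g h' x by (intro gset_mult) (auto simp: gset_act)
    also have "\<dots> = gact S g x" using gact_inverse(1)[OF S g x] gset_mult[OF S g h'(1) x] h' by simp
    finally show ?thesis using g h' by (simp add: stabilizer_def)
  qed
  then show ?thesis
    using S g subgroup_isotropy[OF S] by (auto simp: twisted_def subconj_def gset_act gset_base_fixed)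
qed

lemma coef_push_eq_tr: "coef_push G M S T f x = tr (st S x) (st T (f x)) \<one>"
proof -
  have "orb_proj G H K = orb_shift G H K \<one>" if "H \<subseteq> carrier G" for H K
    using that l_coset_subset_G by (fastforce simp: orb_proj_def orb_shift_def mem_lcosets intro!: restrict_ext)
  moreover have "st S x \<subseteq> carrier G" by (auto simp: stabilizer_def)
  ultimately show ?thesis unfolding coef_push_def tr_def by simp
qed

lemma Fpush_eq_push: "Fpush G M S T f = push S T f \<one>"
  by (simp add: Fpush_def push_def coef_push_eq_tr)

lemma Fact_eq_push: "Fact G M S g = push S S (gact S g) (inv g)"
  by (simp add: Fact_def push_def coef_act_def tr_def)

lemma Fpush_linear: "gmap S T f \<Longrightarrow> Fpush G M S T f \<in> linear_maps k (FM S) (FM T)"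
  unfolding Fpush_eq_push by (rule push_linear[OF twisted_gmap])

lemma Fpush_in: "gmap S T f \<Longrightarrow> u \<in> carrier (FM S) \<Longrightarrow> Fpush G M S T f u \<in> carrier (FM T)"
  by (rule linear_maps_closed[OF Fpush_linear])

lemma Fpush_gen:
  "gmap S T f \<Longrightarrow> x \<in> pts S \<Longrightarrow> l \<in> carrier (cf S x) \<Longrightarrow>
    Fpush G M S T f (gen G M S l x) = gen G M T (coef_push G M S T f x l) (f x)"
  unfolding Fpush_eq_push coef_push_eq_tr by (rule push_gen[OF twisted_gmap])

lemma coef_push_in:
  assumes "gmap S T f" "x \<in> pts S" "l \<in> carrier (cf S x)"
  shows "coef_push G M S T f x l \<in> carrier (cf T (f x))"
  unfolding coef_push_eq_tr using twisted_gmap[OF assms(1)] assms(2,3)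
  by (intro linear_maps_closed[OF tr_linear]) (auto simp: twisted_def)

lemma Fpush_comp:
  assumes "gmap S T f" "gmap T U f'" "u \<in> carrier (FM S)" "\<And>x. x \<in> pts S \<Longrightarrow> h x = f' (f x)"
  shows "Fpush G M T U f' (Fpush G M S T f u) = Fpush G M S U h u"
  using push_comp[OF twisted_gmap[OF assms(1)] twisted_gmap[OF assms(2)] assms(3), of h] assms(4)
  unfolding Fpush_eq_push by simp

lemma Fpush_cong:
  assumes "gmap S T f" "u \<in> carrier (FM S)" "\<And>x. x \<in> pts S \<Longrightarrow> f x = h x"
  shows "Fpush G M S T f u = Fpush G M S T h u"
  unfolding Fpush_eq_push by (rule push_cong[OF twisted_gmap[OF assms(1)] assms(2,3)])

lemma Fpush_id: "gset S \<Longrightarrow> u \<in> carrier (FM S) \<Longrightarrow> Fpush G M S S (\<lambda>x. x) u = u"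
  unfolding Fpush_eq_push by (rule push_id)

lemma Fact_linear: "gset S \<Longrightarrow> g \<in> carrier G \<Longrightarrow> Fact G M S g \<in> linear_maps k (FM S) (FM S)"
  unfolding Fact_eq_push by (rule push_linear[OF twisted_gact])

lemma Fact_in: "gset S \<Longrightarrow> g \<in> carrier G \<Longrightarrow> u \<in> carrier (FM S) \<Longrightarrow> Fact G M S g u \<in> carrier (FM S)"
  by (rule linear_maps_closed[OF Fact_linear])

lemma Fact_gen:
  "gset S \<Longrightarrow> g \<in> carrier G \<Longrightarrow> x \<in> pts S \<Longrightarrow> l \<in> carrier (cf S x) \<Longrightarrow>
    Fact G M S g (gen G M S l x) = gen G M S (coef_act G M S g x l) (gact S g x)"
  unfolding Fact_eq_push coef_act_def tr_def[symmetric] by (rule push_gen[OF twisted_gact])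

text \<open>The twists come out in the order \<open>inv h \<otimes> inv g\<close>, which is the
  inverse of \<open>g \<otimes> h\<close>.\<close>

lemma Fact_mult:
  assumes S: "gset S" and g: "g \<in> carrier G" and h: "h \<in> carrier G" and u: "u \<in> carrier (FM S)"
  shows "Fact G M S (g \<otimes> h) u = Fact G M S g (Fact G M S h u)"
  using push_comp[OF twisted_gact[OF S h] twisted_gact[OF S g] u, of "gact S (g \<otimes> h)"]
    gset_mult[OF S g h] g h unfolding Fact_eq_push by (simp add: inv_mult_group)

text \<open>Both composites are the push along x \<mapsto> f(gx) with twist
  \<open>inv g\<close>.\<close>

lemma Fpush_Fact:
  assumes f: "gmap S T f" and g: "g \<in> carrier G" and u: "u \<in> carrier (FM S)"
  shows "Fpush G M S T f (Fact G M S g u) = Fact G M T g (Fpush G M S T f u)"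
proof -
  have "push S T f \<one> (push S S (gact S g) (inv g) u) = push S T (\<lambda>x. f (gact S g x)) (inv g \<otimes> \<one>) u"
    by (rule push_comp[OF twisted_gact[OF gmap_gset(1)[OF f] g] twisted_gmap[OF f] u refl])
  moreover have "push T T (gact T g) (inv g) (push S T f \<one> u) = push S T (\<lambda>x. f (gact S g x)) (\<one> \<otimes> inv g) u"
    using f g by (intro push_comp[OF twisted_gmap[OF f] twisted_gact[OF gmap_gset(2)[OF f] g] u])
      (simp add: gmap_def)
  ultimately show ?thesis using g unfolding Fpush_eq_push Fact_eq_push by simp
qed

section \<open>The fixed submodule\<close>

lemma FX_carrier: "u \<in> carrier (FX S) \<longleftrightarrow> u \<in> carrier (FM S) \<and> (\<forall>g\<in>carrier G. Fact G M S g u = u)"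
  by (simp add: Ffix_def)

lemma FX_simps: "\<zero>\<^bsub>FX S\<^esub> = \<zero>\<^bsub>FM S\<^esub>" "u \<oplus>\<^bsub>FX S\<^esub> v = u \<oplus>\<^bsub>FM S\<^esub> v" "r \<odot>\<^bsub>FX S\<^esub> u = r \<odot>\<^bsub>FM S\<^esub> u"
  by (simp_all add: Ffix_def)

lemma FX_FM: "u \<in> carrier (FX S) \<Longrightarrow> u \<in> carrier (FM S)"
  by (simp add: FX_carrier)

lemma module_FX:
  assumes S: "gset S"
  shows "module k (FX S)"
proof -
  interpret F: module k "FM S" by (rule module_FM[OF S])
  have lin: "Fact G M S g \<in> linear_maps k (FM S) (FM S)" if "g \<in> carrier G" for g
    using Fact_linear[OF S that] .
  have "submodule {u \<in> carrier (FM S). \<forall>g\<in>carrier G. Fact G M S g u = u} k (FM S)"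
  proof (rule F.submoduleI)
    have sm: "r \<odot>\<^bsub>FM S\<^esub> u \<in> {u \<in> carrier (FM S). \<forall>g\<in>carrier G. Fact G M S g u = u}"
      if "r \<in> carrier k" "u \<in> {u \<in> carrier (FM S). \<forall>g\<in>carrier G. Fact G M S g u = u}" for r u
      using that linear_maps_smult[OF lin] F.smult_closed by (auto simp del: FM_simps)
    then show "\<And>r u. r \<in> carrier k \<Longrightarrow> u \<in> {u \<in> carrier (FM S). \<forall>g\<in>carrier G. Fact G M S g u = u} \<Longrightarrow>
       r \<odot>\<^bsub>FM S\<^esub> u \<in> {u \<in> carrier (FM S). \<forall>g\<in>carrier G. Fact G M S g u = u}" .
    show "\<ominus>\<^bsub>FM S\<^esub> u \<in> {u \<in> carrier (FM S). \<forall>g\<in>carrier G. Fact G M S g u = u}"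
      if "u \<in> {u \<in> carrier (FM S). \<forall>g\<in>carrier G. Fact G M S g u = u}" for u
      using that sm[of "\<ominus>\<^bsub>k\<^esub> \<one>\<^bsub>k\<^esub>" u] F.smult_l_minus[of "\<one>\<^bsub>k\<^esub>" u] F.smult_one[of u] by (auto simp del: FM_simps)
    show "u \<oplus>\<^bsub>FM S\<^esub> v \<in> {u \<in> carrier (FM S). \<forall>g\<in>carrier G. Fact G M S g u = u}"
      if "u \<in> {u \<in> carrier (FM S). \<forall>g\<in>carrier G. Fact G M S g u = u}"
        "v \<in> {u \<in> carrier (FM S). \<forall>g\<in>carrier G. Fact G M S g u = u}" for u v
      using that linear_maps_add[OF lin] F.M.a_closed by (auto simp del: FM_simps)
    show "\<zero>\<^bsub>FM S\<^esub> \<in> {u \<in> carrier (FM S). \<forall>g\<in>carrier G. Fact G M S g u = u}"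
      using linear_maps_zero[OF lin module_FM[OF S] module_FM[OF S]] F.M.zero_closed by (simp del: FM_simps)
  qed blast
  from submodule.submodule_is_module[OF this module_FM[OF S]] show ?thesis by (simp add: Ffix_def)
qed

lemma linear_maps_FX_dom:
  "f \<in> linear_maps k (FM S) N \<Longrightarrow> f \<in> linear_maps k (FX S) N"
  by (auto simp: linear_maps_def FX_carrier FX_simps simp del: FM_simps)

lemma linear_maps_FX_cod:
  "f \<in> linear_maps k V (FM S) \<Longrightarrow> (\<And>u. u \<in> carrier V \<Longrightarrow> f u \<in> carrier (FX S)) \<Longrightarrow> f \<in> linear_maps k V (FX S)"
  by (auto simp: linear_maps_def FX_simps simp del: FM_simps)

lemma Fpush_FX:
  assumes f: "gmap S T f" and u: "u \<in> carrier (FX S)"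
  shows "Fpush G M S T f u \<in> carrier (FX T)"
  using f u Fpush_Fact[OF f _ FX_FM[OF u]] by (auto simp: FX_carrier Fpush_in)

end

section \<open>Averaging over the group\<close>

definition nat_in :: "('k, 'b) ring_scheme \<Rightarrow> nat \<Rightarrow> 'k" where
  "nat_in R n = [n] \<cdot>\<^bsub>R\<^esub> \<one>\<^bsub>R\<^esub>"

lemma (in ring) nat_in_closed: "nat_in R n \<in> carrier R"
  by (simp add: nat_in_def)

lemma (in ring) nat_in_mult: "nat_in R (m * n) = nat_in R m \<otimes> nat_in R n"
  by (simp add: nat_in_def add_pow_ldistr add.nat_pow_pow mult.commute)

lemma (in module) smult_nat_in: "x \<in> carrier M \<Longrightarrow> nat_in R n \<odot>\<^bsub>M\<^esub> x = [n] \<cdot>\<^bsub>M\<^esub> x"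
proof (induction n)
  case (Suc n)
  then show ?case using smult_l_distr[of "nat_in R n" "\<one>" x] by (simp add: nat_in_def)
qed (simp add: nat_in_def)

text \<open>If n were zero in the ring, so would be its remainder modulo the characteristic;
  minimality makes the remainder 0, and the characteristic would divide n.\<close>

lemma ring_char_order_nonzero:
  assumes R: "ring R" and one: "\<one>\<^bsub>R\<^esub> \<noteq> \<zero>\<^bsub>R\<^esub>" and n: "0 < n"
    and ch: "ring_char R = 0 \<or> \<not> ring_char R dvd n"
  shows "nat_in R n \<noteq> \<zero>\<^bsub>R\<^esub>"
proof
  interpret ring R by fact
  assume z: "nat_in R n = \<zero>\<^bsub>R\<^esub>"
  let ?P = "\<lambda>n::nat. 0 < n \<and> [n] \<cdot>\<^bsub>R\<^esub> \<one>\<^bsub>R\<^esub> = \<zero>\<^bsub>R\<^esub>"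
  have ex: "?P n" using n z by (simp add: nat_in_def)
  then have c: "ring_char R = (LEAST n. ?P n)" unfolding ring_char_def by (metis (no_types, lifting))
  have p: "?P (ring_char R)" unfolding c by (rule LeastI[of ?P, OF ex])
  let ?r = "n mod ring_char R"
  have "nat_in R n = nat_in R (ring_char R * (n div ring_char R)) \<oplus>\<^bsub>R\<^esub> nat_in R ?r"
    by (simp add: nat_in_def add.nat_pow_mult)
  then have "nat_in R ?r = \<zero>\<^bsub>R\<^esub>"
    using z p nat_in_closed by (simp add: nat_in_mult nat_in_def[of R "ring_char R"])
  moreover have "?r < ring_char R" using p by simp
  ultimately have "?r = 0"
    using not_less_Least[of ?r ?P] c by (auto simp: nat_in_def)
  then show False using ch p by auto
qed

locale coefficients_invertible = coefficients G k M
  for G :: "('g, 'a) monoid_scheme" (structure) and k :: "('k, 'b) ring_scheme"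
    and M :: "('g, 'k, 'm) coefficients" +
  assumes finite_group: "finite (carrier G)" and field_k: "Ring.field k"
    and order_nonzero: "nat_in k (order G) \<noteq> \<zero>\<^bsub>k\<^esub>"
begin

sublocale k: Ring.field k by (rule field_k)

text \<open>By Lagrange the order of \<open>H\<close> is a factor of the order of \<open>G\<close>,
  and a factor of a nonzero element is nonzero.\<close>

lemma subgroup_order_unit:
  assumes "subgroup H G"
  shows "nat_in k (card H) \<in> Units k"
proof -
  have "order G = card (rcosets H) * card H" using lagrange[OF assms] by simp
  then have "nat_in k (order G) = nat_in k (card (rcosets H)) \<otimes>\<^bsub>k\<^esub> nat_in k (card H)"
    by (simp add: k.nat_in_mult)
  then have "nat_in k (card H) \<noteq> \<zero>\<^bsub>k\<^esub>" using order_nonzero k.nat_in_closed by auto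
  then show ?thesis using k.nat_in_closed by (simp add: k.field_Units)
qed

lemma order_unit: "nat_in k (order G) \<in> Units k"
  using order_nonzero k.nat_in_closed by (simp add: k.field_Units)

text \<open>The projection e of the overview.\<close>

definition avg :: "('g, 'x) pointed_gset \<Rightarrow> ('x \<Rightarrow> 'm) \<Rightarrow> ('x \<Rightarrow> 'm)" where
  "avg S u = inv\<^bsub>k\<^esub> (nat_in k (order G)) \<odot>\<^bsub>FM S\<^esub> (\<Oplus>\<^bsub>FM S\<^esub>g\<in>carrier G. Fact G M S g u)"

lemma inv_order: "inv\<^bsub>k\<^esub> (nat_in k (order G)) \<in> carrier k"
  using order_unit by simp

lemma sum_Fact_linear:
  "gset S \<Longrightarrow> (\<lambda>u. \<Oplus>\<^bsub>FM S\<^esub>g\<in>carrier G. Fact G M S g u) \<in> linear_maps k (FM S) (FM S)"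
  by (intro linear_maps_finsum_pointwise module_FM Fact_linear)

lemma smult_linear:
  assumes "module k V" and r: "r \<in> carrier k"
  shows "(\<lambda>u. r \<odot>\<^bsub>V\<^esub> u) \<in> linear_maps k V V"
proof -
  interpret V: module k V by fact
  show ?thesis
  proof (rule linear_mapsI)
    fix s x assume s: "s \<in> carrier k" and x: "x \<in> carrier V"
    show "r \<odot>\<^bsub>V\<^esub> (s \<odot>\<^bsub>V\<^esub> x) = s \<odot>\<^bsub>V\<^esub> (r \<odot>\<^bsub>V\<^esub> x)"
      using r s x by (metis V.smult_assoc1 k.m_comm)
  qed (use r in \<open>auto simp: V.smult_r_distr\<close>)
qed

lemma avg_linear: "gset S \<Longrightarrow> avg S \<in> linear_maps k (FM S) (FM S)"
  unfolding avg_def[abs_def]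
  by (intro linear_maps_comp[OF sum_Fact_linear smult_linear] module_FM inv_order)

text \<open>An equivariant linear map can be moved inside the sum over G. Applied both to induced
  maps and to the scaling w.\<close>

lemma avg_natural:
  assumes S: "gset S" and T: "gset T" and L: "L \<in> linear_maps k (FM S) (FM T)"
    and eq: "\<And>g u. g \<in> carrier G \<Longrightarrow> u \<in> carrier (FM S) \<Longrightarrow> L (Fact G M S g u) = Fact G M T g (L u)"
    and u: "u \<in> carrier (FM S)"
  shows "L (avg S u) = avg T (L u)"
proof -
  interpret FS: module k "FM S" by (rule module_FM[OF S])
  interpret FT: module k "FM T" by (rule module_FM[OF T])
  have cl: "(\<lambda>g. Fact G M S g u) \<in> carrier G \<rightarrow> carrier (FM S)" using Fact_in[OF S _ u] by blast
  have "L (\<Oplus>\<^bsub>FM S\<^esub>g\<in>carrier G. Fact G M S g u) = (\<Oplus>\<^bsub>FM T\<^esub>g\<in>carrier G. L (Fact G M S g u))"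
    by (rule linear_maps_finsum[OF L module_FM[OF S] module_FM[OF T] cl])
  also have "\<dots> = (\<Oplus>\<^bsub>FM T\<^esub>g\<in>carrier G. Fact G M T g (L u))"
    using eq[OF _ u] Fact_in[OF T _ linear_maps_closed[OF L u]] by (intro FT.M.finsum_cong') auto
  finally show ?thesis
    unfolding avg_def using linear_maps_smult[OF L inv_order FS.M.finsum_closed[OF cl]] by simp
qed

text \<open>Left translation by \<open>h\<close> merely permutes the summands.\<close>

lemma Fact_avg:
  assumes S: "gset S" and h: "h \<in> carrier G" and u: "u \<in> carrier (FM S)"
  shows "Fact G M S h (avg S u) = avg S u"
proof -
  interpret FS: module k "FM S" by (rule module_FM[OF S])
  have cl: "(\<lambda>g. Fact G M S g u) \<in> carrier G \<rightarrow> carrier (FM S)" using Fact_in[OF S _ u] by blast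
  have im: "(\<lambda>g. h \<otimes> g) ` carrier G = carrier G"
    using h surj_const_mult by blast
  have "Fact G M S h (\<Oplus>\<^bsub>FM S\<^esub>g\<in>carrier G. Fact G M S g u) =
      (\<Oplus>\<^bsub>FM S\<^esub>g\<in>carrier G. Fact G M S h (Fact G M S g u))"
    by (rule linear_maps_finsum[OF Fact_linear[OF S h] module_FM[OF S] module_FM[OF S] cl])
  also have "\<dots> = (\<Oplus>\<^bsub>FM S\<^esub>g\<in>carrier G. Fact G M S (h \<otimes> g) u)"
    using Fact_mult[OF S h _ u] Fact_in[OF S _ u] h u by (intro FS.M.finsum_cong') (auto intro: Fact_in[OF S])
  also have "\<dots> = (\<Oplus>\<^bsub>FM S\<^esub>g\<in>(\<lambda>g. h \<otimes> g) ` carrier G. Fact G M S g u)"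
    using cl h by (intro FS.M.finsum_reindex[symmetric]) (auto simp: im inj_on_multc inj_on_cmult)
  finally show ?thesis
    unfolding avg_def im
    using linear_maps_smult[OF Fact_linear[OF S h] inv_order FS.M.finsum_closed[OF cl]] by simp
qed

lemma avg_FX: "gset S \<Longrightarrow> u \<in> carrier (FM S) \<Longrightarrow> avg S u \<in> carrier (FX S)"
  by (simp add: FX_carrier Fact_avg linear_maps_closed[OF avg_linear])

lemma avg_fixed:
  assumes S: "gset S" and u: "u \<in> carrier (FX S)"
  shows "avg S u = u"
proof -
  interpret FS: module k "FM S" by (rule module_FM[OF S])
  have "(\<Oplus>\<^bsub>FM S\<^esub>g\<in>carrier G. Fact G M S g u) = (\<Oplus>\<^bsub>FM S\<^esub>g\<in>carrier G. u)"
    using u by (intro FS.M.finsum_cong') (auto simp: FX_carrier)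
  also have "\<dots> = nat_in k (order G) \<odot>\<^bsub>FM S\<^esub> u"
    using FX_FM[OF u] FS.M.add.finprod_const[of u "carrier G"]
    by (simp add: FS.smult_nat_in order_def del: FM_simps)
  finally show ?thesis
    unfolding avg_def using FS.smult_assoc1[OF inv_order k.nat_in_closed FX_FM[OF u], of "order G"] order_unit
      FS.smult_one[OF FX_FM[OF u]] by (simp del: FM_simps)
qed

lemma Fpush_avg:
  assumes f: "gmap S T f" and u: "u \<in> carrier (FM S)"
  shows "Fpush G M S T f (avg S u) = avg T (Fpush G M S T f u)"
  by (rule avg_natural[OF gmap_gset[OF f] Fpush_linear[OF f] Fpush_Fact[OF f] u])

section \<open>Pointwise scaling and the weights |G : G_x|\<close>

definition scale :: "('g, 'x) pointed_gset \<Rightarrow> ('x \<Rightarrow> 'k) \<Rightarrow> ('x \<Rightarrow> 'm) \<Rightarrow> ('x \<Rightarrow> 'm)" where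
  "scale S c u = (\<lambda>x\<in>pts S. c x \<odot>\<^bsub>cf S x\<^esub> u x)"

lemma scale_in:
  assumes S: "gset S" and c: "c \<in> pts S \<rightarrow> carrier k" and u: "u \<in> carrier (FM S)"
  shows "scale S c u \<in> carrier (FM S)"
  unfolding scale_def
proof (rule pointwise_in_FM[OF _ supp_finite[OF u] _ _ gset_base[OF S]])
  note mod = module_cf[OF S]
  show "c x \<odot>\<^bsub>cf S x\<^esub> u x \<in> carrier (cf S x)" if "x \<in> pts S" for x
    using that c FM_value[OF u] by (auto intro!: module.smult_closed[OF mod])
  show "c x \<odot>\<^bsub>cf S x\<^esub> u x = \<zero>\<^bsub>cf S x\<^esub>" if "x \<in> pts S" "x \<notin> supp G M S u" for x
    using that c by (auto simp: supp_def intro!: module.smult_r_null[OF mod])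
  show "c (base S) \<odot>\<^bsub>cf S (base S)\<^esub> u (base S) = \<zero>\<^bsub>cf S (base S)\<^esub>"
    using u c gset_base[OF S] by (auto simp: FM_carrier intro!: module.smult_r_null[OF mod])
qed

lemma scale_linear:
  assumes S: "gset S" and c: "c \<in> pts S \<rightarrow> carrier k"
  shows "scale S c \<in> linear_maps k (FM S) (FM S)"
proof (rule linear_mapsI)
  note mod = module_cf[OF S]
  have cx: "x \<in> pts S \<Longrightarrow> c x \<in> carrier k" for x using c by blast
  fix u v assume u: "u \<in> carrier (FM S)" and v: "v \<in> carrier (FM S)"
  show "scale S c (u \<oplus>\<^bsub>FM S\<^esub> v) = scale S c u \<oplus>\<^bsub>FM S\<^esub> scale S c v"
    using cx FM_value[OF u] FM_value[OF v]
    by (auto simp: scale_def module.smult_r_distr[OF mod] intro!: restrict_ext)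
next
  note mod = module_cf[OF S]
  have cx: "x \<in> pts S \<Longrightarrow> c x \<in> carrier k" for x using c by blast
  fix r u assume r: "r \<in> carrier k" and u: "u \<in> carrier (FM S)"
  have "c x \<odot>\<^bsub>cf S x\<^esub> (r \<odot>\<^bsub>cf S x\<^esub> u x) = r \<odot>\<^bsub>cf S x\<^esub> (c x \<odot>\<^bsub>cf S x\<^esub> u x)" if x: "x \<in> pts S" for x
    using module.smult_assoc1[OF mod[OF x] cx[OF x] r FM_value[OF u x]]
      module.smult_assoc1[OF mod[OF x] r cx[OF x] FM_value[OF u x]] k.m_comm[OF cx[OF x] r] by simp
  then show "scale S c (r \<odot>\<^bsub>FM S\<^esub> u) = r \<odot>\<^bsub>FM S\<^esub> scale S c u"
    by (auto simp: scale_def intro!: restrict_ext)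
qed (rule scale_in[OF S c])

lemma scale_gen:
  assumes S: "gset S" and c: "c \<in> pts S \<rightarrow> carrier k" and x: "x \<in> pts S"
  shows "scale S c (gen G M S l x) = c x \<odot>\<^bsub>FM S\<^esub> gen G M S l x"
proof -
  note mod = module_cf[OF S]
  have cx: "x \<in> pts S \<Longrightarrow> c x \<in> carrier k" for x using c by blast
  have z: "y \<in> pts S \<Longrightarrow> z \<in> pts S \<Longrightarrow> c y \<odot>\<^bsub>cf S z\<^esub> \<zero>\<^bsub>cf S z\<^esub> = \<zero>\<^bsub>cf S z\<^esub>" for y z
    by (rule module.smult_r_null[OF mod cx])
  show ?thesis
    using x by (auto simp: scale_def gen_def z intro!: restrict_ext)
qed

lemma scale_inverse:
  assumes S: "gset S" and c: "c \<in> pts S \<rightarrow> carrier k" and d: "d \<in> pts S \<rightarrow> carrier k"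
    and u: "u \<in> carrier (FM S)" and cd: "\<And>x. x \<in> pts S \<Longrightarrow> c x \<otimes>\<^bsub>k\<^esub> d x = \<one>\<^bsub>k\<^esub>"
  shows "scale S c (scale S d u) = u"
proof (rule FM_eqI[OF scale_in[OF S c scale_in[OF S d u]] u])
  fix x assume x: "x \<in> pts S"
  interpret X: module k "cf S x" by (rule module_cf[OF S x])
  have "c x \<in> carrier k" "d x \<in> carrier k" using c d x by auto
  then show "scale S c (scale S d u) x = u x"
    using x FM_value[OF u x] cd[OF x] X.smult_assoc1[of "c x" "d x" "u x"] by (simp add: scale_def)
qed

text \<open>On lx the two sides carry the factors c(gx) and c(x), which agree by the invariance of
  \<open>c\<close> under \<open>g\<close>.\<close>

lemma scale_Fact:
  assumes S: "gset S" and c: "c \<in> pts S \<rightarrow> carrier k" and g: "g \<in> carrier G"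
    and inv: "\<And>x. x \<in> pts S \<Longrightarrow> c (gact S g x) = c x" and u: "u \<in> carrier (FM S)"
  shows "scale S c (Fact G M S g u) = Fact G M S g (scale S c u)"
proof (rule FM_linear_eq[OF S module_FM[OF S] _ _ _ u])
  show "(\<lambda>u. scale S c (Fact G M S g u)) \<in> linear_maps k (FM S) (FM S)"
    by (rule linear_maps_comp[OF Fact_linear[OF S g] scale_linear[OF S c]])
  show "(\<lambda>u. Fact G M S g (scale S c u)) \<in> linear_maps k (FM S) (FM S)"
    by (rule linear_maps_comp[OF scale_linear[OF S c] Fact_linear[OF S g]])
  fix l x assume x: "x \<in> pts S" and l: "l \<in> carrier (cf S x)"
  have cx: "c x \<in> carrier k" using c x by blast
  have "scale S c (Fact G M S g (gen G M S l x)) = c x \<odot>\<^bsub>FM S\<^esub> Fact G M S g (gen G M S l x)"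
    unfolding Fact_gen[OF S g x l] scale_gen[OF S c gset_act[OF S g x]] inv[OF x] ..
  also have "\<dots> = Fact G M S g (scale S c (gen G M S l x))"
    unfolding scale_gen[OF S c x] using linear_maps_smult[OF Fact_linear[OF S g] cx gen_in[OF S x l]] by simp
  finally show "scale S c (Fact G M S g (gen G M S l x)) = Fact G M S g (scale S c (gen G M S l x))" .
qed

text \<open>The index |G : G_x| in k, written as a quotient of two orders that are both units, so
  that the reciprocal \<open>iwt\<close> is at hand. Scaling by \<open>wt\<close> is the w of the
  overview.\<close>

definition wt :: "('g, 'x) pointed_gset \<Rightarrow> 'x \<Rightarrow> 'k" where
  "wt S x = nat_in k (order G) \<otimes>\<^bsub>k\<^esub> inv\<^bsub>k\<^esub> (nat_in k (card (st S x)))"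

definition iwt :: "('g, 'x) pointed_gset \<Rightarrow> 'x \<Rightarrow> 'k" where
  "iwt S x = nat_in k (card (st S x)) \<otimes>\<^bsub>k\<^esub> inv\<^bsub>k\<^esub> (nat_in k (order G))"

lemma isotropy_unit: "gset S \<Longrightarrow> x \<in> pts S \<Longrightarrow> nat_in k (card (st S x)) \<in> Units k"
  by (intro subgroup_order_unit subgroup_isotropy)

lemma wt_in: "gset S \<Longrightarrow> wt S \<in> pts S \<rightarrow> carrier k"
  and iwt_in: "gset S \<Longrightarrow> iwt S \<in> pts S \<rightarrow> carrier k"
  by (auto simp: wt_def iwt_def intro!: k.m_closed k.nat_in_closed k.Units_inv_closed isotropy_unit order_unit)

lemma wt_iwt:
  assumes "gset S" "x \<in> pts S"
  shows "wt S x \<otimes>\<^bsub>k\<^esub> iwt S x = \<one>\<^bsub>k\<^esub>" "iwt S x \<otimes>\<^bsub>k\<^esub> wt S x = \<one>\<^bsub>k\<^esub>"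
proof -
  let ?n = "nat_in k (order G)" and ?c = "nat_in k (card (st S x))"
  have n: "?n \<in> Units k" and c: "?c \<in> Units k" using order_unit isotropy_unit assms by auto
  then have cl: "?n \<in> carrier k" "?c \<in> carrier k" "inv\<^bsub>k\<^esub> ?n \<in> carrier k" "inv\<^bsub>k\<^esub> ?c \<in> carrier k" by auto
  have "wt S x \<otimes>\<^bsub>k\<^esub> iwt S x = (?n \<otimes>\<^bsub>k\<^esub> inv\<^bsub>k\<^esub> ?n) \<otimes>\<^bsub>k\<^esub> (?c \<otimes>\<^bsub>k\<^esub> inv\<^bsub>k\<^esub> ?c)"
    unfolding wt_def iwt_def using cl by (simp add: k.m_ac)
  then show "wt S x \<otimes>\<^bsub>k\<^esub> iwt S x = \<one>\<^bsub>k\<^esub>" using n c by simp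
  then show "iwt S x \<otimes>\<^bsub>k\<^esub> wt S x = \<one>\<^bsub>k\<^esub>"
    using assms wt_in iwt_in by (metis PiE k.m_comm)
qed

text \<open>Conjugation by \<open>h\<close> injects one isotropy group into the other; applying this
  to g and to its inverse gives both inequalities.\<close>

lemma card_isotropy:
  assumes S: "gset S" and x: "x \<in> pts S" and g: "g \<in> carrier G"
  shows "card (st S (gact S g x)) = card (st S x)"
proof -
  have le: "card (st S y) \<le> card (st S (gact S h y))" if h: "h \<in> carrier G" and y: "y \<in> pts S" for h y
  proof (rule card_inj_on_le)
    have c: "a \<in> carrier G" if "a \<in> st S y" for a using that by (simp add: stabilizer_def)
    show "inj_on (\<lambda>a. h \<otimes> a \<otimes> inv h) (st S y)"
      using h c by (auto simp: inj_on_def)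
    show "(\<lambda>a. h \<otimes> a \<otimes> inv h) ` st S y \<subseteq> st S (gact S h y)"
      using twisted_gact[OF S h] h y by (auto simp: twisted_def subconj_def)
    show "finite (st S (gact S h y))"
      using finite_group by (auto simp: stabilizer_def)
  qed
  show ?thesis
    using le[OF g x] le[OF inv_closed[OF g] gset_act[OF S g x]] gact_inverse(1)[OF S g x] by simp
qed

lemma wt_invariant:
  assumes "gset S" "x \<in> pts S" "g \<in> carrier G"
  shows "wt S (gact S g x) = wt S x" "iwt S (gact S g x) = iwt S x"
  using card_isotropy[OF assms] by (simp_all add: wt_def iwt_def)

lemma scale_FX:
  assumes S: "gset S" and u: "u \<in> carrier (FX S)"
  shows "scale S (wt S) u \<in> carrier (FX S)" "scale S (iwt S) u \<in> carrier (FX S)"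
  using u scale_Fact[OF S wt_in[OF S] _ wt_invariant(1)[OF S] FX_FM[OF u]]
    scale_Fact[OF S iwt_in[OF S] _ wt_invariant(2)[OF S] FX_FM[OF u]]
    scale_in[OF S wt_in[OF S] FX_FM[OF u]] scale_in[OF S iwt_in[OF S] FX_FM[OF u]]
  by (auto simp: FX_carrier)

lemma scale_wt_iwt:
  assumes S: "gset S" and u: "u \<in> carrier (FM S)"
  shows "scale S (wt S) (scale S (iwt S) u) = u" "scale S (iwt S) (scale S (wt S) u) = u"
  using scale_inverse[OF S wt_in[OF S] iwt_in[OF S] u wt_iwt(1)[OF S]]
    scale_inverse[OF S iwt_in[OF S] wt_in[OF S] u wt_iwt(2)[OF S]] by auto

lemma scale_avg:
  assumes S: "gset S" and u: "u \<in> carrier (FM S)"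
  shows "scale S (wt S) (avg S u) = avg S (scale S (wt S) u)"
  by (rule avg_natural[OF S S scale_linear[OF S wt_in[OF S]] scale_Fact[OF S wt_in[OF S] _ wt_invariant(1)[OF S]] u])

section \<open>Orbit sums and the maps \<beta> and \<alpha>\<close>

lemma some_in_lcoset:
  assumes H: "subgroup H G" and C: "C \<in> lcosets H"
  shows "(SOME g. g \<in> C) \<in> C" "(SOME g. g \<in> C) \<in> carrier G"
proof -
  have "C \<noteq> {}" using C lcos_self[OF _ H] by (auto simp: mem_lcosets)
  then show "(SOME g. g \<in> C) \<in> C" using some_in_eq by blast
  then show "(SOME g. g \<in> C) \<in> carrier G" using C lcosets_part_G[OF H] by blast
qed

lemma gamma_eq:
  assumes S: "gset S" and x: "x \<in> pts S" and l: "l \<in> carrier (cf S x)"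
  shows "gamma G M S x l = (\<Oplus>\<^bsub>FM S\<^esub>C\<in>orb G S x. Fact G M S (SOME g. g \<in> C) (gen G M S l x))"
proof -
  interpret FS: module k "FM S" by (rule module_FM[OF S])
  note s = some_in_lcoset(2)[OF subgroup_isotropy[OF S x]]
  show ?thesis
    unfolding gamma_def Let_def
    using s Fact_in[OF S _ gen_in[OF S x l]] Fact_gen[OF S _ x l]
    by (intro FS.M.finsum_cong') (auto simp del: FM_simps)
qed

text \<open>The term for \<open>g\<close> depends only on its left coset modulo G_x. Splitting G
  into cosets, each contributes |G_x| copies of the summand that \<open>gamma\<close> takes for
  it.\<close>

lemma sum_Fact_gen:
  assumes S: "gset S" and x: "x \<in> pts S" and l: "l \<in> carrier (cf S x)"
  shows "(\<Oplus>\<^bsub>FM S\<^esub>g\<in>carrier G. Fact G M S g (gen G M S l x)) = nat_in k (card (st S x)) \<odot>\<^bsub>FM S\<^esub> gamma G M S x l"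
proof -
  interpret FS: module k "FM S" by (rule module_FM[OF S])
  let ?H = "st S x" and ?u = "gen G M S l x"
  have H: "subgroup ?H G" by (rule subgroup_isotropy[OF S x])
  have u: "?u \<in> carrier (FM S)" by (rule gen_in[OF S x l])
  have finite_orb: "finite (orb G S x)"
    using finite_group by (simp add: LCOSETS_def)
  have Cc: "C \<subseteq> carrier G" if "C \<in> orb G S x" for C
    using that lcosets_part_G[OF H] by blast
  \<comment> \<open>An element h of G_x fixes lx by \<open>tr_id\<close>, so every ah in the coset
    of a acts on lx as a does.\<close>
  have const: "Fact G M S g ?u = Fact G M S g' ?u" if C: "C \<in> orb G S x" "g \<in> C" "g' \<in> C" for C g g'
  proof -
    obtain a where a: "a \<in> carrier G" "C = a <#\<^bsub>G\<^esub> ?H" using C by (auto simp: mem_lcosets)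
    have "Fact G M S c ?u = Fact G M S a ?u" if c: "c \<in> C" for c
    proof -
      obtain h where h: "h \<in> ?H" "c = a \<otimes> h" using c a by (auto simp: l_coset_def)
      have hG: "h \<in> carrier G" "gact S h x = x" using h by (auto simp: stabilizer_def)
      have "coef_act G M S h x l = l"
        unfolding coef_act_def tr_def[symmetric] hG(2)
        using H h l by (intro tr_id) (auto intro: subgroup.m_inv_closed)
      then have "Fact G M S h ?u = ?u" using Fact_gen[OF S hG(1) x l] hG by simp
      then show ?thesis using Fact_mult[OF S a(1) hG(1) u] h by simp
    qed
    then show ?thesis using C by metis
  qed
  have "(\<Oplus>\<^bsub>FM S\<^esub>g\<in>carrier G. Fact G M S g ?u) = (\<Oplus>\<^bsub>FM S\<^esub>g\<in>\<Union>((\<lambda>C. C) ` orb G S x). Fact G M S g ?u)"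
    by (simp add: lcosets_part_G[OF H] del: FM_simps)
  also have "\<dots> = (\<Oplus>\<^bsub>FM S\<^esub>C\<in>orb G S x. \<Oplus>\<^bsub>FM S\<^esub>g\<in>C. Fact G M S g ?u)"
  proof (rule FS.M.add.finprod_UN_disjoint[OF finite_orb])
    show "finite C" if "C \<in> orb G S x" for C using Cc[OF that] finite_group finite_subset by blast
    show "pairwise (\<lambda>C D. disjnt C D) (orb G S x)"
      using lcos_disjoint[OF H] by (auto simp: pairwise_def disjnt_def)
    show "Fact G M S g ?u \<in> carrier (FM S)" if "C \<in> orb G S x" "g \<in> C" for C g
      using Cc that Fact_in[OF S _ u] by blast
  qed
  also have "\<dots> = (\<Oplus>\<^bsub>FM S\<^esub>C\<in>orb G S x. nat_in k (card ?H) \<odot>\<^bsub>FM S\<^esub> Fact G M S (SOME g. g \<in> C) ?u)"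
  proof (rule FS.M.finsum_cong')
    fix C assume C: "C \<in> orb G S x"
    note s = some_in_lcoset[OF H C]
    have sF: "Fact G M S (SOME g. g \<in> C) ?u \<in> carrier (FM S)" by (rule Fact_in[OF S s(2) u])
    have "(\<Oplus>\<^bsub>FM S\<^esub>g\<in>C. Fact G M S g ?u) = (\<Oplus>\<^bsub>FM S\<^esub>g\<in>C. Fact G M S (SOME g. g \<in> C) ?u)"
      using const[OF C _ s(1)] sF by (intro FS.M.finsum_cong') auto
    also have "\<dots> = nat_in k (card C) \<odot>\<^bsub>FM S\<^esub> Fact G M S (SOME g. g \<in> C) ?u"
      using FS.M.add.finprod_const[OF sF, of C] sF by (simp add: FS.smult_nat_in del: FM_simps)
    also have "card C = card ?H"
      using l_card_cosets_equal[OF C subgroup.subset[OF H] finite_group] by simp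
    finally show "(\<Oplus>\<^bsub>FM S\<^esub>g\<in>C. Fact G M S g ?u) = nat_in k (card ?H) \<odot>\<^bsub>FM S\<^esub> Fact G M S (SOME g. g \<in> C) ?u" .
  next
    show "(\<lambda>C. nat_in k (card ?H) \<odot>\<^bsub>FM S\<^esub> Fact G M S (SOME g. g \<in> C) ?u) \<in> orb G S x \<rightarrow> carrier (FM S)"
      by (intro funcsetI FS.smult_closed k.nat_in_closed Fact_in[OF S _ u] some_in_lcoset(2)[OF H])
  qed simp
  also have "\<dots> = nat_in k (card ?H) \<odot>\<^bsub>FM S\<^esub> gamma G M S x l"
    unfolding gamma_eq[OF S x l]
  proof (rule FS.finsum_smult_ldistr[OF finite_orb k.nat_in_closed, symmetric])
    show "(\<lambda>C. Fact G M S (SOME g. g \<in> C) ?u) \<in> orb G S x \<rightarrow> carrier (FM S)"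
      by (intro funcsetI Fact_in[OF S _ u] some_in_lcoset(2)[OF H])
  qed
  finally show ?thesis .
qed

lemma gamma_base: "gset S \<Longrightarrow> gamma G M S (base S) l = \<zero>\<^bsub>FM S\<^esub>"
proof -
  assume S: "gset S"
  interpret FS: module k "FM S" by (rule module_FM[OF S])
  show ?thesis
    unfolding gamma_def Let_def
    using gset_base_fixed[OF S some_in_lcoset(2)[OF subgroup_isotropy[OF S gset_base[OF S]]]]
    by (intro FS.M.add.finprod_one_eqI) (simp add: gen_base del: FM_simps)
qed

lemma gamma_linear:
  assumes S: "gset S" and x: "x \<in> pts S"
  shows "(\<lambda>l. gamma G M S x l) \<in> linear_maps k (cf S x) (FM S)"
proof (rule linear_maps_cong[OF _ module_cf[OF S x]])
  show "(\<lambda>l. \<Oplus>\<^bsub>FM S\<^esub>C\<in>orb G S x. Fact G M S (SOME g. g \<in> C) (gen G M S l x)) \<in> linear_maps k (cf S x) (FM S)"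
    by (intro linear_maps_finsum_pointwise module_cf[OF S x] module_FM[OF S]
        linear_maps_comp[OF gen_linear[OF S x] Fact_linear[OF S]] some_in_lcoset(2)[OF subgroup_isotropy[OF S x]])
qed (rule gamma_eq[OF S x])

lemma beta_linear: "gset S \<Longrightarrow> beta G M S \<in> linear_maps k (FM S) (FM S)"
  unfolding beta_def by (rule lin_ext_linear[OF _ module_FM gamma_linear gamma_base])

lemma beta_gen:
  "gset S \<Longrightarrow> x \<in> pts S \<Longrightarrow> l \<in> carrier (cf S x) \<Longrightarrow> beta G M S (gen G M S l x) = gamma G M S x l"
  unfolding beta_def by (rule lin_ext_gen[OF _ module_FM gamma_linear gamma_base])

text \<open>On lx the weight |G| |G_x|^-1 cancels the factor |G|^-1 |G_x| produced by averaging,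
  leaving \<gamma>_x(l).\<close>

lemma beta_eq_avg:
  assumes S: "gset S" and u: "u \<in> carrier (FM S)"
  shows "beta G M S u = avg S (scale S (wt S) u)"
proof (rule FM_linear_eq[OF S module_FM[OF S] beta_linear[OF S]
      linear_maps_comp[OF scale_linear[OF S wt_in[OF S]] avg_linear[OF S]] _ u])
  fix l x assume x: "x \<in> pts S" and l: "l \<in> carrier (cf S x)"
  interpret FS: module k "FM S" by (rule module_FM[OF S])
  let ?n = "nat_in k (order G)" and ?c = "nat_in k (card (st S x))"
  have n: "?n \<in> Units k" and c: "?c \<in> Units k" using order_unit isotropy_unit[OF S x] by auto
  then have cl: "?n \<in> carrier k" "?c \<in> carrier k" "inv\<^bsub>k\<^esub> ?n \<in> carrier k" "inv\<^bsub>k\<^esub> ?c \<in> carrier k" by auto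
  have w: "wt S x \<in> carrier k" using wt_in[OF S] x by blast
  have ga: "gamma G M S x l \<in> carrier (FM S)" by (rule linear_maps_closed[OF gamma_linear[OF S x] l])
  have one: "wt S x \<otimes>\<^bsub>k\<^esub> (inv\<^bsub>k\<^esub> ?n \<otimes>\<^bsub>k\<^esub> ?c) = \<one>\<^bsub>k\<^esub>"
  proof -
    have "wt S x \<otimes>\<^bsub>k\<^esub> (inv\<^bsub>k\<^esub> ?n \<otimes>\<^bsub>k\<^esub> ?c) = (?n \<otimes>\<^bsub>k\<^esub> inv\<^bsub>k\<^esub> ?n) \<otimes>\<^bsub>k\<^esub> (?c \<otimes>\<^bsub>k\<^esub> inv\<^bsub>k\<^esub> ?c)"
      unfolding wt_def using cl by (simp add: k.m_ac)
    then show ?thesis using n c by simp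
  qed
  have "avg S (scale S (wt S) (gen G M S l x)) = wt S x \<odot>\<^bsub>FM S\<^esub> avg S (gen G M S l x)"
    unfolding scale_gen[OF S wt_in[OF S] x]
    by (rule linear_maps_smult[OF avg_linear[OF S] w gen_in[OF S x l]])
  also have "\<dots> = (wt S x \<otimes>\<^bsub>k\<^esub> (inv\<^bsub>k\<^esub> ?n \<otimes>\<^bsub>k\<^esub> ?c)) \<odot>\<^bsub>FM S\<^esub> gamma G M S x l"
    unfolding avg_def sum_Fact_gen[OF S x l] using w cl ga FS.smult_closed
    by (simp add: FS.smult_assoc1 del: FM_simps)
  finally show "beta G M S (gen G M S l x) = avg S (scale S (wt S) (gen G M S l x))"
    unfolding one beta_gen[OF S x l] using FS.smult_one[OF ga] by simp
qed

lemma beta_FX: "gset S \<Longrightarrow> u \<in> carrier (FM S) \<Longrightarrow> beta G M S u \<in> carrier (FX S)"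
  by (simp add: beta_eq_avg avg_FX scale_in wt_in)

lemma alpha_eq_scale:
  assumes S: "gset S" and u: "u \<in> carrier (FX S)"
  shows "alpha G M S u = scale S (wt S) u"
proof -
  have "alpha G M S u = beta G M S u" using u by (simp add: alpha_def compose_def incl_def)
  also have "\<dots> = scale S (wt S) u"
    unfolding beta_eq_avg[OF S FX_FM[OF u]] by (rule avg_fixed[OF S scale_FX(1)[OF S u]])
  finally show ?thesis .
qed

lemma alpha_avg:
  assumes S: "gset S" and u: "u \<in> carrier (FM S)"
  shows "alpha G M S (avg S u) = beta G M S u"
  unfolding alpha_eq_scale[OF S avg_FX[OF S u]] scale_avg[OF S u] beta_eq_avg[OF S u] ..

lemma alpha_linear:
  assumes S: "gset S"
  shows "alpha G M S \<in> linear_maps k (FX S) (FX S)"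
proof (rule linear_maps_cong[OF _ module_FX[OF S] alpha_eq_scale[OF S]])
  show "scale S (wt S) \<in> linear_maps k (FX S) (FX S)"
    by (intro linear_maps_FX_cod[OF linear_maps_FX_dom[OF scale_linear[OF S wt_in[OF S]]]] scale_FX(1)[OF S])
qed

lemma alpha_bij:
  assumes S: "gset S"
  shows "bij_betw (alpha G M S) (carrier (FX S)) (carrier (FX S))"
    "u \<in> carrier (FX S) \<Longrightarrow> inv_into (carrier (FX S)) (alpha G M S) u = scale S (iwt S) u"
proof -
  have a: "alpha G M S u = scale S (wt S) u" "alpha G M S u \<in> carrier (FX S)"
    "scale S (iwt S) u \<in> carrier (FX S)" "scale S (iwt S) (alpha G M S u) = u"
    "alpha G M S (scale S (iwt S) u) = u" if "u \<in> carrier (FX S)" for u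
    using alpha_eq_scale[OF S that] alpha_eq_scale[OF S scale_FX(2)[OF S that]]
      scale_FX[OF S that] scale_wt_iwt[OF S FX_FM[OF that]] by auto
  show b: "bij_betw (alpha G M S) (carrier (FX S)) (carrier (FX S))"
    by (rule bij_betw_byWitness[where f' = "scale S (iwt S)"]) (use a in auto)
  show "inv_into (carrier (FX S)) (alpha G M S) u = scale S (iwt S) u" if "u \<in> carrier (FX S)"
    using a that b by (intro inv_into_f_eq) (auto simp: bij_betw_def)
qed

text \<open>Evaluates the definite description in \<open>FG_push\<close>. The conjugate of the
  induced map by the weights takes the prescribed values, because e commutes with induced maps;
  uniqueness holds because \<beta> maps onto the fixed elements.\<close>

lemma FG_push_eq:
  assumes f: "gmap S T f"
  shows "FG_push G k M S T f = (\<lambda>u\<in>carrier (FX S). scale T (wt T) (Fpush G M S T f (scale S (iwt S) u)))"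
    (is "_ = restrict ?h _")
  unfolding FG_push_def
proof (rule the_equality)
  have S: "gset S" and T: "gset T" using f by (auto simp: gmap_def)
  note avg_in = linear_maps_closed[OF avg_linear]
  have hF: "?h \<in> linear_maps k (FM S) (FM T)"
    by (rule linear_maps_comp[OF scale_linear[OF S iwt_in[OF S]]
          linear_maps_comp[OF Fpush_linear[OF f] scale_linear[OF T wt_in[OF T]]]])
  have hX: "?h \<in> linear_maps k (FX S) (FX T)"
    by (intro linear_maps_FX_cod[OF linear_maps_FX_dom[OF hF]] scale_FX(1)[OF T] Fpush_FX[OF f] scale_FX(2)[OF S])
  have h: "restrict ?h (carrier (FX S)) \<in> linear_maps k (FX S) (FX T)"
    by (rule linear_maps_cong[OF hX module_FX[OF S]]) simp
  have ga: "gamma G M S x l \<in> carrier (FX S)" if "x \<in> pts S" "l \<in> carrier (cf S x)" for x l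
    using beta_FX[OF S gen_in[OF S that]] beta_gen[OF S that] by simp
  have val: "?h (gamma G M S x l) = gamma G M T (f x) (coef_push G M S T f x l)"
    if x: "x \<in> pts S" and l: "l \<in> carrier (cf S x)" for x l
  proof -
    let ?u = "gen G M S l x"
    have u: "?u \<in> carrier (FM S)" by (rule gen_in[OF S x l])
    \<comment> \<open>Writing \<gamma>_x(l) as w e (lx), the factor w^-1 in \<open>?h\<close> leaves
      e (lx), which the induced map takes to e of the image of lx.\<close>
    have "gamma G M S x l = scale S (wt S) (avg S ?u)"
      using beta_gen[OF S x l] beta_eq_avg[OF S u] scale_avg[OF S u] by simp
    then have "?h (gamma G M S x l) = scale T (wt T) (Fpush G M S T f (avg S ?u))"
      using scale_wt_iwt(2)[OF S avg_in[OF S u]] by simp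
    also have "\<dots> = scale T (wt T) (avg T (Fpush G M S T f ?u))"
      unfolding Fpush_avg[OF f u] ..
    also have "\<dots> = beta G M T (gen G M T (coef_push G M S T f x l) (f x))"
      using scale_avg[OF T Fpush_in[OF f u]] beta_eq_avg[OF T Fpush_in[OF f u]] Fpush_gen[OF f x l] by simp
    also have "\<dots> = gamma G M T (f x) (coef_push G M S T f x l)"
      by (rule beta_gen[OF T gmap_in[OF f x] coef_push_in[OF f x l]])
    finally show ?thesis .
  qed
  show "restrict ?h (carrier (FX S)) \<in> extensional (carrier (FX S)) \<and>
      restrict ?h (carrier (FX S)) \<in> linear_maps k (FX S) (FX T) \<and>
      (\<forall>x\<in>pts S. \<forall>l\<in>carrier (cf S x).
        restrict ?h (carrier (FX S)) (gamma G M S x l) = gamma G M T (f x) (coef_push G M S T f x l))"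
    using h val ga by simp
  fix h' assume h': "h' \<in> extensional (carrier (FX S)) \<and> h' \<in> linear_maps k (FX S) (FX T) \<and>
      (\<forall>x\<in>pts S. \<forall>l\<in>carrier (cf S x). h' (gamma G M S x l) = gamma G M T (f x) (coef_push G M S T f x l))"
  have betaX: "beta G M S \<in> linear_maps k (FM S) (FX S)"
    by (rule linear_maps_FX_cod[OF beta_linear[OF S] beta_FX[OF S]])
  show "h' = restrict ?h (carrier (FX S))"
  proof (rule extensionalityI[of _ "carrier (FX S)"])
    fix u assume u: "u \<in> carrier (FX S)"
    \<comment> \<open>A preimage of \<open>u\<close> under \<beta> = e w: w cancels, and e fixes
      \<open>u\<close>. It then suffices to compare \<open>h'\<close> and \<open>?h\<close> after
      composing with \<beta>, that is, on the \<gamma>_x(l).\<close>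
    let ?v = "scale S (iwt S) u"
    have v: "?v \<in> carrier (FM S)" using scale_in[OF S iwt_in[OF S] FX_FM[OF u]] .
    have bv: "beta G M S ?v = u"
      unfolding beta_eq_avg[OF S v] scale_wt_iwt(1)[OF S FX_FM[OF u]] by (rule avg_fixed[OF S u])
    have "h' (beta G M S ?v) = ?h (beta G M S ?v)"
    proof (rule FM_linear_eq[OF S module_FX[OF T] linear_maps_comp[OF betaX] linear_maps_comp[OF betaX hX] _ v])
      show "h' \<in> linear_maps k (FX S) (FX T)" using h' by blast
      show "h' (beta G M S (gen G M S l x)) = ?h (beta G M S (gen G M S l x))"
        if "x \<in> pts S" "l \<in> carrier (cf S x)" for x l
        using h' that val beta_gen[OF S that] by simp
    qed
    then show "h' u = restrict ?h (carrier (FX S)) u" using u bv by simp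
  qed (use h' in auto)
qed

text \<open>Since \<alpha> is w on fixed elements, it cancels the w^-1 of the conjugated map. This
  makes \<alpha> natural between the two functorialities.\<close>

lemma FG_push_alpha:
  assumes f: "gmap S T f" and u: "u \<in> carrier (FX S)"
  shows "FG_push G k M S T f (alpha G M S u) = alpha G M T (Fbar_push G M S T f u)"
proof -
  have S: "gset S" and T: "gset T" using f by (auto simp: gmap_def)
  show ?thesis
    using u scale_FX(1)[OF S u] Fpush_FX[OF f u] scale_wt_iwt(2)[OF S FX_FM[OF u]]
    by (simp add: FG_push_eq[OF f] alpha_eq_scale[OF S u] alpha_eq_scale[OF T] Fbar_push_def)
qed

end

section \<open>The topological groups\<close>

text \<open>Along a homeomorphism the target carries the identification topology, so the criterion
  for quotients applies. It transports the group structure from \<open>FFhat_top\<close> to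
  \<open>FFG_top\<close>.\<close>

lemma k_topological_group_homeomorphic:
  assumes inf: "infinite (UNIV :: 'z set)"
    and A: "k_topological_group TYPE('z) A T" and B: "group B"
    and f: "f \<in> iso A B" "homeomorphic_map T U f"
  shows "k_topological_group TYPE('z) B U"
proof -
  have q: "quotient_map T U f" using f(2) by (simp add: homeomorphic_map_def)
  have "openin U V \<longleftrightarrow> V \<subseteq> f ` topspace T \<and> openin T {x \<in> topspace T. f x \<in> V}" for V
    using q openin_subset[of U V] unfolding quotient_map_def by blast
  then have "U = identification_topology T f"
    unfolding topology_eq openin_identification_topology by blast
  then show ?thesis
    using k_topological_group_quotient[OF inf A B] f(1) by (simp add: iso_def bij_betw_def)
qed

lemma simplicial_map_comp_class:
  assumes "simplicial_set K" "simplicial_set L" "simplicial_set N" "simplicial_map K L f" "simplicial_map L N g"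
    "x \<in> level K n" "t \<in> standard_simplex n"
  shows "real_map N g (real_map L f (real_class K (n, x, t))) = real_class N (n, g n (f n x), t)"
  using assms real_map_class[of K L f x n t] real_map_class[of L N g "f n x" n t]
  by (auto simp: simplicial_map_def Pi_iff)

text \<open>The degreewise inverses automatically commute with the operators, so they realize to a
  continuous inverse.\<close>

lemma homeomorphic_map_real_map:
  assumes K: "simplicial_set K" and L: "simplicial_set L"
    and f: "simplicial_map K L f" and bij: "\<And>n. bij_betw (f n) (level K n) (level L n)"
  shows "homeomorphic_map (realization K) (realization L) (real_map L f)"
proof -
  interpret K: simplicial_set K by fact
  interpret L: simplicial_set L by fact
  define g where "g n = inv_into (level K n) (f n)" for n
  have gf: "g n (f n x) = x" if "x \<in> level K n" for n x
    using bij_betw_inv_into_left[OF bij that] by (simp add: g_def)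
  have fg: "f n (g n y) = y" "g n y \<in> level K n" if "y \<in> level L n" for n y
    using bij_betw_inv_into_right[OF bij that] bij_betwE[OF bij_betw_inv_into[OF bij]] that by (auto simp: g_def)
  have g: "simplicial_map L K g"
    unfolding simplicial_map_def
  proof (intro conjI allI ballI funcsetI)
    fix m n \<theta> y assume \<theta>: "\<theta> \<in> simplex_maps m n" and y: "y \<in> level L n"
    have "g m (sop L m n \<theta> (f n (g n y))) = g m (f m (sop K m n \<theta> (g n y)))"
      using f \<theta> fg(2)[OF y] by (simp add: simplicial_map_def)
    then show "g m (sop L m n \<theta> y) = sop K m n \<theta> (g n y)"
      using fg[OF y] gf[OF K.sop_closed[OF \<theta> fg(2)[OF y]]] by simp
  qed (rule fg)
  have "homeomorphic_maps (realization K) (realization L) (real_map L f) (real_map K g)"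
    unfolding homeomorphic_maps_def
  proof (intro conjI ballI continuous_map_real_map K L f g)
    fix c assume "c \<in> topspace (realization K)"
    then obtain n x t where c: "c = real_class K (n, x, t)" "x \<in> level K n" "t \<in> standard_simplex n"
      by (rule K.realization_cases)
    then show "real_map K g (real_map L f c) = c"
      using simplicial_map_comp_class[OF K L K f g c(2,3)] gf by simp
  next
    fix c assume "c \<in> topspace (realization L)"
    then obtain n x t where c: "c = real_class L (n, x, t)" "x \<in> level L n" "t \<in> standard_simplex n"
      by (rule L.realization_cases)
    then show "real_map L f (real_map K g c) = c"
      using simplicial_map_comp_class[OF L K L g f c(2,3)] fg by simp
  qed
  then show ?thesis using homeomorphic_map_maps by blast
qed

text \<open>Any two classes have representatives over one point by \<open>real_group_cases2\<close>,
  so additivity over a fixed \<open>t\<close> suffices.\<close>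

lemma (in simplicial_abelian_group) real_group_hom:
  fixes h :: "'x cell set \<Rightarrow> 'y" and B :: "('y, 'c) monoid_scheme"
  assumes "\<And>a. a \<in> carrier R \<Longrightarrow> h a \<in> carrier B"
    and add: "\<And>n x y t. x \<in> carrier (level K n) \<Longrightarrow> y \<in> carrier (level K n) \<Longrightarrow> t \<in> standard_simplex n \<Longrightarrow>
      h (cls n (x \<oplus>\<^bsub>level K n\<^esub> y) t) = h (cls n x t) \<otimes>\<^bsub>B\<^esub> h (cls n y t)"
  shows "h \<in> hom R B"
proof (rule homI)
  fix a b assume a: "a \<in> carrier R" and b: "b \<in> carrier R"
  obtain n x t where 1: "a = cls n x t" "x \<in> carrier (level K n)" "t \<in> standard_simplex n"
    using a real_group_cases by metis
  obtain m \<theta> y s where 2: "\<theta> \<in> simplex_maps m n" "y \<in> carrier (level K m)" "s \<in> standard_simplex m"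
    "simplex_push m \<theta> s = t" "b = cls m y s" "cls n x t = cls m (sop K m n \<theta> x) s"
    using real_group_cases2[OF b 1(2,3)] .
  show "h (a \<otimes>\<^bsub>R\<^esub> b) = h a \<otimes>\<^bsub>B\<^esub> h b"
    using add[OF sop_in[OF 2(1) 1(2)] 2(2,3)] real_mult_cls[OF sop_in[OF 2(1) 1(2)] 2(2,3)] 1 2 by simp
qed (rule assms)

lemma topological_group_iso_realization:
  fixes K :: "(('k, 'x) module, 'x) simplicial" and L :: "(('k, 'y) module, 'y) simplicial"
    and h :: "(nat \<Rightarrow> real) \<Rightarrow> 'z"
  assumes h: "inj h" and inf: "infinite (UNIV :: 'z set)"
    and K: "simplicial_abelian_group K" and L: "simplicial_abelian_group L"
    and f: "simplicial_map (underlying K) (underlying L) f"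
    and bij: "\<And>n. bij_betw (f n) (carrier (level K n)) (carrier (level L n))"
    and add: "\<And>n x y. x \<in> carrier (level K n) \<Longrightarrow> y \<in> carrier (level K n) \<Longrightarrow>
      f n (x \<oplus>\<^bsub>level K n\<^esub> y) = f n x \<oplus>\<^bsub>level L n\<^esub> f n y"
  shows "topological_group_iso TYPE('z) (real_group K) (real_top K) (real_group L) (real_top L)
    (real_map (underlying L) f)"
proof -
  interpret K: simplicial_abelian_group K by fact
  interpret L: simplicial_abelian_group L by fact
  let ?F = "real_map (underlying L) f"
  have hm: "homeomorphic_map (real_top K) (real_top L) ?F"
    unfolding real_top_def using f bij by (intro homeomorphic_map_real_map K.simplicial L.simplicial) auto
  then have b: "bij_betw ?F (carrier (real_group K)) (carrier (real_group L))"
    unfolding K.carrier_real_group L.carrier_real_group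
    by (simp add: homeomorphic_map_def quotient_map_def bij_betw_def)
  have "?F \<in> hom (real_group K) (real_group L)"
  proof (rule K.real_group_hom)
    show "?F a \<in> carrier (real_group L)" if "a \<in> carrier (real_group K)" for a
      using b that bij_betwE by blast
    fix n x y t assume xy: "x \<in> carrier (level K n)" "y \<in> carrier (level K n)" and t: "t \<in> standard_simplex n"
    have c: "?F (K.cls n z t) = L.cls n (f n z) t" if "z \<in> carrier (level K n)" for z
      using real_map_class[OF K.simplicial L.simplicial f _ t] that by simp
    have "f n x \<in> carrier (level L n)" "f n y \<in> carrier (level L n)"
      using xy bij_betwE[OF bij] by auto
    then show "?F (K.cls n (x \<oplus>\<^bsub>level K n\<^esub> y) t) = ?F (K.cls n x t) \<otimes>\<^bsub>real_group L\<^esub> ?F (K.cls n y t)"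
      using xy t by (simp add: c K.add_in add L.real_mult_cls)
  qed
  then show ?thesis
    using hm b K.k_topological_group_realization[OF h inf] L.k_topological_group_realization[OF h inf]
    by (simp add: topological_group_iso_def iso_def)
qed

section \<open>Simplicial pointed G-sets and the three simplicial groups\<close>

context coefficients
begin

text \<open>The third clause asks for equal functions and not only equal values on points:
  \<open>sop\<close> occurs as an argument of \<open>Fpush\<close> and \<open>FG_push\<close>, and
  the clause is applied there by rewriting.\<close>

definition simplicial_gset :: "(('g, 'x) pointed_gset, 'x) simplicial \<Rightarrow> bool" where
  "simplicial_gset K \<longleftrightarrow> (\<forall>n. gset (level K n)) \<and>
     (\<forall>m n. \<forall>\<theta>\<in>simplex_maps m n. gmap (level K n) (level K m) (sop K m n \<theta>)) \<and>
     (\<forall>m n \<theta> \<psi>. (\<forall>i\<le>m. \<theta> i = \<psi> i) \<longrightarrow> sop K m n \<theta> = sop K m n \<psi>) \<and>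
     (\<forall>n. \<forall>x\<in>pts (level K n). sop K n n (\<lambda>i. i) x = x) \<and>
     (\<forall>l m n. \<forall>\<psi>\<in>simplex_maps l m. \<forall>\<theta>\<in>simplex_maps m n. \<forall>x\<in>pts (level K n).
        sop K l m \<psi> (sop K m n \<theta> x) = sop K l n (\<lambda>i. \<theta> (\<psi> i)) x)"

context
  fixes K :: "(('g, 'x) pointed_gset, 'x) simplicial"
  assumes K: "simplicial_gset K"
begin

lemma level_gset: "gset (level K n)"
  and sop_gmap: "\<theta> \<in> simplex_maps m n \<Longrightarrow> gmap (level K n) (level K m) (sop K m n \<theta>)"
  and sop_fun_cong: "(\<And>i. i \<le> m \<Longrightarrow> \<theta> i = \<psi> i) \<Longrightarrow> sop K m n \<theta> = sop K m n \<psi>"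
  using K unfolding simplicial_gset_def by blast+

lemma Fpush_sop_id:
  assumes u: "u \<in> carrier (FM (level K n))"
  shows "Fpush G M (level K n) (level K n) (sop K n n (\<lambda>i. i)) u = u"
proof -
  have "Fpush G M (level K n) (level K n) (sop K n n (\<lambda>i. i)) u = Fpush G M (level K n) (level K n) (\<lambda>x. x) u"
    using K by (intro Fpush_cong[OF sop_gmap[OF simplex_maps_id] u]) (auto simp: simplicial_gset_def)
  then show ?thesis using Fpush_id[OF level_gset u] by simp
qed

lemma Fpush_sop_comp:
  assumes "\<psi> \<in> simplex_maps l m" "\<theta> \<in> simplex_maps m n" "u \<in> carrier (FM (level K n))"
  shows "Fpush G M (level K m) (level K l) (sop K l m \<psi>) (Fpush G M (level K n) (level K m) (sop K m n \<theta>) u) =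
    Fpush G M (level K n) (level K l) (sop K l n (\<lambda>i. \<theta> (\<psi> i))) u"
  using K assms by (intro Fpush_comp sop_gmap) (auto simp: simplicial_gset_def)

lemma simplicial_abelian_group_sF: "simplicial_abelian_group (sF G M K)"
proof (rule simplicial_abelian_group.intro)
  show "abelian_group (level (sF G M K) n)" for n
    using module.axioms(2)[OF module_FM[OF level_gset]] by (simp add: sF_def)
  show "simplicial_set (underlying (sF G M K))"
  proof
    fix \<theta> \<psi> :: "nat \<Rightarrow> nat" and m n u assume "\<And>i. i \<le> m \<Longrightarrow> \<theta> i = \<psi> i"
    then show "sop (underlying (sF G M K)) m n \<theta> u = sop (underlying (sF G M K)) m n \<psi> u"
      using sop_fun_cong[of m \<theta> \<psi> n] by (simp add: sF_def underlying_def)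
  qed (simp_all add: sF_def underlying_def Fpush_in sop_gmap Fpush_sop_id Fpush_sop_comp)
  show "sop (sF G M K) m n \<theta> (x \<oplus>\<^bsub>level (sF G M K) n\<^esub> y) =
      sop (sF G M K) m n \<theta> x \<oplus>\<^bsub>level (sF G M K) m\<^esub> sop (sF G M K) m n \<theta> y"
    if "\<theta> \<in> simplex_maps m n" "x \<in> carrier (level (sF G M K) n)" "y \<in> carrier (level (sF G M K) n)" for \<theta> m n x y
    using linear_maps_add[OF Fpush_linear[OF sop_gmap[OF that(1)]]] that(2,3) by (simp add: sF_def del: FM_simps)
qed

lemma simplicial_abelian_group_sFbar: "simplicial_abelian_group (sFbar G M K)"
proof (rule simplicial_abelian_group.intro)
  interpret FX: module k "FX (level K n)" for n by (rule module_FX[OF level_gset])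
  show "abelian_group (level (sFbar G M K) n)" for n
    using module.axioms(2)[OF module_FX[OF level_gset]] by (simp add: sFbar_def)
  show "simplicial_set (underlying (sFbar G M K))"
  proof
    fix \<theta> \<psi> :: "nat \<Rightarrow> nat" and m n u assume "\<And>i. i \<le> m \<Longrightarrow> \<theta> i = \<psi> i"
    then show "sop (underlying (sFbar G M K)) m n \<theta> u = sop (underlying (sFbar G M K)) m n \<psi> u"
      using sop_fun_cong[of m \<theta> \<psi> n] by (simp add: sFbar_def underlying_def)
  qed (simp_all add: sFbar_def underlying_def Fbar_push_def Fpush_FX FX_FM sop_gmap Fpush_sop_id Fpush_sop_comp)
  show "sop (sFbar G M K) m n \<theta> (x \<oplus>\<^bsub>level (sFbar G M K) n\<^esub> y) =
      sop (sFbar G M K) m n \<theta> x \<oplus>\<^bsub>level (sFbar G M K) m\<^esub> sop (sFbar G M K) m n \<theta> y"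
    if "\<theta> \<in> simplex_maps m n" "x \<in> carrier (level (sFbar G M K) n)" "y \<in> carrier (level (sFbar G M K) n)" for \<theta> m n x y
    using linear_maps_add[OF linear_maps_FX_dom[OF Fpush_linear[OF sop_gmap[OF that(1)]]]] that(2,3)
    by (simp add: sFbar_def Fbar_push_def FX_simps[symmetric] del: FM_simps)
qed

lemma simplicial_map_incl:
  "simplicial_map (underlying (sFbar G M K)) (underlying (sF G M K)) (\<lambda>n. incl G M (level K n))"
  unfolding simplicial_map_def
  by (auto simp: sF_def sFbar_def underlying_def incl_def FX_FM Fbar_push_def Fpush_FX sop_gmap)

end

end

context coefficients_invertible
begin

context
  fixes K :: "(('g, 'x) pointed_gset, 'x) simplicial"
  assumes K: "simplicial_gset K"
begin

text \<open>e commutes with the operators by \<open>Fpush_avg\<close>. Its realization goes from |F|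
  back to the realization of the fixed part, which part (b) needs for openness.\<close>

lemma simplicial_map_avg:
  "simplicial_map (underlying (sF G M K)) (underlying (sFbar G M K)) (\<lambda>n. avg (level K n))"
  unfolding simplicial_map_def
  by (auto simp: sF_def sFbar_def underlying_def Fbar_push_def avg_FX level_gset[OF K]
      Fpush_avg[OF sop_gmap[OF K]])

lemma FG_push_sop:
  assumes \<theta>: "\<theta> \<in> simplex_maps m n" and u: "u \<in> carrier (FX (level K n))"
  shows "FG_push G k M (level K n) (level K m) (sop K m n \<theta>) u =
    scale (level K m) (wt (level K m)) (Fpush G M (level K n) (level K m) (sop K m n \<theta>)
      (scale (level K n) (iwt (level K n)) u))"
  using FG_push_eq[OF sop_gmap[OF K \<theta>]] u by simp

lemma simplicial_abelian_group_sFG: "simplicial_abelian_group (sFG G k M K)"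
proof (rule simplicial_abelian_group.intro)
  note gs = level_gset[OF K] and gm = sop_gmap[OF K]
  show "abelian_group (level (sFG G k M K) n)" for n
    using module.axioms(2)[OF module_FX[OF gs]] by (simp add: sFG_def)
  show "simplicial_set (underlying (sFG G k M K))"
  proof
    fix \<theta> \<psi> :: "nat \<Rightarrow> nat" and m n u assume "\<And>i. i \<le> m \<Longrightarrow> \<theta> i = \<psi> i"
    then show "sop (underlying (sFG G k M K)) m n \<theta> u = sop (underlying (sFG G k M K)) m n \<psi> u"
      using sop_fun_cong[OF K, of m \<theta> \<psi> n] by (simp add: sFG_def underlying_def)
  next
    fix \<theta> m n u assume "\<theta> \<in> simplex_maps m n" "u \<in> level (underlying (sFG G k M K)) n"
    then show "sop (underlying (sFG G k M K)) m n \<theta> u \<in> level (underlying (sFG G k M K)) m"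
      by (simp add: sFG_def underlying_def FG_push_sop scale_FX gs Fpush_FX gm)
  next
    fix u n assume "u \<in> level (underlying (sFG G k M K)) n"
    then have u: "u \<in> carrier (FX (level K n))" by (simp add: sFG_def underlying_def)
    show "sop (underlying (sFG G k M K)) n n (\<lambda>i. i) u = u"
      using u FX_FM[OF u] FX_FM[OF scale_FX(2)[OF gs u]]
      by (simp add: sFG_def underlying_def FG_push_sop simplex_maps_id Fpush_sop_id[OF K] scale_wt_iwt gs)
  next
    fix \<psi> \<theta> l m n u assume \<psi>: "\<psi> \<in> simplex_maps l m" and \<theta>: "\<theta> \<in> simplex_maps m n"
      and "u \<in> level (underlying (sFG G k M K)) n"
    then have u: "u \<in> carrier (FX (level K n))" by (simp add: sFG_def underlying_def)
    \<comment> \<open>In the composite of two conjugated operators the inner w and w^-1 meet at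
      \<open>?v\<close> and cancel.\<close>
    let ?v = "Fpush G M (level K n) (level K m) (sop K m n \<theta>) (scale (level K n) (iwt (level K n)) u)"
    have v: "?v \<in> carrier (FX (level K m))" by (intro Fpush_FX[OF gm[OF \<theta>]] scale_FX gs u)
    show "sop (underlying (sFG G k M K)) l m \<psi> (sop (underlying (sFG G k M K)) m n \<theta> u) =
       sop (underlying (sFG G k M K)) l n (\<lambda>i. \<theta> (\<psi> i)) u"
      using u v \<psi> \<theta> scale_FX(1)[OF gs v] FX_FM[OF scale_FX(2)[OF gs u]] FX_FM[OF v]
      by (simp add: sFG_def underlying_def FG_push_sop simplex_maps_comp scale_wt_iwt gs Fpush_sop_comp[OF K])
  qed
  show "sop (sFG G k M K) m n \<theta> (x \<oplus>\<^bsub>level (sFG G k M K) n\<^esub> y) =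
      sop (sFG G k M K) m n \<theta> x \<oplus>\<^bsub>level (sFG G k M K) m\<^esub> sop (sFG G k M K) m n \<theta> y"
    if \<theta>: "\<theta> \<in> simplex_maps m n" and "x \<in> carrier (level (sFG G k M K) n)" "y \<in> carrier (level (sFG G k M K) n)" for \<theta> m n x y
  proof -
    interpret FX: module k "FX (level K n)" by (rule module_FX[OF gs])
    have xy: "x \<in> carrier (FX (level K n))" "y \<in> carrier (FX (level K n))" using that by (auto simp: sFG_def)
    have "(\<lambda>u. scale (level K m) (wt (level K m)) (Fpush G M (level K n) (level K m) (sop K m n \<theta>)
      (scale (level K n) (iwt (level K n)) u))) \<in> linear_maps k (FX (level K n)) (FM (level K m))"
      by (intro linear_maps_FX_dom linear_maps_comp[OF scale_linear linear_maps_comp[OF Fpush_linear scale_linear]]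
          gs gm \<theta> wt_in iwt_in)
    from linear_maps_add[OF this xy] show ?thesis
      using xy FX.M.a_closed[OF xy] by (simp add: sFG_def FG_push_sop[OF \<theta>] FX_simps del: FM_simps)
  qed
qed

lemma topological_group_iso_real_alpha:
  fixes h :: "(nat \<Rightarrow> real) \<Rightarrow> 'z"
  assumes h: "inj h" and inf: "infinite (UNIV :: 'z set)"
  shows "topological_group_iso TYPE('z) (real_group (sFbar G M K)) (real_top (sFbar G M K))
    (real_group (sFG G k M K)) (real_top (sFG G k M K))
    (real_map (underlying (sFG G k M K)) (\<lambda>n. alpha G M (level K n)))"
proof (rule topological_group_iso_realization[OF h inf simplicial_abelian_group_sFbar[OF K] simplicial_abelian_group_sFG])
  note gs = level_gset[OF K] and gm = sop_gmap[OF K]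
  show "simplicial_map (underlying (sFbar G M K)) (underlying (sFG G k M K)) (\<lambda>n. alpha G M (level K n))"
    unfolding simplicial_map_def
    using linear_maps_closed[OF alpha_linear[OF gs]] FG_push_alpha[OF gm]
    by (auto simp: sFbar_def sFG_def underlying_def)
  show "bij_betw (alpha G M (level K n)) (carrier (level (sFbar G M K) n)) (carrier (level (sFG G k M K) n))" for n
    using alpha_bij(1)[OF gs] by (simp add: sFbar_def sFG_def)
  show "alpha G M (level K n) (x \<oplus>\<^bsub>level (sFbar G M K) n\<^esub> y) =
      alpha G M (level K n) x \<oplus>\<^bsub>level (sFG G k M K) n\<^esub> alpha G M (level K n) y"
    if "x \<in> carrier (level (sFbar G M K) n)" "y \<in> carrier (level (sFbar G M K) n)" for n x y
    using linear_maps_add[OF alpha_linear[OF gs]] that by (simp add: sFbar_def sFG_def)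
qed

end

end

section \<open>The singular simplicial set and the identification topologies\<close>

locale coefficients_gspace = coefficients_invertible G k M
  for G :: "('g, 'a) monoid_scheme" (structure) and k :: "('k, 'b) ring_scheme"
    and M :: "('g, 'k, 'm) coefficients" +
  fixes X :: "('g, 'x) pointed_gspace"
  assumes gspace: "is_pointed_gspace G X"
begin

abbreviation D where "D \<equiv> discrete_gset X"
abbreviation SX where "SX \<equiv> Sing X"
abbreviation SXn where "SXn n \<equiv> level (Sing X) n"

lemma gspace_act:
  "g \<in> carrier G \<Longrightarrow> x \<in> topspace (gtop X) \<Longrightarrow> act X g x \<in> topspace (gtop X)"
  "x \<in> topspace (gtop X) \<Longrightarrow> act X \<one> x = x"
  "g \<in> carrier G \<Longrightarrow> h \<in> carrier G \<Longrightarrow> x \<in> topspace (gtop X) \<Longrightarrow> act X (g \<otimes> h) x = act X g (act X h x)"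
proof -
  interpret A: group_action G "topspace (gtop X)" "act X" using gspace by (simp add: is_pointed_gspace_def)
  show "g \<in> carrier G \<Longrightarrow> x \<in> topspace (gtop X) \<Longrightarrow> act X g x \<in> topspace (gtop X)"
    using A.element_image by blast
  show "x \<in> topspace (gtop X) \<Longrightarrow> act X \<one> x = x"
    using A.id_eq_one by (metis restrict_apply')
  show "g \<in> carrier G \<Longrightarrow> h \<in> carrier G \<Longrightarrow> x \<in> topspace (gtop X) \<Longrightarrow> act X (g \<otimes> h) x = act X g (act X h x)"
    by (rule A.composition_rule)
qed

lemma gspace_bpt: "bpt X \<in> topspace (gtop X)" "g \<in> carrier G \<Longrightarrow> act X g (bpt X) = bpt X"
  using gspace by (auto simp: is_pointed_gspace_def)

lemma continuous_act:
  assumes "g \<in> carrier G"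
  shows "continuous_map (gtop X) (gtop X) (act X g)"
proof -
  have "continuous_map (gtop X) (prod_topology (discrete_topology (carrier G)) (gtop X)) (\<lambda>x. (g, x))"
    using assms by (simp add: continuous_map_pairwise o_def)
  then have "continuous_map (gtop X) (gtop X) ((\<lambda>(g, x). act X g x) \<circ> (\<lambda>x. (g, x)))"
    using gspace unfolding is_pointed_gspace_def by (meson continuous_map_compose)
  then show ?thesis by (simp add: o_def)
qed

lemma gset_D: "gset D"
  using gspace_act gspace_bpt by (simp add: gset_def discrete_gset_def)

lemma singular_simplex_value:
  "singular_simplex n (gtop X) \<sigma> \<Longrightarrow> t \<in> standard_simplex n \<Longrightarrow> \<sigma> t \<in> topspace (gtop X)"
  using continuous_map_image_subset_topspace by (fastforce simp: singular_simplex_def)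

lemma SXn_simps:
  "pts (SXn n) = singular_simplex_set n (gtop X)"
  "gact (SXn n) g = (\<lambda>\<sigma>\<in>singular_simplex_set n (gtop X). \<lambda>t\<in>standard_simplex n. act X g (\<sigma> t))"
  "base (SXn n) = (\<lambda>t\<in>standard_simplex n. bpt X)"
  "sop SX m n \<theta> = (\<lambda>\<sigma>\<in>singular_simplex_set n (gtop X). \<lambda>t\<in>standard_simplex m. \<sigma> (simplex_push m \<theta> t))"
  by (simp_all add: Sing_def)

lemma singular_simplex_restrict:
  "continuous_map (simplex_top n) (gtop X) f \<Longrightarrow> singular_simplex n (gtop X) (\<lambda>t\<in>standard_simplex n. f t)"
  by (auto simp: singular_simplex_def elim: continuous_map_eq)

lemma singular_simplex_act:
  assumes "g \<in> carrier G" "singular_simplex n (gtop X) \<sigma>"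
  shows "singular_simplex n (gtop X) (\<lambda>t\<in>standard_simplex n. act X g (\<sigma> t))"
  using assms continuous_map_compose[OF _ continuous_act[OF assms(1)], of "simplex_top n" \<sigma>]
  by (intro singular_simplex_restrict) (simp add: singular_simplex_def o_def)

lemma gset_SXn: "gset (SXn n)"
  unfolding gset_def
proof (intro conjI ballI)
  show "gact (SXn n) g \<sigma> \<in> pts (SXn n)" if "g \<in> carrier G" "\<sigma> \<in> pts (SXn n)" for g \<sigma>
    using that singular_simplex_act by (simp add: SXn_simps)
  show "gact (SXn n) \<one> \<sigma> = \<sigma>" if "\<sigma> \<in> pts (SXn n)" for \<sigma>
    using that gspace_act(2)[OF singular_simplex_value]
    by (auto simp: SXn_simps singular_simplex_def intro!: extensionalityI[of _ "standard_simplex n"])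
  show "gact (SXn n) (g \<otimes> h) \<sigma> = gact (SXn n) g (gact (SXn n) h \<sigma>)"
    if "g \<in> carrier G" "h \<in> carrier G" "\<sigma> \<in> pts (SXn n)" for g h \<sigma>
    using that singular_simplex_act gspace_act(3)[OF _ _ singular_simplex_value]
    by (auto simp: SXn_simps intro!: restrict_ext)
  show "base (SXn n) \<in> pts (SXn n)"
    using gspace_bpt(1) by (simp add: SXn_simps singular_simplex_restrict)
  show "gact (SXn n) g (base (SXn n)) = base (SXn n)" if "g \<in> carrier G" for g
  proof -
    have "singular_simplex n (gtop X) (\<lambda>t\<in>standard_simplex n. bpt X)"
      using gspace_bpt(1) by (simp add: singular_simplex_restrict)
    then show ?thesis using that gspace_bpt(2) by (auto simp: SXn_simps intro!: restrict_ext)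
  qed
qed

lemma singular_simplex_push:
  assumes "\<theta> \<in> simplex_maps m n" "singular_simplex n (gtop X) \<sigma>"
  shows "singular_simplex m (gtop X) (\<lambda>t\<in>standard_simplex m. \<sigma> (simplex_push m \<theta> t))"
  using assms continuous_map_compose[OF continuous_map_simplex_push[OF assms(1)], of "gtop X" \<sigma>]
  by (intro singular_simplex_restrict) (simp add: singular_simplex_def o_def)

lemma simplicial_gset_SX: "simplicial_gset SX"
  unfolding simplicial_gset_def
proof (intro conjI allI ballI impI)
  show "gset (SXn n)" for n by (rule gset_SXn)
  show "gmap (SXn n) (SXn m) (sop SX m n \<theta>)" if "\<theta> \<in> simplex_maps m n" for \<theta> m n
  proof -
    have "singular_simplex n (gtop X) (\<lambda>t\<in>standard_simplex n. bpt X)"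
      using gspace_bpt(1) by (simp add: singular_simplex_restrict)
    then show ?thesis
      using that singular_simplex_act singular_simplex_push simplex_push_in[OF that]
      by (auto simp: gmap_def gset_SXn SXn_simps intro!: restrict_ext)
  qed
  show "sop SX m n \<theta> = sop SX m n \<psi>" if "\<forall>i\<le>m. \<theta> i = \<psi> i" for \<theta> \<psi> m n
    using simplex_push_cong[of m \<theta> \<psi>] that by (simp add: SXn_simps)
  show "sop SX n n (\<lambda>i. i) \<sigma> = \<sigma>" if "\<sigma> \<in> pts (SXn n)" for n \<sigma>
    using that simplex_push_id[of n]
    by (auto simp: SXn_simps singular_simplex_def standard_simplex_iff intro!: extensionalityI[of _ "standard_simplex n"])
  show "sop SX l m \<psi> (sop SX m n \<theta> \<sigma>) = sop SX l n (\<lambda>i. \<theta> (\<psi> i)) \<sigma>"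
    if "\<psi> \<in> simplex_maps l m" "\<theta> \<in> simplex_maps m n" "\<sigma> \<in> pts (SXn n)" for l m n \<psi> \<theta> \<sigma>
    using that singular_simplex_push simplex_push_in[OF that(1)] simplex_push_comp[OF that(1)]
    by (auto simp: SXn_simps intro!: restrict_ext)
qed

lemma gmap_eval:
  assumes "t \<in> standard_simplex n"
  shows "gmap (SXn n) D (\<lambda>\<sigma>. \<sigma> t)"
  using assms gset_SXn gset_D singular_simplex_value
  by (auto simp: gmap_def SXn_simps discrete_gset_def)

sublocale F: simplicial_abelian_group "sF G M SX"
  by (rule simplicial_abelian_group_sF[OF simplicial_gset_SX])

sublocale Fbar: simplicial_abelian_group "sFbar G M SX"
  by (rule simplicial_abelian_group_sFbar[OF simplicial_gset_SX])

lemma sF_level: "level (sF G M SX) n = FM (SXn n)"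
  and sFbar_level: "level (sFbar G M SX) n = FX (SXn n)"
  by (simp_all add: sF_def sFbar_def)

text \<open>Evaluation at a pushed point is evaluation at the original point after the simplicial
  operator. So representatives with a common refinement have the same value, and
  \<open>the_elem\<close> is applied to a singleton.\<close>

lemma pi_map_class:
  assumes u: "u \<in> carrier (FM (SXn n))" and t: "t \<in> standard_simplex n"
  shows "pi_map G M X (F.cls n u t) = Fpush G M (SXn n) D (\<lambda>\<sigma>. \<sigma> t) u"
proof -
  let ?e = "\<lambda>(n, u, t). Fpush G M (SXn n) D (\<lambda>\<sigma>. \<sigma> t) u"
  have c0: "(n, u, t) \<in> F.U.cells" using u t by (simp add: F.U.cells_def sF_level)
  have pull: "Fpush G M (SXn n) D (\<lambda>\<sigma>. \<sigma> (simplex_push m \<theta> v)) u =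
      Fpush G M (SXn m) D (\<lambda>\<sigma>. \<sigma> v) (sop (sF G M SX) m n \<theta> u)"
    if \<theta>: "\<theta> \<in> simplex_maps m n" and v: "v \<in> standard_simplex m" and u: "u \<in> carrier (FM (SXn n))"
    for m n \<theta> v u
    unfolding sF_def simplicial.simps
    by (rule Fpush_comp[OF sop_gmap[OF simplicial_gset_SX \<theta>] gmap_eval[OF v] u, symmetric])
      (simp add: SXn_simps v)
  have same: "?e d = ?e (n, u, t)" if d: "d \<in> F.cls n u t" for d
  proof -
    obtain n' u' t' where d': "d = (n', u', t')" by (metis prod.exhaust)
    have "F.U.common_refinement (n, u, t) d" "d \<in> F.U.cells"
      using F.U.real_class_members[OF c0 d] F.U.real_class_eq_iff[OF c0] by metis+
    then obtain m v \<theta> \<theta>' where 1: "v \<in> standard_simplex m" "\<theta> \<in> simplex_maps m n" "\<theta>' \<in> simplex_maps m n'"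
     "simplex_push m \<theta> v = t" "simplex_push m \<theta>' v = t'" "sop (sF G M SX) m n \<theta> u = sop (sF G M SX) m n' \<theta>' u'"
     "u' \<in> carrier (FM (SXn n'))"
      unfolding F.U.common_refinement_def d' F.U.cells_def by (auto simp: sF_level)
    show ?thesis
      using pull[OF 1(2,1) u] pull[OF 1(3,1,7)] 1 by (simp add: d')
  qed
  have "(n, u, t) \<in> F.cls n u t" by (simp add: real_class_def real_rel_def)
  then have "?e ` F.cls n u t = {?e (n, u, t)}" using same by blast
  then show ?thesis by (simp add: pi_map_def)
qed

text \<open>\<open>J\<close> and \<open>E\<close> are the maps |\<iota>| and |e| of the
  overview.\<close>

abbreviation J where "J \<equiv> real_map (underlying (sF G M SX)) (\<lambda>n. incl G M (SXn n))"
abbreviation E where "E \<equiv> real_map (underlying (sFbar G M SX)) (\<lambda>n. avg (SXn n))"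

lemma continuous_J: "continuous_map (real_top (sFbar G M SX)) (real_top (sF G M SX)) J"
  unfolding real_top_def
  by (rule continuous_map_real_map[OF Fbar.simplicial F.simplicial simplicial_map_incl[OF simplicial_gset_SX]])

lemma continuous_E: "continuous_map (real_top (sF G M SX)) (real_top (sFbar G M SX)) E"
  unfolding real_top_def
  by (rule continuous_map_real_map[OF F.simplicial Fbar.simplicial simplicial_map_avg[OF simplicial_gset_SX]])

lemma J_class:
  assumes "u \<in> carrier (FX (SXn n))" "t \<in> standard_simplex n"
  shows "J (Fbar.cls n u t) = F.cls n u t"
  using real_map_class[OF Fbar.simplicial F.simplicial simplicial_map_incl[OF simplicial_gset_SX], of u n t] assms
  by (simp add: sFbar_level incl_def)

lemma E_class:
  assumes "u \<in> carrier (FM (SXn n))" "t \<in> standard_simplex n"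
  shows "E (F.cls n u t) = Fbar.cls n (avg (SXn n) u) t"
  using real_map_class[OF F.simplicial Fbar.simplicial simplicial_map_avg[OF simplicial_gset_SX], of u n t] assms
  by (simp add: sF_level)

lemma pi_hat_class:
  assumes "u \<in> carrier (FX (SXn n))" "t \<in> standard_simplex n"
  shows "pi_hat G M X (Fbar.cls n u t) = Fpush G M (SXn n) D (\<lambda>\<sigma>. \<sigma> t) u"
  unfolding pi_hat_def using J_class[OF assms] pi_map_class[OF FX_FM[OF assms(1)] assms(2)] by simp

lemma pi_hat_in:
  assumes "c \<in> topspace (real_top (sFbar G M SX))"
  shows "pi_hat G M X c \<in> carrier (FX D)"
proof -
  obtain n u t where "c = Fbar.cls n u t" "u \<in> carrier (FX (SXn n))" "t \<in> standard_simplex n"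
    using assms Fbar.real_group_cases unfolding Fbar.carrier_real_group sFbar_level by metis
  then show ?thesis by (simp add: pi_hat_class Fpush_FX[OF gmap_eval])
qed

text \<open>Evaluation at a point is a G-map, so e passes from singular simplices to points of X;
  there \<alpha> e = \<beta>.\<close>

lemma beta_pi_map:
  assumes "c \<in> topspace (real_top (sF G M SX))"
  shows "beta G M D (pi_map G M X c) = alpha G M D (pi_hat G M X (E c))"
proof -
  obtain n u t where c: "c = F.cls n u t" "u \<in> carrier (FM (SXn n))" "t \<in> standard_simplex n"
    using assms F.real_group_cases unfolding F.carrier_real_group sF_level by metis
  then show ?thesis
    using Fpush_avg[OF gmap_eval[OF c(3)] c(2)] alpha_avg[OF gset_D Fpush_in[OF gmap_eval[OF c(3)] c(2)]]
    by (simp add: pi_map_class E_class pi_hat_class avg_FX[OF gset_SXn])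
qed

lemma alpha_pi_hat:
  assumes "c \<in> topspace (real_top (sFbar G M SX))"
  shows "alpha G M D (pi_hat G M X c) = beta G M D (pi_map G M X (J c))"
  using pi_hat_in[OF assms] by (simp add: alpha_def compose_def incl_def pi_hat_def)

lemma pi_hat_hom: "pi_hat G M X \<in> hom (real_group (sFbar G M SX)) (add_monoid (FX D))"
proof (rule Fbar.real_group_hom)
  show "pi_hat G M X c \<in> carrier (add_monoid (FX D))" if "c \<in> carrier (real_group (sFbar G M SX))" for c
    using that pi_hat_in by (simp add: Fbar.carrier_real_group)
  fix n x y t assume "x \<in> carrier (level (sFbar G M SX) n)" "y \<in> carrier (level (sFbar G M SX) n)"
    and t: "t \<in> standard_simplex n"
  then have xy: "x \<in> carrier (FX (SXn n))" "y \<in> carrier (FX (SXn n))" by (simp_all add: sFbar_level)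
  interpret FX: module k "FX (SXn n)" by (rule module_FX[OF gset_SXn])
  show "pi_hat G M X (Fbar.cls n (x \<oplus>\<^bsub>level (sFbar G M SX) n\<^esub> y) t) =
    pi_hat G M X (Fbar.cls n x t) \<otimes>\<^bsub>add_monoid (FX D)\<^esub> pi_hat G M X (Fbar.cls n y t)"
    using linear_maps_add[OF linear_maps_FX_dom[OF Fpush_linear[OF gmap_eval[OF t]]] xy] FX.M.a_closed[OF xy]
    by (simp add: pi_hat_class xy t sFbar_level FX_simps del: FM_simps)
qed

text \<open>Points are constant \<open>0\<close>-simplices.\<close>

lemma pi_hat_surj: "pi_hat G M X ` carrier (real_group (sFbar G M SX)) = carrier (FX D)"
proof
  show "pi_hat G M X ` carrier (real_group (sFbar G M SX)) \<subseteq> carrier (FX D)"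
    using pi_hat_in by (auto simp: Fbar.carrier_real_group)
  show "carrier (FX D) \<subseteq> pi_hat G M X ` carrier (real_group (sFbar G M SX))"
  proof
    fix u assume u: "u \<in> carrier (FX D)"
    \<comment> \<open>A G-map from the points of X to the 0-simplices, with evaluation at the only
      point \<open>v\<close> as left inverse; by functoriality the image of \<open>u\<close> under
      \<open>s\<close> is then a preimage of \<open>u\<close>.\<close>
    define s where "s = (\<lambda>x. \<lambda>t\<in>standard_simplex 0. x :: 'x)"
    define v :: "nat \<Rightarrow> real" where "v = (\<lambda>j. if j = 0 then 1 else 0)"
    have v: "v \<in> standard_simplex 0" by (simp add: v_def)
    have ss: "singular_simplex 0 (gtop X) (s x)" if "x \<in> topspace (gtop X)" for x
      unfolding s_def using that by (simp add: singular_simplex_restrict)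
    have s: "gmap D (SXn 0) s"
      unfolding gmap_def using gset_D gset_SXn ss
      by (auto simp: SXn_simps discrete_gset_def) (auto simp: s_def intro!: restrict_ext)
    let ?w = "Fpush G M D (SXn 0) s u"
    have w: "?w \<in> carrier (FX (SXn 0))" by (rule Fpush_FX[OF s u])
    have "pi_hat G M X (Fbar.cls 0 ?w v) = Fpush G M D D (\<lambda>x. x) u"
      unfolding pi_hat_class[OF w v]
      by (rule Fpush_comp[OF s gmap_eval[OF v] FX_FM[OF u]]) (simp add: s_def v)
    also have "\<dots> = u" by (rule Fpush_id[OF gset_D FX_FM[OF u]])
    finally show "u \<in> pi_hat G M X ` carrier (real_group (sFbar G M SX))"
      using Fbar.cls_in[of ?w 0 v] w v by (metis image_eqI sFbar_level)
  qed
qed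

lemma topspace_FFhat: "topspace (FFhat_top G M X) = carrier (FX D)"
  unfolding FFhat_top_def topspace_identification_topology
  using pi_hat_surj by (simp add: Fbar.carrier_real_group)

text \<open>That \<beta> \<pi> maps into and onto the fixed elements is read off from \<alpha> and
  \<open>pi_hat\<close>, through \<open>beta_pi_map\<close> and \<open>alpha_pi_hat\<close>
  respectively.\<close>

lemma topspace_FFG: "topspace (FFG_top G M X) = carrier (FX D)"
proof -
  have *: "topspace (FFG_top G M X) = (\<lambda>c. beta G M D (pi_map G M X c)) ` topspace (real_top (sF G M SX))"
    unfolding FFG_top_def FF_top_def topspace_identification_topology by (simp add: image_image)
  show ?thesis
    unfolding *
  proof
    show "(\<lambda>c. beta G M D (pi_map G M X c)) ` topspace (real_top (sF G M SX)) \<subseteq> carrier (FX D)"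
    proof (rule image_subsetI)
      fix c assume c: "c \<in> topspace (real_top (sF G M SX))"
      then have "E c \<in> topspace (real_top (sFbar G M SX))"
        using continuous_map_image_subset_topspace[OF continuous_E] by blast
      then show "beta G M D (pi_map G M X c) \<in> carrier (FX D)"
        unfolding beta_pi_map[OF c] by (intro linear_maps_closed[OF alpha_linear[OF gset_D]] pi_hat_in)
    qed
    show "carrier (FX D) \<subseteq> (\<lambda>c. beta G M D (pi_map G M X c)) ` topspace (real_top (sF G M SX))"
    proof
      fix u assume "u \<in> carrier (FX D)"
      then obtain w where w: "w \<in> carrier (FX D)" "u = alpha G M D w"
        using alpha_bij(1)[OF gset_D] by (metis bij_betw_def imageE)
      then obtain c where c: "c \<in> topspace (real_top (sFbar G M SX))" "w = pi_hat G M X c"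
        using pi_hat_surj by (metis Fbar.carrier_real_group imageE)
      then show "u \<in> (\<lambda>c. beta G M D (pi_map G M X c)) ` topspace (real_top (sF G M SX))"
        using w alpha_pi_hat[OF c(1)] continuous_map_image_subset_topspace[OF continuous_J] by blast
    qed
  qed
qed

lemma openin_FFhat:
  "openin (FFhat_top G M X) U \<longleftrightarrow> U \<subseteq> carrier (FX D) \<and>
     openin (real_top (sFbar G M SX)) {c \<in> topspace (real_top (sFbar G M SX)). pi_hat G M X c \<in> U}"
  using topspace_FFhat unfolding FFhat_top_def openin_identification_topology topspace_identification_topology by simp

text \<open>The identifications along \<pi> and \<beta> compose to one, so openness can be tested on
  |F| directly.\<close>

lemma openin_FFG:
  "openin (FFG_top G M X) U \<longleftrightarrow> U \<subseteq> carrier (FX D) \<and>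
     openin (real_top (sF G M SX)) {c \<in> topspace (real_top (sF G M SX)). beta G M D (pi_map G M X c) \<in> U}"
proof -
  have eq: "{c \<in> topspace (real_top (sF G M SX)). pi_map G M X c \<in> {x \<in> topspace (FF_top G M X). beta G M D x \<in> U}} =
    {c \<in> topspace (real_top (sF G M SX)). beta G M D (pi_map G M X c) \<in> U}"
    by (auto simp: FF_top_def topspace_identification_topology)
  have "{x \<in> topspace (FF_top G M X). beta G M D x \<in> U} \<subseteq> pi_map G M X ` topspace (real_top (sF G M SX))"
    by (auto simp: FF_top_def topspace_identification_topology)
  then show ?thesis
    using topspace_FFG eq unfolding FFG_top_def openin_identification_topology topspace_identification_topology
    by (simp add: FF_top_def openin_identification_topology)
qed

text \<open>\<open>?A\<close> is the preimage of \<open>?B\<close> under \<open>J\<close>, and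
  \<open>?B\<close> is the preimage of \<open>?A\<close> under \<open>E\<close>. Continuity of these
  two maps therefore suffices, although they are not inverse to each other in general.\<close>

lemma homeomorphic_map_alpha: "homeomorphic_map (FFhat_top G M X) (FFG_top G M X) (alpha G M D)"
proof -
  have bij: "bij_betw (alpha G M D) (carrier (FX D)) (carrier (FX D))" by (rule alpha_bij(1)[OF gset_D])
  have "openin (FFhat_top G M X) {x \<in> topspace (FFhat_top G M X). alpha G M D x \<in> U} \<longleftrightarrow> openin (FFG_top G M X) U"
    if U: "U \<subseteq> carrier (FX D)" for U
  proof -
    let ?A = "{c \<in> topspace (real_top (sFbar G M SX)). alpha G M D (pi_hat G M X c) \<in> U}"
    let ?B = "{c \<in> topspace (real_top (sF G M SX)). beta G M D (pi_map G M X c) \<in> U}"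
    have "openin (real_top (sFbar G M SX)) ?A" if B: "openin (real_top (sF G M SX)) ?B"
    proof -
      have "?A = {c \<in> topspace (real_top (sFbar G M SX)). J c \<in> ?B}"
        using alpha_pi_hat continuous_map_image_subset_topspace[OF continuous_J] by auto
      then show ?thesis using openin_continuous_map_preimage[OF continuous_J B] by simp
    qed
    moreover have "openin (real_top (sF G M SX)) ?B" if A: "openin (real_top (sFbar G M SX)) ?A"
    proof -
      have "?B = {c \<in> topspace (real_top (sF G M SX)). E c \<in> ?A}"
        using beta_pi_map continuous_map_image_subset_topspace[OF continuous_E] by auto
      then show ?thesis using openin_continuous_map_preimage[OF continuous_E A] by simp
    qed
    moreover have "{c \<in> topspace (real_top (sFbar G M SX)). pi_hat G M X c \<in> {x \<in> carrier (FX D). alpha G M D x \<in> U}} = ?A"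
      using pi_hat_in by auto
    ultimately show ?thesis
      using U unfolding openin_FFhat openin_FFG topspace_FFhat by auto
  qed
  then show ?thesis
    using bij by (simp add: homeomorphic_map_def quotient_map_def topspace_FFhat topspace_FFG bij_betw_def)
qed

text \<open>The source is a quotient of a realization along the homomorphism \<open>pi_hat\<close>;
  the group topology of the target is transported along \<alpha>.\<close>

lemma topological_group_iso_alpha:
  fixes h :: "(nat \<Rightarrow> real) \<Rightarrow> 'z"
  assumes h: "inj h" and inf: "infinite (UNIV :: 'z set)"
  shows "topological_group_iso TYPE('z) (add_monoid (FX D)) (FFhat_top G M X)
    (add_monoid (FX D)) (FFG_top G M X) (alpha G M D)"
proof -
  interpret FX: module k "FX D" by (rule module_FX[OF gset_D])
  have grp: "group (add_monoid (FX D))" by (rule FX.M.a_group)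
  have hat: "k_topological_group TYPE('z) (add_monoid (FX D)) (FFhat_top G M X)"
    unfolding FFhat_top_def
    using pi_hat_surj
    by (intro k_topological_group_quotient[OF inf Fbar.k_topological_group_realization[OF h inf] grp pi_hat_hom]) simp
  have iso: "alpha G M D \<in> iso (add_monoid (FX D)) (add_monoid (FX D))"
    using alpha_bij(1)[OF gset_D] linear_maps_closed[OF alpha_linear[OF gset_D]] linear_maps_add[OF alpha_linear[OF gset_D]]
    by (auto simp: iso_def hom_def)
  show ?thesis
    using hat iso homeomorphic_map_alpha k_topological_group_homeomorphic[OF inf hat grp iso homeomorphic_map_alpha]
    by (simp add: topological_group_iso_def)
qed

end

theorem proposition4p2:
  fixes G :: "('g, 'a) monoid_scheme"
    and k :: "('k, 'b) ring_scheme"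
    and M :: "('g, 'k, 'm) coefficients"
    and X :: "('g, 'x) pointed_gspace"
  assumes "group G" and "finite (carrier G)"
    and "field k"
    and "ring_char k = 0 \<or>
         (Factorial_Ring.prime (ring_char k) \<and> \<not> ring_char k dvd order G)"
    and "coefficient_system G k M"
    and "is_pointed_gspace G X"
  shows "topological_group_iso TYPE('z + (nat \<Rightarrow> real))
           (real_group (sFbar G M (Sing X))) (real_top (sFbar G M (Sing X)))
           (real_group (sFG G k M (Sing X))) (real_top (sFG G k M (Sing X)))
           (real_alpha G k M X) \<and>
         topological_group_iso TYPE('z + (nat \<Rightarrow> real))
           (add_monoid (Ffix G M (discrete_gset X))) (FFhat_top G M X)
           (add_monoid (Ffix G M (discrete_gset X))) (FFG_top G M X)
           (alpha G M (discrete_gset X))"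
proof -
  interpret G: group G by fact
  interpret k: Ring.field k by fact
  have "nat_in k (order G) \<noteq> \<zero>\<^bsub>k\<^esub>"
  proof (rule ring_char_order_nonzero[OF k.ring_axioms])
    show "\<one>\<^bsub>k\<^esub> \<noteq> \<zero>\<^bsub>k\<^esub>" by simp
    show "0 < order G" using assms(2) G.order_gt_0_iff_finite by blast
  qed (use assms(4) in blast)
  then interpret coefficients_gspace G k M X
    using assms by unfold_locales
  \<comment> \<open>The right summand holds the simplices, and its constant functions make the type
    infinite, as the products of test spaces require.\<close>
  let ?h = "Inr :: (nat \<Rightarrow> real) \<Rightarrow> 'z + (nat \<Rightarrow> real)"
  have h: "inj ?h" by simp
  have inf: "infinite (UNIV :: ('z + (nat \<Rightarrow> real)) set)"
  proof
    assume "finite (UNIV :: ('z + (nat \<Rightarrow> real)) set)"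
    moreover have "inj (\<lambda>r::real. ?h (\<lambda>_. r))" by (auto simp: inj_on_def fun_eq_iff)
    ultimately have "finite (UNIV :: real set)"
      by (metis finite_imageD finite_subset subset_UNIV)
    then show False using infinite_UNIV_char_0 by blast
  qed
  show ?thesis
    unfolding real_alpha_def
    using topological_group_iso_real_alpha[OF simplicial_gset_SX h inf] topological_group_iso_alpha[OF h inf]
    by blast
qed

end
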